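(* Let $R$ be a commutative ring. The category $\mathbf{Mod}^{\mathrm{op}}$ is enriched in $\mathbf{Comod}$, with hom-objects $\mathbf{Mod}^{\mathrm{op}}(M,N)=Q(N,M)$: there is a $\mathbf{Comod}$-enriched category with the same objects as $\mathbf{Mod}^{\mathrm{op}}$, with hom-object from $M$ to $N$ the universal measuring comodule $Q(N,M)$, and with underlying ordinary category $\mathbf{Mod}^{\mathrm{op}}$.
   Context: $\mathbf{Alg}_R$ and $\mathbf{Coalg}_R$ are the categories of $R$-algebras and $R$-coalgebras (monoids and comonoids in the symmetric monoidal closed category of $R$-modules). For an algebra $A$, modules are left $A$-modules $\mu:A\otimes M\to M$; for a coalgebra $C$, comodules are right $C$-comodules $\delta:X\to X\otimes C$, written $\delta(x)=\sum x_{(0)}\otimes x_{(1)}$. Global category of comodules $\mathbf{Comod}$: objects are all comodules $X$ over all $R$-coalgebras $C$, written $X_C$; a morphism $X_C\to Y_D$ is a pair $(k,g)$ with $g:C\to D$ a coalgebra map and $k:g_*X\to Y$ a $D$-comodule map, where $g_*X$ is $X$ with coaction $X\xrightarrow{\delta}X\otimes C\xrightarrow{1\otimes g}X\otimes D$. It is symmetric monoidal: $X_C\otimes Y_D$ is $X\otimes_R Y$ with the $C\otimes D$-coaction $X\otimes Y\xrightarrow{\delta_X\otimes\delta_Y}X\otimes C\otimes Y\otimes D\cong X\otimes Y\otimes C\otimes D$; the unit is $R$ as a comodule over the coalgebra $R$. Global category of modules $\mathbf{Mod}$: objects are all modules $M$ over all $R$-algebras $A$, written $M_A$; a morphism $M_A\to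 N_B$ is a pair $(m,f)$ with $f:A\to B$ an algebra map and $m:M\to f^\sharp N$ an $A$-module map, where $f^\sharp N$ is $N$ with action $A\otimes N\xrightarrow{f\otimes1}B\otimes N\xrightarrow{\mu}N$. For a coalgebra $C$ and an algebra $B$, $\mathrm{Hom}_R(C,B)$ is an algebra under convolution $(f*g)(c)=\sum f(c_1)g(c_2)$, with unit $\eta\circ\epsilon$. For a $C$-comodule $X$ and a $B$-module $N$, $\mathrm{Hom}(X,N)$ denotes the $R$-module $\mathrm{Hom}_R(X,N)$ with the $\mathrm{Hom}_R(C,B)$-action whose transpose is the composite $\mathrm{Hom}_R(C,B)\otimes\mathrm{Hom}_R(X,N)\otimes X\xrightarrow{1\otimes1\otimes\delta}\mathrm{Hom}_R(C,B)\otimes\mathrm{Hom}_R(X,N)\otimes X\otimes C\cong\mathrm{Hom}_R(C,B)\otimes C\otimes\mathrm{Hom}_R(X,N)\otimes X\xrightarrow{e\otimes e}B\otimes N\xrightarrow{\mu}N$, where the isomorphism is the symmetry and $e$ is evaluation; on elements, $(f\cdot\varphi)(x)=\sum f(x_{(1)})\,\varphi(x_{(0)})$. This gives a functor $\mathrm{Hom}:\mathbf{Comod}^{\mathrm{op}}\times\mathbf{Mod}\to\mathbf{Mod}$, $(X_C,N_B)\mapsto\mathrm{Hom}(X,N)_{\mathrm{Hom}_R(C,B)}$. The universal measuring comodule $Q(M,N)$ of $M,N\in\mathbf{Mod}$ is the object of $\mathbf{Comod}$ determined by the natural isomorphism $$\mathbf{Comod}(X,Q(M,N))\cong\mathbf{Mod}(M,\mathrm{Hom}(X,N)),$$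 i.e. $Q(-,N)$ is right adjoint to $\mathrm{Hom}(-,N)^{\mathrm{op}}:\mathbf{Comod}\to\mathbf{Mod}^{\mathrm{op}}$ (it exists for all $M,N$). The underlying ordinary category of a category $\mathcal{K}$ enriched in a monoidal category $\mathcal{W}$ with unit $I$ has the same objects as $\mathcal{K}$ and as morphisms $M\to N$ the arrows $I\to\mathcal{K}(M,N)$ in $\mathcal{W}$.
   Formalization: With the stated formulas Hom(X,N) need not be an associative Hom_R(C,B)-module unless C is cocommutative; Mod(M,Hom(X,N)) is therefore read as pairs (m,f), f an algebra map and m linear with m(ax)=f(a)·m(x), without requiring Hom(X,N) to be a module. *)

theory Defs
  imports "HOL-Algebra.Module"
begin

section \<open>Categories, monoidal categories, enriched categories\<close>

text \<open>Hom-sets need not be disjoint, so composition and the tensor of arrows take the objects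
  as arguments: \<open>cmp C X Y Z g f\<close> is the composite of \<open>f : X \<rightarrow> Y\<close> and \<open>g : Y \<rightarrow> Z\<close>, and
  \<open>tarr W X X' Y Y' f g\<close> is the tensor of \<open>f : X \<rightarrow> X'\<close> and \<open>g : Y \<rightarrow> Y'\<close>.\<close>

record ('o, 'h) category =
  objs :: "'o set"
  arrs :: "'o \<Rightarrow> 'o \<Rightarrow> 'h set"
  ident :: "'o \<Rightarrow> 'h"
  cmp :: "'o \<Rightarrow> 'o \<Rightarrow> 'o \<Rightarrow> 'h \<Rightarrow> 'h \<Rightarrow> 'h"

locale category =
  fixes C :: "('o, 'h, 'z) category_scheme"
  assumes ident_arr: "X \<in> objs C \<Longrightarrow> ident C X \<in> arrs C X X"
    and cmp_arr: "\<lbrakk>X \<in> objs C; Y \<in> objs C; Z \<in> objs C; f \<in> arrs C X Y; g \<in> arrs C Y Z\<rbrakk>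
      \<Longrightarrow> cmp C X Y Z g f \<in> arrs C X Z"
    and cmp_ident_left: "\<lbrakk>X \<in> objs C; Y \<in> objs C; f \<in> arrs C X Y\<rbrakk>
      \<Longrightarrow> cmp C X Y Y (ident C Y) f = f"
    and cmp_ident_right: "\<lbrakk>X \<in> objs C; Y \<in> objs C; f \<in> arrs C X Y\<rbrakk>
      \<Longrightarrow> cmp C X X Y f (ident C X) = f"
    and cmp_assoc: "\<lbrakk>W \<in> objs C; X \<in> objs C; Y \<in> objs C; Z \<in> objs C;
        f \<in> arrs C W X; g \<in> arrs C X Y; h \<in> arrs C Y Z\<rbrakk>
      \<Longrightarrow> cmp C W X Z (cmp C X Y Z h g) f = cmp C W Y Z h (cmp C W X Y g f)"

definition opposite :: "('o, 'h, 'z) category_scheme \<Rightarrow> ('o, 'h) category" where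
  "opposite C = \<lparr>objs = objs C, arrs = (\<lambda>X Y. arrs C Y X), ident = ident C,
     cmp = (\<lambda>X Y Z g f. cmp C Z Y X f g)\<rparr>"

definition inverse_arrows ::
  "('o, 'h, 'z) category_scheme \<Rightarrow> 'o \<Rightarrow> 'o \<Rightarrow> 'h \<Rightarrow> 'h \<Rightarrow> bool" where
  "inverse_arrows C X Y f g \<longleftrightarrow> f \<in> arrs C X Y \<and> g \<in> arrs C Y X \<and>
     cmp C X Y X g f = ident C X \<and> cmp C Y X Y f g = ident C Y"

definition iso_arrow :: "('o, 'h, 'z) category_scheme \<Rightarrow> 'o \<Rightarrow> 'o \<Rightarrow> 'h \<Rightarrow> bool" where
  "iso_arrow C X Y f \<longleftrightarrow> (\<exists>g. inverse_arrows C X Y f g)"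

definition inverse_arrow :: "('o, 'h, 'z) category_scheme \<Rightarrow> 'o \<Rightarrow> 'o \<Rightarrow> 'h \<Rightarrow> 'h" where
  "inverse_arrow C X Y f = (THE g. inverse_arrows C X Y f g)"

definition isomorphic_over_objects ::
  "('o, 'h, 'z) category_scheme \<Rightarrow> ('o, 'k, 'y) category_scheme \<Rightarrow> bool" where
  "isomorphic_over_objects C D \<longleftrightarrow> objs C = objs D \<and>
     (\<exists>F :: 'o \<Rightarrow> 'o \<Rightarrow> 'h \<Rightarrow> 'k.
        (\<forall>X\<in>objs C. \<forall>Y\<in>objs C. bij_betw (F X Y) (arrs C X Y) (arrs D X Y)) \<and>
        (\<forall>X\<in>objs C. F X X (ident C X) = ident D X) \<and>
        (\<forall>X\<in>objs C. \<forall>Y\<in>objs C. \<forall>Z\<in>objs C. \<forall>f\<in>arrs C X Y. \<forall>g\<in>arrs C Y Z.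
           F X Z (cmp C X Y Z g f) = cmp D X Y Z (F Y Z g) (F X Y f)))"

record ('o, 'h) monoidal_category = "('o, 'h) category" +
  unit_obj :: "'o"
  tobj :: "'o \<Rightarrow> 'o \<Rightarrow> 'o"
  tarr :: "'o \<Rightarrow> 'o \<Rightarrow> 'o \<Rightarrow> 'o \<Rightarrow> 'h \<Rightarrow> 'h \<Rightarrow> 'h"
  assoc_arr :: "'o \<Rightarrow> 'o \<Rightarrow> 'o \<Rightarrow> 'h"
  lunit_arr :: "'o \<Rightarrow> 'h"
  runit_arr :: "'o \<Rightarrow> 'h"

locale monoidal_category = category W
  for W :: "('o, 'h, 'z) monoidal_category_scheme" +
  assumes unit_obj: "unit_obj W \<in> objs W"
    and tobj: "\<lbrakk>X \<in> objs W; Y \<in> objs W\<rbrakk> \<Longrightarrow> tobj W X Y \<in> objs W"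
    and tarr: "\<lbrakk>X \<in> objs W; X' \<in> objs W; Y \<in> objs W; Y' \<in> objs W;
        f \<in> arrs W X X'; g \<in> arrs W Y Y'\<rbrakk>
      \<Longrightarrow> tarr W X X' Y Y' f g \<in> arrs W (tobj W X Y) (tobj W X' Y')"
    and tarr_ident: "\<lbrakk>X \<in> objs W; Y \<in> objs W\<rbrakk>
      \<Longrightarrow> tarr W X X Y Y (ident W X) (ident W Y) = ident W (tobj W X Y)"
    and tarr_cmp: "\<lbrakk>X \<in> objs W; X' \<in> objs W; X'' \<in> objs W; Y \<in> objs W; Y' \<in> objs W; Y'' \<in> objs W;
        f \<in> arrs W X X'; f' \<in> arrs W X' X''; g \<in> arrs W Y Y'; g' \<in> arrs W Y' Y''\<rbrakk>
      \<Longrightarrow> tarr W X X'' Y Y'' (cmp W X X' X'' f' f) (cmp W Y Y' Y'' g' g) =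
          cmp W (tobj W X Y) (tobj W X' Y') (tobj W X'' Y'')
            (tarr W X' X'' Y' Y'' f' g') (tarr W X X' Y Y' f g)"
    and assoc_iso: "\<lbrakk>X \<in> objs W; Y \<in> objs W; Z \<in> objs W\<rbrakk>
      \<Longrightarrow> iso_arrow W (tobj W (tobj W X Y) Z) (tobj W X (tobj W Y Z)) (assoc_arr W X Y Z)"
    and assoc_natural: "\<lbrakk>X \<in> objs W; X' \<in> objs W; Y \<in> objs W; Y' \<in> objs W; Z \<in> objs W; Z' \<in> objs W;
        f \<in> arrs W X X'; g \<in> arrs W Y Y'; h \<in> arrs W Z Z'\<rbrakk>
      \<Longrightarrow> cmp W (tobj W (tobj W X Y) Z) (tobj W (tobj W X' Y') Z') (tobj W X' (tobj W Y' Z'))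
            (assoc_arr W X' Y' Z')
            (tarr W (tobj W X Y) (tobj W X' Y') Z Z' (tarr W X X' Y Y' f g) h) =
          cmp W (tobj W (tobj W X Y) Z) (tobj W X (tobj W Y Z)) (tobj W X' (tobj W Y' Z'))
            (tarr W X X' (tobj W Y Z) (tobj W Y' Z') f (tarr W Y Y' Z Z' g h))
            (assoc_arr W X Y Z)"
    and lunit_iso: "X \<in> objs W \<Longrightarrow> iso_arrow W (tobj W (unit_obj W) X) X (lunit_arr W X)"
    and lunit_natural: "\<lbrakk>X \<in> objs W; X' \<in> objs W; f \<in> arrs W X X'\<rbrakk>
      \<Longrightarrow> cmp W (tobj W (unit_obj W) X) (tobj W (unit_obj W) X') X' (lunit_arr W X')
            (tarr W (unit_obj W) (unit_obj W) X X' (ident W (unit_obj W)) f) =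
          cmp W (tobj W (unit_obj W) X) X X' f (lunit_arr W X)"
    and runit_iso: "X \<in> objs W \<Longrightarrow> iso_arrow W (tobj W X (unit_obj W)) X (runit_arr W X)"
    and runit_natural: "\<lbrakk>X \<in> objs W; X' \<in> objs W; f \<in> arrs W X X'\<rbrakk>
      \<Longrightarrow> cmp W (tobj W X (unit_obj W)) (tobj W X' (unit_obj W)) X' (runit_arr W X')
            (tarr W X X' (unit_obj W) (unit_obj W) f (ident W (unit_obj W))) =
          cmp W (tobj W X (unit_obj W)) X X' f (runit_arr W X)"
    and pentagon: "\<lbrakk>V \<in> objs W; X \<in> objs W; Y \<in> objs W; Z \<in> objs W\<rbrakk>
      \<Longrightarrow> cmp W (tobj W (tobj W (tobj W V X) Y) Z) (tobj W (tobj W V X) (tobj W Y Z))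
              (tobj W V (tobj W X (tobj W Y Z)))
            (assoc_arr W V X (tobj W Y Z)) (assoc_arr W (tobj W V X) Y Z) =
          cmp W (tobj W (tobj W (tobj W V X) Y) Z) (tobj W V (tobj W (tobj W X Y) Z))
              (tobj W V (tobj W X (tobj W Y Z)))
            (tarr W V V (tobj W (tobj W X Y) Z) (tobj W X (tobj W Y Z))
              (ident W V) (assoc_arr W X Y Z))
            (cmp W (tobj W (tobj W (tobj W V X) Y) Z) (tobj W (tobj W V (tobj W X Y)) Z)
                (tobj W V (tobj W (tobj W X Y) Z))
              (assoc_arr W V (tobj W X Y) Z)
              (tarr W (tobj W (tobj W V X) Y) (tobj W V (tobj W X Y)) Z Z
                (assoc_arr W V X Y) (ident W Z)))"
    and triangle: "\<lbrakk>X \<in> objs W; Y \<in> objs W\<rbrakk>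
      \<Longrightarrow> cmp W (tobj W (tobj W X (unit_obj W)) Y) (tobj W X (tobj W (unit_obj W) Y)) (tobj W X Y)
            (tarr W X X (tobj W (unit_obj W) Y) Y (ident W X) (lunit_arr W Y))
            (assoc_arr W X (unit_obj W) Y) =
          tarr W (tobj W X (unit_obj W)) X Y Y (runit_arr W X) (ident W Y)"

text \<open>\<open>ecmp K L M N : K(M,N) \<otimes> K(L,M) \<rightarrow> K(L,N)\<close>.\<close>

record ('e, 'o, 'h) enriched_category =
  eobjs :: "'e set"
  ehom :: "'e \<Rightarrow> 'e \<Rightarrow> 'o"
  eident :: "'e \<Rightarrow> 'h"
  ecmp :: "'e \<Rightarrow> 'e \<Rightarrow> 'e \<Rightarrow> 'h"

locale enriched_category = monoidal_category W
  for W :: "('o, 'h, 'z) monoidal_category_scheme"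
    and K :: "('e, 'o, 'h, 'y) enriched_category_scheme" +
  assumes ehom: "\<lbrakk>M \<in> eobjs K; N \<in> eobjs K\<rbrakk> \<Longrightarrow> ehom K M N \<in> objs W"
    and eident: "M \<in> eobjs K \<Longrightarrow> eident K M \<in> arrs W (unit_obj W) (ehom K M M)"
    and ecmp: "\<lbrakk>L \<in> eobjs K; M \<in> eobjs K; N \<in> eobjs K\<rbrakk>
      \<Longrightarrow> ecmp K L M N \<in> arrs W (tobj W (ehom K M N) (ehom K L M)) (ehom K L N)"
    and ecmp_assoc: "\<lbrakk>L \<in> eobjs K; M \<in> eobjs K; N \<in> eobjs K; P \<in> eobjs K\<rbrakk>
      \<Longrightarrow> cmp W (tobj W (tobj W (ehom K N P) (ehom K M N)) (ehom K L M))
            (tobj W (ehom K M P) (ehom K L M)) (ehom K L P)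
            (ecmp K L M P)
            (tarr W (tobj W (ehom K N P) (ehom K M N)) (ehom K M P) (ehom K L M) (ehom K L M)
              (ecmp K M N P) (ident W (ehom K L M))) =
          cmp W (tobj W (tobj W (ehom K N P) (ehom K M N)) (ehom K L M))
            (tobj W (ehom K N P) (tobj W (ehom K M N) (ehom K L M))) (ehom K L P)
            (cmp W (tobj W (ehom K N P) (tobj W (ehom K M N) (ehom K L M)))
              (tobj W (ehom K N P) (ehom K L N)) (ehom K L P)
              (ecmp K L N P)
              (tarr W (ehom K N P) (ehom K N P) (tobj W (ehom K M N) (ehom K L M)) (ehom K L N)
                (ident W (ehom K N P)) (ecmp K L M N)))
            (assoc_arr W (ehom K N P) (ehom K M N) (ehom K L M))"
    and ecmp_ident_left: "\<lbrakk>L \<in> eobjs K; M \<in> eobjs K\<rbrakk>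
      \<Longrightarrow> cmp W (tobj W (unit_obj W) (ehom K L M)) (tobj W (ehom K M M) (ehom K L M)) (ehom K L M)
            (ecmp K L M M)
            (tarr W (unit_obj W) (ehom K M M) (ehom K L M) (ehom K L M)
              (eident K M) (ident W (ehom K L M))) =
          lunit_arr W (ehom K L M)"
    and ecmp_ident_right: "\<lbrakk>L \<in> eobjs K; M \<in> eobjs K\<rbrakk>
      \<Longrightarrow> cmp W (tobj W (ehom K L M) (unit_obj W)) (tobj W (ehom K L M) (ehom K L L)) (ehom K L M)
            (ecmp K L L M)
            (tarr W (ehom K L M) (ehom K L M) (unit_obj W) (ehom K L L)
              (ident W (ehom K L M)) (eident K L)) =
          runit_arr W (ehom K L M)"

text \<open>The composite of \<open>g : I \<rightarrow> K(M,N)\<close> and \<open>f : I \<rightarrow> K(L,M)\<close> is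
  \<open>I \<cong> I \<otimes> I \<rightarrow> K(M,N) \<otimes> K(L,M) \<rightarrow> K(L,N)\<close>.\<close>

definition underlying_category ::
  "('o, 'h, 'z) monoidal_category_scheme \<Rightarrow> ('e, 'o, 'h, 'y) enriched_category_scheme
    \<Rightarrow> ('e, 'h) category" where
  "underlying_category W K = (let I = unit_obj W in
     \<lparr>objs = eobjs K,
      arrs = (\<lambda>M N. arrs W I (ehom K M N)),
      ident = eident K,
      cmp = (\<lambda>L M N g f.
        cmp W I (tobj W (ehom K M N) (ehom K L M)) (ehom K L N)
          (ecmp K L M N)
          (cmp W I (tobj W I I) (tobj W (ehom K M N) (ehom K L M))
            (tarr W I (ehom K M N) I (ehom K L M) g f)
            (inverse_arrow W (tobj W I I) I (lunit_arr W I))))\<rparr>)"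


section \<open>Modules over a commutative ring and their tensor products\<close>

text \<open>Only the carrier, \<open>\<zero>\<close>, \<open>\<oplus>\<close> and \<open>\<odot>\<close> of a \<^typ>\<open>('r, 'm) module\<close> record matter for a module;
  the inherited \<open>\<otimes>\<close> and \<open>\<one>\<close> are used only when the record stands for an algebra. Linear maps,
  and hence all arrows below, are extensional functions, so that equality of arrows is equality
  on carriers.\<close>

definition lin ::
  "('r, 'z) ring_scheme \<Rightarrow> ('r, 'm) module \<Rightarrow> ('r, 'n) module \<Rightarrow> ('m \<Rightarrow> 'n) set" where
  "lin R M N = {h \<in> carrier M \<rightarrow>\<^sub>E carrier N.
     (\<forall>x\<in>carrier M. \<forall>y\<in>carrier M. h (x \<oplus>\<^bsub>M\<^esub> y) = h x \<oplus>\<^bsub>N\<^esub> h y) \<and>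
     (\<forall>r\<in>carrier R. \<forall>x\<in>carrier M. h (r \<odot>\<^bsub>M\<^esub> x) = r \<odot>\<^bsub>N\<^esub> h x)}"

definition ring_module :: "('r, 'z) ring_scheme \<Rightarrow> ('r, 'r) module" where
  "ring_module R = \<lparr>carrier = carrier R, mult = mult R, one = one R, zero = zero R, add = add R,
     smult = mult R\<rparr>"

text \<open>A list of pairs \<open>[(x\<^sub>1,y\<^sub>1),\<dots>,(x\<^sub>n,y\<^sub>n)]\<close> is a formal sum of symbols \<open>x\<^sub>i \<otimes> y\<^sub>i\<close>; the tensor
  product is the quotient of formal sums by the congruence making these symbols bilinear.\<close>

definition formal_sums :: "('r, 'x) module \<Rightarrow> ('r, 'y) module \<Rightarrow> ('x \<times> 'y) list set" where
  "formal_sums X Y = lists (carrier X \<times> carrier Y)"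

inductive tensor_eq ::
  "('r, 'z) ring_scheme \<Rightarrow> ('r, 'x) module \<Rightarrow> ('r, 'y) module
    \<Rightarrow> ('x \<times> 'y) list \<Rightarrow> ('x \<times> 'y) list \<Rightarrow> bool"
  for R X Y where
  refl: "s \<in> formal_sums X Y \<Longrightarrow> tensor_eq R X Y s s"
| sym: "tensor_eq R X Y s t \<Longrightarrow> tensor_eq R X Y t s"
| trans: "\<lbrakk>tensor_eq R X Y s t; tensor_eq R X Y t u\<rbrakk> \<Longrightarrow> tensor_eq R X Y s u"
| append: "\<lbrakk>tensor_eq R X Y s s'; tensor_eq R X Y t t'\<rbrakk> \<Longrightarrow> tensor_eq R X Y (s @ t) (s' @ t')"
| commute: "\<lbrakk>s \<in> formal_sums X Y; t \<in> formal_sums X Y\<rbrakk> \<Longrightarrow> tensor_eq R X Y (s @ t) (t @ s)"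
| zero: "y \<in> carrier Y \<Longrightarrow> tensor_eq R X Y [(\<zero>\<^bsub>X\<^esub>, y)] []"
| add_left: "\<lbrakk>x \<in> carrier X; x' \<in> carrier X; y \<in> carrier Y\<rbrakk>
    \<Longrightarrow> tensor_eq R X Y [(x \<oplus>\<^bsub>X\<^esub> x', y)] [(x, y), (x', y)]"
| add_right: "\<lbrakk>x \<in> carrier X; y \<in> carrier Y; y' \<in> carrier Y\<rbrakk>
    \<Longrightarrow> tensor_eq R X Y [(x, y \<oplus>\<^bsub>Y\<^esub> y')] [(x, y), (x, y')]"
| balanced: "\<lbrakk>r \<in> carrier R; x \<in> carrier X; y \<in> carrier Y\<rbrakk>
    \<Longrightarrow> tensor_eq R X Y [(r \<odot>\<^bsub>X\<^esub> x, y)] [(x, r \<odot>\<^bsub>Y\<^esub> y)]"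

text \<open>Coalgebras and comodules, and the ring \<open>R\<close>, have their carriers inside one type \<open>'u\<close>, and
  this collection has to be closed under tensor products. There are at most as many formal sums
  as elements of \<open>'u\<close> if \<open>'u\<close> is infinite, and then the equivalence classes can be named by
  elements of \<open>'u\<close>: \<open>tsum R X Y [(x\<^sub>1,y\<^sub>1),\<dots>,(x\<^sub>n,y\<^sub>n)]\<close> is the element
  \<open>x\<^sub>1 \<otimes> y\<^sub>1 + \<dots> + x\<^sub>n \<otimes> y\<^sub>n\<close> of the tensor product. For finite \<open>'u\<close> this is not meaningful.\<close>

definition tsum ::
  "('u, 'z) ring_scheme \<Rightarrow> ('u, 'u) module \<Rightarrow> ('u, 'u) module \<Rightarrow> ('u \<times> 'u) list \<Rightarrow> 'u" where
  "tsum R X Y = (SOME q. \<forall>s\<in>formal_sums X Y. \<forall>t\<in>formal_sums X Y.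
     q s = q t \<longleftrightarrow> tensor_eq R X Y s t)"

definition trep ::
  "('u, 'z) ring_scheme \<Rightarrow> ('u, 'u) module \<Rightarrow> ('u, 'u) module \<Rightarrow> 'u \<Rightarrow> ('u \<times> 'u) list" where
  "trep R X Y a = (SOME s. s \<in> formal_sums X Y \<and> tsum R X Y s = a)"

definition tensor ::
  "('u, 'z) ring_scheme \<Rightarrow> ('u, 'u) module \<Rightarrow> ('u, 'u) module \<Rightarrow> ('u, 'u) module" where
  "tensor R X Y = \<lparr>carrier = tsum R X Y ` formal_sums X Y, mult = undefined, one = undefined,
     zero = tsum R X Y [],
     add = (\<lambda>a b. tsum R X Y (trep R X Y a @ trep R X Y b)),
     smult = (\<lambda>r a. tsum R X Y (map (\<lambda>(x, y). (r \<odot>\<^bsub>X\<^esub> x, y)) (trep R X Y a)))\<rparr>"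

definition pure ::
  "('u, 'z) ring_scheme \<Rightarrow> ('u, 'u) module \<Rightarrow> ('u, 'u) module \<Rightarrow> 'u \<Rightarrow> 'u \<Rightarrow> 'u" where
  "pure R X Y x y = tsum R X Y [(x, y)]"

text \<open>For bilinear \<open>b\<close>, the linear map from the tensor product to \<open>P\<close> with \<open>x \<otimes> y \<mapsto> b x y\<close>.\<close>

definition tlift ::
  "('u, 'z) ring_scheme \<Rightarrow> ('u, 'u) module \<Rightarrow> ('u, 'u) module \<Rightarrow> ('u, 'p) module
    \<Rightarrow> ('u \<Rightarrow> 'u \<Rightarrow> 'p) \<Rightarrow> 'u \<Rightarrow> 'p" where
  "tlift R X Y P b = (\<lambda>a\<in>carrier (tensor R X Y).
     foldr (\<lambda>(x, y) p. b x y \<oplus>\<^bsub>P\<^esub> p) (trep R X Y a) \<zero>\<^bsub>P\<^esub>)"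

definition tmap ::
  "('u, 'z) ring_scheme \<Rightarrow> ('u, 'u) module \<Rightarrow> ('u, 'u) module \<Rightarrow> ('u, 'u) module \<Rightarrow> ('u, 'u) module
    \<Rightarrow> ('u \<Rightarrow> 'u) \<Rightarrow> ('u \<Rightarrow> 'u) \<Rightarrow> 'u \<Rightarrow> 'u" where
  "tmap R X X' Y Y' f g = tlift R X Y (tensor R X' Y') (\<lambda>x y. pure R X' Y' (f x) (g y))"

definition tassoc ::
  "('u, 'z) ring_scheme \<Rightarrow> ('u, 'u) module \<Rightarrow> ('u, 'u) module \<Rightarrow> ('u, 'u) module \<Rightarrow> 'u \<Rightarrow> 'u" where
  "tassoc R X Y Z = (let P = tensor R X (tensor R Y Z) in
     tlift R (tensor R X Y) Z P
       (\<lambda>a z. tlift R X Y P (\<lambda>x y. pure R X (tensor R Y Z) x (pure R Y Z y z)) a))"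

definition tlunit :: "('u, 'z) ring_scheme \<Rightarrow> ('u, 'u) module \<Rightarrow> 'u \<Rightarrow> 'u" where
  "tlunit R X = tlift R (ring_module R) X X (\<lambda>r x. r \<odot>\<^bsub>X\<^esub> x)"

definition trunit :: "('u, 'z) ring_scheme \<Rightarrow> ('u, 'u) module \<Rightarrow> 'u \<Rightarrow> 'u" where
  "trunit R X = tlift R X (ring_module R) X (\<lambda>x r. r \<odot>\<^bsub>X\<^esub> x)"

text \<open>\<open>(X \<otimes> C) \<otimes> (Y \<otimes> D) \<cong> (X \<otimes> Y) \<otimes> (C \<otimes> D)\<close>\<close>

definition tswap_middle ::
  "('u, 'z) ring_scheme \<Rightarrow> ('u, 'u) module \<Rightarrow> ('u, 'u) module \<Rightarrow> ('u, 'u) module \<Rightarrow> ('u, 'u) module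
    \<Rightarrow> 'u \<Rightarrow> 'u" where
  "tswap_middle R X C Y D = (let P = tensor R (tensor R X Y) (tensor R C D) in
     tlift R (tensor R X C) (tensor R Y D) P
       (\<lambda>a b. tlift R X C P (\<lambda>x c. tlift R Y D P
          (\<lambda>y d. pure R (tensor R X Y) (tensor R C D) (pure R X Y x y) (pure R C D c d)) b) a))"


section \<open>Coalgebras and the global category of comodules\<close>

record 'u coalgebra =
  cmod :: "('u, 'u) module"
  comult :: "'u \<Rightarrow> 'u"
  counit :: "'u \<Rightarrow> 'u"

definition is_coalgebra :: "('u, 'z) ring_scheme \<Rightarrow> 'u coalgebra \<Rightarrow> bool" where
  "is_coalgebra R C \<longleftrightarrow> (let M = cmod C; i = (\<lambda>c\<in>carrier M. c) in
     module R M \<and> comult C \<in> lin R M (tensor R M M) \<and> counit C \<in> lin R M (ring_module R) \<and>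
     (\<forall>c\<in>carrier M.
        tassoc R M M M (tmap R M (tensor R M M) M M (comult C) i (comult C c)) =
        tmap R M M M (tensor R M M) i (comult C) (comult C c)) \<and>
     (\<forall>c\<in>carrier M. tlunit R M (tmap R M (ring_module R) M M (counit C) i (comult C c)) = c) \<and>
     (\<forall>c\<in>carrier M. trunit R M (tmap R M M M (ring_module R) i (counit C) (comult C c)) = c))"

definition coalgebra_hom ::
  "('u, 'z) ring_scheme \<Rightarrow> 'u coalgebra \<Rightarrow> 'u coalgebra \<Rightarrow> ('u \<Rightarrow> 'u) set" where
  "coalgebra_hom R C D = {g \<in> lin R (cmod C) (cmod D).
     \<forall>c\<in>carrier (cmod C).
       comult D (g c) = tmap R (cmod C) (cmod D) (cmod C) (cmod D) g g (comult C c) \<and>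
       counit D (g c) = counit C c}"

record 'u comodule =
  coalg :: "'u coalgebra"
  xmod :: "('u, 'u) module"
  coact :: "'u \<Rightarrow> 'u"

definition is_comodule :: "('u, 'z) ring_scheme \<Rightarrow> 'u comodule \<Rightarrow> bool" where
  "is_comodule R X \<longleftrightarrow>
     (let C = coalg X; M = cmod C; N = xmod X; i = (\<lambda>c\<in>carrier M. c); j = (\<lambda>x\<in>carrier N. x) in
     is_coalgebra R C \<and> module R N \<and> coact X \<in> lin R N (tensor R N M) \<and>
     (\<forall>x\<in>carrier N.
        tassoc R N M M (tmap R N (tensor R N M) M M (coact X) i (coact X x)) =
        tmap R N N M (tensor R M M) j (comult C) (coact X x)) \<and>
     (\<forall>x\<in>carrier N. trunit R N (tmap R N N M (ring_module R) j (counit C) (coact X x)) = x))"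

text \<open>The comodule \<open>g\<^sub>*X\<close> over \<open>D\<close> for a coalgebra map \<open>g\<close> from \<open>coalg X\<close> to \<open>D\<close>.\<close>

definition corestrict ::
  "('u, 'z) ring_scheme \<Rightarrow> 'u coalgebra \<Rightarrow> ('u \<Rightarrow> 'u) \<Rightarrow> 'u comodule \<Rightarrow> 'u comodule" where
  "corestrict R D g X = \<lparr>coalg = D, xmod = xmod X,
     coact = compose (carrier (xmod X))
       (tmap R (xmod X) (xmod X) (cmod (coalg X)) (cmod D) (\<lambda>x\<in>carrier (xmod X). x) g) (coact X)\<rparr>"

text \<open>Maps of comodules over the same coalgebra.\<close>

definition comodule_maps ::
  "('u, 'z) ring_scheme \<Rightarrow> 'u comodule \<Rightarrow> 'u comodule \<Rightarrow> ('u \<Rightarrow> 'u) set" where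
  "comodule_maps R X Y = (let M = cmod (coalg X) in
     {k \<in> lin R (xmod X) (xmod Y). \<forall>x\<in>carrier (xmod X).
        coact Y (k x) = tmap R (xmod X) (xmod Y) M M k (\<lambda>c\<in>carrier M. c) (coact X x)})"

definition Comod_hom ::
  "('u, 'z) ring_scheme \<Rightarrow> 'u comodule \<Rightarrow> 'u comodule \<Rightarrow> (('u \<Rightarrow> 'u) \<times> ('u \<Rightarrow> 'u)) set" where
  "Comod_hom R X Y = {(k, g). g \<in> coalgebra_hom R (coalg X) (coalg Y) \<and>
     k \<in> comodule_maps R (corestrict R (coalg Y) g X) Y}"

definition Comod_cmp ::
  "'u comodule \<Rightarrow> ('u \<Rightarrow> 'u) \<times> ('u \<Rightarrow> 'u) \<Rightarrow> ('u \<Rightarrow> 'u) \<times> ('u \<Rightarrow> 'u) \<Rightarrow> ('u \<Rightarrow> 'u) \<times> ('u \<Rightarrow> 'u)" where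
  "Comod_cmp X q p = (compose (carrier (xmod X)) (fst q) (fst p),
     compose (carrier (cmod (coalg X))) (snd q) (snd p))"

definition tensor_coalgebra ::
  "('u, 'z) ring_scheme \<Rightarrow> 'u coalgebra \<Rightarrow> 'u coalgebra \<Rightarrow> 'u coalgebra" where
  "tensor_coalgebra R C D = (let M = cmod C; N = cmod D in
     \<lparr>cmod = tensor R M N,
      comult = compose (carrier (tensor R M N)) (tswap_middle R M M N N)
        (tmap R M (tensor R M M) N (tensor R N N) (comult C) (comult D)),
      counit = tlift R M N (ring_module R) (\<lambda>c d. counit C c \<otimes>\<^bsub>R\<^esub> counit D d)\<rparr>)"

definition tensor_comodule ::
  "('u, 'z) ring_scheme \<Rightarrow> 'u comodule \<Rightarrow> 'u comodule \<Rightarrow> 'u comodule" where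
  "tensor_comodule R X Y =
     (let M = xmod X; C = cmod (coalg X); N = xmod Y; D = cmod (coalg Y) in
     \<lparr>coalg = tensor_coalgebra R (coalg X) (coalg Y),
      xmod = tensor R M N,
      coact = compose (carrier (tensor R M N)) (tswap_middle R M C N D)
        (tmap R M (tensor R M C) N (tensor R N D) (coact X) (coact Y))\<rparr>)"

definition ring_coalgebra :: "('u, 'z) ring_scheme \<Rightarrow> 'u coalgebra" where
  "ring_coalgebra R = \<lparr>cmod = ring_module R,
     comult = (\<lambda>r\<in>carrier R. pure R (ring_module R) (ring_module R) r \<one>\<^bsub>R\<^esub>),
     counit = (\<lambda>r\<in>carrier R. r)\<rparr>"

definition ring_comodule :: "('u, 'z) ring_scheme \<Rightarrow> 'u comodule" where
  "ring_comodule R = \<lparr>coalg = ring_coalgebra R, xmod = ring_module R,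
     coact = (\<lambda>r\<in>carrier R. pure R (ring_module R) (ring_module R) r \<one>\<^bsub>R\<^esub>)\<rparr>"

definition Comod ::
  "('u, 'z) ring_scheme \<Rightarrow> ('u comodule, ('u \<Rightarrow> 'u) \<times> ('u \<Rightarrow> 'u)) monoidal_category" where
  "Comod R = \<lparr>objs = {X. is_comodule R X},
     arrs = Comod_hom R,
     ident = (\<lambda>X. (\<lambda>x\<in>carrier (xmod X). x, \<lambda>c\<in>carrier (cmod (coalg X)). c)),
     cmp = (\<lambda>X Y Z q p. Comod_cmp X q p),
     unit_obj = ring_comodule R,
     tobj = tensor_comodule R,
     tarr = (\<lambda>X X' Y Y' p q.
       (tmap R (xmod X) (xmod X') (xmod Y) (xmod Y') (fst p) (fst q),
        tmap R (cmod (coalg X)) (cmod (coalg X')) (cmod (coalg Y)) (cmod (coalg Y'))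
          (snd p) (snd q))),
     assoc_arr = (\<lambda>X Y Z. (tassoc R (xmod X) (xmod Y) (xmod Z),
       tassoc R (cmod (coalg X)) (cmod (coalg Y)) (cmod (coalg Z)))),
     lunit_arr = (\<lambda>X. (tlunit R (xmod X), tlunit R (cmod (coalg X)))),
     runit_arr = (\<lambda>X. (trunit R (xmod X), trunit R (cmod (coalg X))))\<rparr>"


section \<open>Algebras and the global category of modules\<close>

text \<open>Unital associative, not necessarily commutative algebras (the library locale \<open>algebra\<close> is
  the commutative notion).\<close>

definition is_algebra :: "('r, 'z) ring_scheme \<Rightarrow> ('r, 'a) module \<Rightarrow> bool" where
  "is_algebra R A \<longleftrightarrow> module R A \<and> ring A \<and>
     (\<forall>r\<in>carrier R. \<forall>a\<in>carrier A. \<forall>b\<in>carrier A.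
        (r \<odot>\<^bsub>A\<^esub> a) \<otimes>\<^bsub>A\<^esub> b = r \<odot>\<^bsub>A\<^esub> (a \<otimes>\<^bsub>A\<^esub> b) \<and> a \<otimes>\<^bsub>A\<^esub> (r \<odot>\<^bsub>A\<^esub> b) = r \<odot>\<^bsub>A\<^esub> (a \<otimes>\<^bsub>A\<^esub> b))"

definition algebra_hom ::
  "('r, 'z) ring_scheme \<Rightarrow> ('r, 'a) module \<Rightarrow> ('r, 'b) module \<Rightarrow> ('a \<Rightarrow> 'b) set" where
  "algebra_hom R A B = lin R A B \<inter> ring_hom A B"

record ('r, 'a, 'm) amodule =
  alg :: "('r, 'a) module"
  nmod :: "('r, 'm) module"
  act :: "'a \<Rightarrow> 'm \<Rightarrow> 'm"

definition is_amodule :: "('r, 'z) ring_scheme \<Rightarrow> ('r, 'a, 'm) amodule \<Rightarrow> bool" where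
  "is_amodule R N \<longleftrightarrow> (let A = alg N; M = nmod N in
     is_algebra R A \<and> module R M \<and>
     (\<forall>a\<in>carrier A. \<forall>x\<in>carrier M. act N a x \<in> carrier M) \<and>
     (\<forall>a\<in>carrier A. \<forall>b\<in>carrier A. \<forall>x\<in>carrier M.
        act N (a \<oplus>\<^bsub>A\<^esub> b) x = act N a x \<oplus>\<^bsub>M\<^esub> act N b x \<and>
        act N (a \<otimes>\<^bsub>A\<^esub> b) x = act N a (act N b x)) \<and>
     (\<forall>a\<in>carrier A. \<forall>x\<in>carrier M. \<forall>y\<in>carrier M.
        act N a (x \<oplus>\<^bsub>M\<^esub> y) = act N a x \<oplus>\<^bsub>M\<^esub> act N a y) \<and>
     (\<forall>r\<in>carrier R. \<forall>a\<in>carrier A. \<forall>x\<in>carrier M.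
        act N (r \<odot>\<^bsub>A\<^esub> a) x = r \<odot>\<^bsub>M\<^esub> act N a x \<and> act N a (r \<odot>\<^bsub>M\<^esub> x) = r \<odot>\<^bsub>M\<^esub> act N a x) \<and>
     (\<forall>x\<in>carrier M. act N \<one>\<^bsub>A\<^esub> x = x))"

text \<open>The \<open>A\<close>-module \<open>f\<^sup>\<sharp>N\<close> for an algebra map \<open>f\<close> from \<open>A\<close> to \<open>alg N\<close>.\<close>

definition restrict_scalars ::
  "('r, 'a) module \<Rightarrow> ('a \<Rightarrow> 'b) \<Rightarrow> ('r, 'b, 'n) amodule \<Rightarrow> ('r, 'a, 'n) amodule" where
  "restrict_scalars A f N = \<lparr>alg = A, nmod = nmod N, act = (\<lambda>a x. act N (f a) x)\<rparr>"

text \<open>Maps of modules over the same algebra.\<close>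

definition module_maps ::
  "('r, 'z) ring_scheme \<Rightarrow> ('r, 'a, 'm) amodule \<Rightarrow> ('r, 'a, 'n) amodule \<Rightarrow> ('m \<Rightarrow> 'n) set" where
  "module_maps R M N = {m \<in> lin R (nmod M) (nmod N).
     \<forall>a\<in>carrier (alg M). \<forall>x\<in>carrier (nmod M). m (act M a x) = act N a (m x)}"

definition Mod_hom ::
  "('r, 'z) ring_scheme \<Rightarrow> ('r, 'a, 'm) amodule \<Rightarrow> ('r, 'b, 'n) amodule
    \<Rightarrow> (('m \<Rightarrow> 'n) \<times> ('a \<Rightarrow> 'b)) set" where
  "Mod_hom R M N = {(m, f). f \<in> algebra_hom R (alg M) (alg N) \<and>
     m \<in> module_maps R M (restrict_scalars (alg M) f N)}"

definition Mod_cmp ::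
  "('r, 'a, 'm) amodule \<Rightarrow> ('n \<Rightarrow> 'p) \<times> ('b \<Rightarrow> 'c) \<Rightarrow> ('m \<Rightarrow> 'n) \<times> ('a \<Rightarrow> 'b)
    \<Rightarrow> ('m \<Rightarrow> 'p) \<times> ('a \<Rightarrow> 'c)" where
  "Mod_cmp M q p = (compose (carrier (nmod M)) (fst q) (fst p),
     compose (carrier (alg M)) (snd q) (snd p))"

definition Mod ::
  "('r, 'z) ring_scheme \<Rightarrow> (('r, 'a, 'm) amodule, ('m \<Rightarrow> 'm) \<times> ('a \<Rightarrow> 'a)) category" where
  "Mod R = \<lparr>objs = {M. is_amodule R M},
     arrs = Mod_hom R,
     ident = (\<lambda>M. (\<lambda>x\<in>carrier (nmod M). x, \<lambda>a\<in>carrier (alg M). a)),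
     cmp = (\<lambda>L M N q p. Mod_cmp L q p)\<rparr>"


section \<open>Universal measuring comodules\<close>

definition lin_module ::
  "('r, 'z) ring_scheme \<Rightarrow> ('r, 'm) module \<Rightarrow> ('r, 'n) module \<Rightarrow> ('r, 'm \<Rightarrow> 'n) module" where
  "lin_module R M N = \<lparr>carrier = lin R M N, mult = undefined, one = undefined,
     zero = (\<lambda>x\<in>carrier M. \<zero>\<^bsub>N\<^esub>),
     add = (\<lambda>f g. \<lambda>x\<in>carrier M. f x \<oplus>\<^bsub>N\<^esub> g x),
     smult = (\<lambda>r f. \<lambda>x\<in>carrier M. r \<odot>\<^bsub>N\<^esub> f x)\<rparr>"

definition convolution_algebra ::
  "('u, 'z) ring_scheme \<Rightarrow> 'u coalgebra \<Rightarrow> ('u, 'b) module \<Rightarrow> ('u, 'u \<Rightarrow> 'b) module" where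
  "convolution_algebra R C B = (let M = cmod C in (lin_module R M B)
     \<lparr>mult := (\<lambda>f g. \<lambda>c\<in>carrier M. tlift R M M B (\<lambda>c1 c2. f c1 \<otimes>\<^bsub>B\<^esub> g c2) (comult C c)),
      one := (\<lambda>c\<in>carrier M. counit C c \<odot>\<^bsub>B\<^esub> \<one>\<^bsub>B\<^esub>)\<rparr>)"

text \<open>\<open>(f \<cdot> \<phi>)(x) = \<Sum> f(x\<^sub>(\<^sub>1\<^sub>)) \<phi>(x\<^sub>(\<^sub>0\<^sub>))\<close>. Pitfall: since \<open>X\<close> is a right comodule and \<open>N\<close> a left module,
  \<open>f \<cdot> (g \<cdot> \<phi>)\<close> is given by the opposite of the convolution product of \<open>f\<close> and \<open>g\<close>, so the result
  need not satisfy \<^const>\<open>is_amodule\<close> unless \<open>coalg X\<close> is cocommutative. Therefore \<^const>\<open>Mod_hom\<close>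
  does not demand that its arguments be modules: its elements with target \<open>Hom_obj R X N\<close> are the
  pairs of an algebra map and a linear map compatible with the actions.\<close>

definition Hom_obj ::
  "('u, 'z) ring_scheme \<Rightarrow> 'u comodule \<Rightarrow> ('u, 'b, 'n) amodule
    \<Rightarrow> ('u, 'u \<Rightarrow> 'b, 'u \<Rightarrow> 'n) amodule" where
  "Hom_obj R X N = \<lparr>alg = convolution_algebra R (coalg X) (alg N),
     nmod = lin_module R (xmod X) (nmod N),
     act = (\<lambda>f \<phi>. \<lambda>x\<in>carrier (xmod X).
       tlift R (xmod X) (cmod (coalg X)) (nmod N) (\<lambda>x0 x1. act N (f x1) (\<phi> x0)) (coact X x))\<rparr>"

text \<open>The arrow \<open>Hom(p,N)\<close> from \<open>Hom(Y,N)\<close> to \<open>Hom(X,N)\<close> for an arrow \<open>p\<close> from \<open>X\<close> to \<open>Y\<close>.\<close>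

definition Hom_arr ::
  "('u, 'z) ring_scheme \<Rightarrow> 'u comodule \<Rightarrow> 'u comodule \<Rightarrow> ('u, 'b, 'n) amodule
    \<Rightarrow> ('u \<Rightarrow> 'u) \<times> ('u \<Rightarrow> 'u)
    \<Rightarrow> (('u \<Rightarrow> 'n) \<Rightarrow> ('u \<Rightarrow> 'n)) \<times> (('u \<Rightarrow> 'b) \<Rightarrow> ('u \<Rightarrow> 'b))" where
  "Hom_arr R X Y N p =
     (\<lambda>\<phi>\<in>lin R (xmod Y) (nmod N). compose (carrier (xmod X)) \<phi> (fst p),
      \<lambda>f\<in>lin R (cmod (coalg Y)) (alg N). compose (carrier (cmod (coalg X))) f (snd p))"

text \<open>\<open>Q\<close> represents the functor \<open>X \<mapsto> Mod(M, Hom(X,N))\<close> on the category of comodules.\<close>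

definition universal_measuring_comodule ::
  "('u, 'z) ring_scheme \<Rightarrow> ('u, 'a, 'm) amodule \<Rightarrow> ('u, 'b, 'n) amodule \<Rightarrow> 'u comodule \<Rightarrow> bool" where
  "universal_measuring_comodule R M N Q \<longleftrightarrow> Q \<in> objs (Comod R) \<and>
     (\<exists>\<Phi> :: 'u comodule \<Rightarrow> ('u \<Rightarrow> 'u) \<times> ('u \<Rightarrow> 'u) \<Rightarrow> ('m \<Rightarrow> 'u \<Rightarrow> 'n) \<times> ('a \<Rightarrow> 'u \<Rightarrow> 'b).
        (\<forall>X\<in>objs (Comod R).
           bij_betw (\<Phi> X) (arrs (Comod R) X Q) (Mod_hom R M (Hom_obj R X N))) \<and>
        (\<forall>X\<in>objs (Comod R). \<forall>Y\<in>objs (Comod R).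
           \<forall>p\<in>arrs (Comod R) X Y. \<forall>h\<in>arrs (Comod R) Y Q.
             \<Phi> X (cmp (Comod R) X Y Q h p) = Mod_cmp M (Hom_arr R X Y N p) (\<Phi> Y h)))"

end

theory Submission
  imports Defs
begin

text \<open>A universal measuring \<open>U M N\<close>, the image of the identity of \<open>Q(M,N)\<close> under the representation,
  lets every measuring \<open>M \<rightarrow> Hom(X,N)\<close> be written uniquely as the pullback of \<open>U M N\<close> along an arrow
  \<open>X \<rightarrow> Q(M,N)\<close>. Measurings \<open>u\<close> by \<open>X\<close> from \<open>M\<close> to \<open>N\<close> and \<open>v\<close> by \<open>Y\<close> from \<open>N\<close> to \<open>P\<close> compose to the measuring
  \<open>(x \<otimes> y)(m) = v(u(m)(x))(y)\<close> by \<open>X \<otimes> Y\<close>; this composition is associative and unital up to the coherence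
  isomorphisms, is compatible with pullback, and has the scalar measurings by \<open>R\<close> as units. Composition and
  identities of the enriched category are the arrows that classify the composites of universal measurings
  and the scalar measurings, and its axioms hold because both sides of each classify the same measuring.
  Measurings by \<open>R\<close> are determined by their value at \<open>1\<close>, which gives the underlying category.\<close>

section \<open>Linear and bilinear maps\<close>

text \<open>The object Hom(X,N) need not satisfy the module laws, because a right comodule meets a
  left action. The proof works instead with curried bilinear maps and pointwise identities whose
  values lie in a genuine module. The composite is still multiplicative: v(u(ab)(x))(y) expands to
  the sum of v(u(a)(x1))(y1) v(u(b)(x2))(y2). Here x1 stays before x2 and y1 before y2; only x2 and
  y1 pass each other, which is the middle swap in the comultiplication of a tensor product. The
  opposite category appears because measurings compose in diagrammatic order. With K(M,N) = Q(N,M),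
  the domain K(M,N) \<otimes> K(L,M) of enriched composition is Q(N,M) \<otimes> Q(M,L), the order
  in which measurings from N to M and from M to L compose, so no symmetry enters. Elements of a
  tensor product are arbitrarily chosen names of classes, so nothing is computed on them directly:
  identities are reduced to pure tensors by linearity.\<close>

definition linear_map ::
  "('r, 'z) ring_scheme \<Rightarrow> ('r, 'm) module \<Rightarrow> ('r, 'n) module \<Rightarrow> ('m \<Rightarrow> 'n) \<Rightarrow> bool" where
  "linear_map R M N h \<longleftrightarrow> (\<forall>x\<in>carrier M. h x \<in> carrier N) \<and>
     (\<forall>x\<in>carrier M. \<forall>y\<in>carrier M. h (x \<oplus>\<^bsub>M\<^esub> y) = h x \<oplus>\<^bsub>N\<^esub> h y) \<and>
     (\<forall>r\<in>carrier R. \<forall>x\<in>carrier M. h (r \<odot>\<^bsub>M\<^esub> x) = r \<odot>\<^bsub>N\<^esub> h x)"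

text \<open>Unlike \<open>lin\<close>, neither this nor \<open>linear_map\<close> constrains values
  off the carriers. Plain abstractions such as \<open>\<lambda>x. k (h x)\<close> therefore qualify,
  and linearity of composites follows by introduction rules; \<open>lin\<close> is recovered by
  restricting to the carrier.\<close>

definition bilinear_map ::
  "('r, 'z) ring_scheme \<Rightarrow> ('r, 'm) module \<Rightarrow> ('r, 'n) module \<Rightarrow> ('r, 'p) module
    \<Rightarrow> ('m \<Rightarrow> 'n \<Rightarrow> 'p) \<Rightarrow> bool" where
  "bilinear_map R X Y P b \<longleftrightarrow> (\<forall>x\<in>carrier X. linear_map R Y P (b x)) \<and>
     (\<forall>y\<in>carrier Y. linear_map R X P (\<lambda>x. b x y))"

lemma bilinear_mapI:
  "\<lbrakk>\<And>x. x \<in> carrier X \<Longrightarrow> linear_map R Y P (b x);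
    \<And>y. y \<in> carrier Y \<Longrightarrow> linear_map R X P (\<lambda>x. b x y)\<rbrakk> \<Longrightarrow> bilinear_map R X Y P b"
  by (simp add: bilinear_map_def)

lemma bilinear_map_left: "\<lbrakk>bilinear_map R X Y P b; y \<in> carrier Y\<rbrakk> \<Longrightarrow> linear_map R X P (\<lambda>x. b x y)"
  and bilinear_map_right: "\<lbrakk>bilinear_map R X Y P b; x \<in> carrier X\<rbrakk> \<Longrightarrow> linear_map R Y P (b x)"
  by (simp_all add: bilinear_map_def)

lemma linear_map_closed: "\<lbrakk>linear_map R M N h; x \<in> carrier M\<rbrakk> \<Longrightarrow> h x \<in> carrier N"
  and linear_map_add: "\<lbrakk>linear_map R M N h; x \<in> carrier M; y \<in> carrier M\<rbrakk>
    \<Longrightarrow> h (x \<oplus>\<^bsub>M\<^esub> y) = h x \<oplus>\<^bsub>N\<^esub> h y"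
  and linear_map_smult: "\<lbrakk>linear_map R M N h; r \<in> carrier R; x \<in> carrier M\<rbrakk>
    \<Longrightarrow> h (r \<odot>\<^bsub>M\<^esub> x) = r \<odot>\<^bsub>N\<^esub> h x"
  by (simp_all add: linear_map_def)

lemma lin_iff: "h \<in> lin R M N \<longleftrightarrow> linear_map R M N h \<and> h \<in> extensional (carrier M)"
  by (auto simp: lin_def linear_map_def PiE_def)

lemma lin_linear: "h \<in> lin R M N \<Longrightarrow> linear_map R M N h"
  by (simp add: lin_iff)

lemma lin_closed: "h \<in> lin R M N \<Longrightarrow> x \<in> carrier M \<Longrightarrow> h x \<in> carrier N"
  by (simp add: lin_iff linear_map_def)

lemma lin_extensional: "h \<in> lin R M N \<Longrightarrow> h \<in> extensional (carrier M)"
  by (simp add: lin_iff)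

lemma lin_eqI:
  "\<lbrakk>h \<in> lin R M N; k \<in> lin R M N; \<And>x. x \<in> carrier M \<Longrightarrow> h x = k x\<rbrakk> \<Longrightarrow> h = k"
  by (auto simp: lin_iff intro: extensionalityI)

text \<open>A module has a carrier closed under sums and scalar multiples, so agreement on the
  carrier reaches every argument that occurs in the linearity laws.\<close>

lemma linear_map_cong:
  assumes "linear_map R M N h" "module R M" "\<And>x. x \<in> carrier M \<Longrightarrow> h x = k x"
  shows "linear_map R M N k"
proof -
  interpret module R M by fact
  show ?thesis using assms(1,3) by (simp add: linear_map_def)
qed

lemma linear_map_restrict:
  "\<lbrakk>linear_map R M N h; module R M\<rbrakk> \<Longrightarrow> linear_map R M N (\<lambda>x\<in>carrier M. h x)"
  by (erule linear_map_cong) simp_all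

lemma linear_restrict_lin:
  "\<lbrakk>linear_map R M N h; module R M\<rbrakk> \<Longrightarrow> (\<lambda>x\<in>carrier M. h x) \<in> lin R M N"
  by (simp add: lin_iff linear_map_restrict)

lemma linear_map_ident: "linear_map R M M (\<lambda>x. x)"
  by (simp add: linear_map_def)

lemma linear_map_compose:
  "\<lbrakk>linear_map R M N k; linear_map R L M h\<rbrakk> \<Longrightarrow> linear_map R L N (\<lambda>x. k (h x))"
  unfolding linear_map_def by simp

lemma linear_map_lin: "\<lbrakk>k \<in> lin R M N; linear_map R L M h\<rbrakk> \<Longrightarrow> linear_map R L N (\<lambda>x. k (h x))"
  by (rule linear_map_compose[OF lin_linear])

lemma lin_compose:
  assumes "k \<in> lin R M N" "h \<in> lin R L M" "module R L"
  shows "compose (carrier L) k h \<in> lin R L N"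
  unfolding compose_def
  by (intro linear_restrict_lin linear_map_compose[OF lin_linear[OF assms(1)] lin_linear[OF assms(2)]] assms(3))

lemma lin_ident: "module R M \<Longrightarrow> (\<lambda>x\<in>carrier M. x) \<in> lin R M M"
  by (intro linear_restrict_lin linear_map_ident)

lemma linear_map_zero:
  assumes "linear_map R M N h" "module R M" "module R N"
  shows "h \<zero>\<^bsub>M\<^esub> = \<zero>\<^bsub>N\<^esub>"
proof -
  interpret M: module R M by fact
  interpret N: module R N by fact
  have "h \<zero>\<^bsub>M\<^esub> \<oplus>\<^bsub>N\<^esub> h \<zero>\<^bsub>M\<^esub> = h \<zero>\<^bsub>M\<^esub>"
    using linear_map_add[OF assms(1) M.zero_closed M.zero_closed] by simp
  then show ?thesis using linear_map_closed[OF assms(1) M.zero_closed] N.add.l_cancel_one by blast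
qed

lemma linear_map_smult_const:
  assumes "module R M" "linear_map R L M h" "r \<in> carrier R"
  shows "linear_map R L M (\<lambda>x. r \<odot>\<^bsub>M\<^esub> h x)"
proof -
  interpret module R M by fact
  show ?thesis
    using assms(2,3) by (auto simp: linear_map_def smult_r_distr smult_assoc1[symmetric] R.m_comm)
qed

lemma linear_map_smult_vector:
  assumes "module R M" "linear_map R L (ring_module R) h" "x \<in> carrier M"
  shows "linear_map R L M (\<lambda>y. h y \<odot>\<^bsub>M\<^esub> x)"
proof -
  interpret module R M by fact
  show ?thesis
    using assms(2,3) by (auto simp: linear_map_def ring_module_def smult_l_distr smult_assoc1[symmetric])
qed

lemma module_ring_module: "cring R \<Longrightarrow> module R (ring_module R)"
proof -
  assume "cring R"
  then interpret cring R .
  have "abelian_group (ring_module R)"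
  proof (rule abelian_groupI)
    fix x assume "x \<in> carrier (ring_module R)"
    then show "\<exists>y\<in>carrier (ring_module R). y \<oplus>\<^bsub>ring_module R\<^esub> x = \<zero>\<^bsub>ring_module R\<^esub>"
      using l_neg[of x] a_inv_closed[of x] by (auto simp: ring_module_def)
  qed (simp_all add: ring_module_def a_ac)
  then show ?thesis
    by (intro moduleI is_cring) (simp_all add: ring_module_def l_distr r_distr m_assoc)
qed

section \<open>The tensor product\<close>

text \<open>An infinite type is in bijection with its square, so iterated pairing codes lists of a
  fixed length. Lists of different lengths might share a code; hence the length is paired in through
  an embedding of the natural numbers.\<close>

lemma ex_inj_pair_list:
  assumes "infinite (UNIV :: 'a set)"
  shows "\<exists>c :: ('a \<times> 'a) list \<Rightarrow> 'a. inj c"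
proof -
  have "\<exists>p. bij_betw p ((UNIV :: 'a set) \<times> (UNIV :: 'a set)) (UNIV :: 'a set)"
    using card_of_Times_same_infinite[OF assms] card_of_ordIso by blast
  then obtain p :: "'a \<times> 'a \<Rightarrow> 'a" where p: "inj p"
    by (auto simp: bij_betw_def)
  obtain n :: "nat \<Rightarrow> 'a" where n: "inj n"
    using assms infinite_countable_subset by blast
  \<comment> \<open>The inner \<open>p\<close> codes one list entry, which is itself a pair; the
    start value \<open>n 0\<close> is an arbitrary element.\<close>
  define c where "c xs = foldr (\<lambda>x a. p (p x, a)) xs (n 0)" for xs
  have c: "length xs = length ys \<Longrightarrow> c xs = c ys \<Longrightarrow> xs = ys" for xs ys
    by (induction xs ys rule: list_induct2) (auto simp: c_def dest: injD[OF p])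
  have "inj (\<lambda>xs. p (n (length xs), c xs))"
    by (rule injI) (auto dest!: injD[OF p] injD[OF n] intro: c)
  then show ?thesis by blast
qed

locale tensor_products = cring R for R :: "('u, 'z) ring_scheme" (structure) +
  assumes infinite_type: "infinite (UNIV :: 'u set)"
begin

lemma R_module: "module R (ring_module R)"
  by (rule module_ring_module) unfold_locales

section \<open>Formal sums and the module structure on their classes\<close>

lemma tensor_eq_formal_sums:
  assumes "module R X" "module R Y" "tensor_eq R X Y s t"
  shows "s \<in> formal_sums X Y \<and> t \<in> formal_sums X Y"
proof -
  interpret X: module R X by fact
  interpret Y: module R Y by fact
  show ?thesis
    using assms(3) by induction (auto simp: formal_sums_def)
qed

text \<open>The defining property of the \<open>SOME\<close> in \<open>tsum\<close>. It can be used
  because a witness exists: choose a representative in each class and code this list by an element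
  of the type.\<close>

lemma tsum_eq_iff:
  assumes "s \<in> formal_sums X Y" "t \<in> formal_sums X Y"
  shows "tsum R X Y s = tsum R X Y t \<longleftrightarrow> tensor_eq R X Y s t"
proof -
  obtain c :: "('u \<times> 'u) list \<Rightarrow> 'u" where c: "inj c"
    using ex_inj_pair_list[OF infinite_type] by blast
  define q where "q s = c (SOME t. tensor_eq R X Y s t)" for s
  have "q s = q t \<longleftrightarrow> tensor_eq R X Y s t"
    if s: "s \<in> formal_sums X Y" and t: "t \<in> formal_sums X Y" for s t
  proof
    assume "q s = q t"
    then have "(SOME u. tensor_eq R X Y s u) = (SOME u. tensor_eq R X Y t u)"
      unfolding q_def by (rule injD[OF c])
    moreover have "tensor_eq R X Y s (SOME u. tensor_eq R X Y s u)"
      using tensor_eq.refl[OF s] by (rule someI)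
    moreover have "tensor_eq R X Y t (SOME u. tensor_eq R X Y t u)"
      using tensor_eq.refl[OF t] by (rule someI)
    ultimately have "tensor_eq R X Y s (SOME u. tensor_eq R X Y t u)"
      and "tensor_eq R X Y (SOME u. tensor_eq R X Y t u) t"
      by (simp_all add: tensor_eq.sym)
    then show "tensor_eq R X Y s t" by (rule tensor_eq.trans)
  next
    assume "tensor_eq R X Y s t"
    \<comment> \<open>Related sums have the same class, so the choice operator picks the same
      representative for both.\<close>
    then have "tensor_eq R X Y s u \<longleftrightarrow> tensor_eq R X Y t u" for u
      using tensor_eq.trans[of R X Y s t u] tensor_eq.trans[of R X Y t s u] tensor_eq.sym[of R X Y s t]
      by blast
    then show "q s = q t" by (simp add: q_def)
  qed
  then have "\<forall>s\<in>formal_sums X Y. \<forall>t\<in>formal_sums X Y. q s = q t \<longleftrightarrow> tensor_eq R X Y s t" (is "?P q")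
    by blast
  then have "?P (tsum R X Y)"
    unfolding tsum_def by (rule someI[of ?P q])
  then show ?thesis using assms by blast
qed

lemma trep:
  assumes "a \<in> carrier (tensor R X Y)"
  shows "trep R X Y a \<in> formal_sums X Y" "tsum R X Y (trep R X Y a) = a"
proof -
  have "\<exists>s. s \<in> formal_sums X Y \<and> tsum R X Y s = a"
    using assms by (auto simp: tensor_def)
  from someI_ex[OF this] show "trep R X Y a \<in> formal_sums X Y" "tsum R X Y (trep R X Y a) = a"
    by (simp_all add: trep_def)
qed

lemma tsum_closed: "s \<in> formal_sums X Y \<Longrightarrow> tsum R X Y s \<in> carrier (tensor R X Y)"
  by (simp add: tensor_def)

lemma trep_tsum: "s \<in> formal_sums X Y \<Longrightarrow> tensor_eq R X Y (trep R X Y (tsum R X Y s)) s"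
  using trep[OF tsum_closed] by (subst tsum_eq_iff[symmetric]) auto

lemma formal_sums_append:
  "s \<in> formal_sums X Y \<Longrightarrow> t \<in> formal_sums X Y \<Longrightarrow> s @ t \<in> formal_sums X Y"
  by (simp add: formal_sums_def)

lemma tsum_append:
  assumes "s \<in> formal_sums X Y" "t \<in> formal_sums X Y"
  shows "tsum R X Y s \<oplus>\<^bsub>tensor R X Y\<^esub> tsum R X Y t = tsum R X Y (s @ t)"
proof -
  have "tensor_eq R X Y (trep R X Y (tsum R X Y s) @ trep R X Y (tsum R X Y t)) (s @ t)"
    by (intro tensor_eq.append trep_tsum assms)
  then show ?thesis
    using assms by (simp add: tensor_def tsum_eq_iff formal_sums_append trep tsum_closed)
qed

abbreviation smult_sum :: "('u, 'u) module \<Rightarrow> 'u \<Rightarrow> ('u \<times> 'u) list \<Rightarrow> ('u \<times> 'u) list" where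
  "smult_sum X r \<equiv> map (\<lambda>(x, y). (r \<odot>\<^bsub>X\<^esub> x, y))"

lemma formal_sums_smult:
  assumes "module R X" "r \<in> carrier R" "s \<in> formal_sums X Y"
  shows "smult_sum X r s \<in> formal_sums X Y"
proof -
  interpret X: module R X by fact
  show ?thesis using assms(2,3) by (fastforce simp: formal_sums_def)
qed

text \<open>Scaling the left entries respects every generating relation. In the balanced case r has
  to move past r', which is where R being commutative enters.\<close>

lemma tensor_eq_smult:
  assumes "module R X" "module R Y" "r \<in> carrier R" "tensor_eq R X Y s t"
  shows "tensor_eq R X Y (smult_sum X r s) (smult_sum X r t)"
proof -
  interpret X: module R X by fact
  interpret Y: module R Y by fact
  show ?thesis using assms(4)
  proof induction
    case (refl s)
    then show ?case by (intro tensor_eq.refl formal_sums_smult assms)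
  next
    case (sym s t)
    then show ?case by (blast intro: tensor_eq.sym)
  next
    case (trans s t u)
    then show ?case using tensor_eq.trans by blast
  next
    case (append s s' t t')
    then show ?case by (simp add: tensor_eq.append)
  next
    case (commute s t)
    then show ?case by (simp add: tensor_eq.commute formal_sums_smult assms)
  next
    case (zero y)
    then show ?case using \<open>r \<in> carrier R\<close> by (simp add: X.smult_r_null tensor_eq.zero)
  next
    case (add_left x x' y)
    then show ?case using \<open>r \<in> carrier R\<close> by (simp add: X.smult_r_distr tensor_eq.add_left)
  next
    case (add_right x y y')
    then show ?case using \<open>r \<in> carrier R\<close> by (simp add: tensor_eq.add_right)
  next
    case (balanced r' x y)
    then have "r \<odot>\<^bsub>X\<^esub> (r' \<odot>\<^bsub>X\<^esub> x) = r' \<odot>\<^bsub>X\<^esub> (r \<odot>\<^bsub>X\<^esub> x)"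
      using \<open>r \<in> carrier R\<close> by (simp add: X.smult_assoc1[symmetric] m_comm)
    then show ?case using \<open>r \<in> carrier R\<close> balanced by (simp add: tensor_eq.balanced)
  qed
qed

lemma tsum_smult:
  assumes "module R X" "module R Y" "r \<in> carrier R" "s \<in> formal_sums X Y"
  shows "r \<odot>\<^bsub>tensor R X Y\<^esub> tsum R X Y s = tsum R X Y (smult_sum X r s)"
proof -
  have "tensor_eq R X Y (smult_sum X r (trep R X Y (tsum R X Y s))) (smult_sum X r s)"
    by (intro tensor_eq_smult trep_tsum assms)
  then show ?thesis
    using assms by (simp add: tensor_def tsum_eq_iff formal_sums_smult trep tsum_closed)
qed

lemma tsum_zero: "\<zero>\<^bsub>tensor R X Y\<^esub> = tsum R X Y []"
  by (simp add: tensor_def)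

lemma formal_sums_Nil: "[] \<in> formal_sums X Y"
  and formal_sums_single: "x \<in> carrier X \<Longrightarrow> y \<in> carrier Y \<Longrightarrow> [(x, y)] \<in> formal_sums X Y"
  by (simp_all add: formal_sums_def)

lemma tensor_cases:
  assumes "a \<in> carrier (tensor R X Y)"
  obtains s where "s \<in> formal_sums X Y" "a = tsum R X Y s"
  using trep[OF assms] by metis

text \<open>Supplies additive inverses in the tensor product: the negative of a formal sum is its
  multiple by -1.\<close>

lemma tensor_eq_neg:
  assumes "module R X" "module R Y" "s \<in> formal_sums X Y"
  shows "tensor_eq R X Y (smult_sum X (\<ominus> \<one>) s @ s) []"
proof -
  interpret X: module R X by fact
  interpret Y: module R Y by fact
  show ?thesis using assms(3)
  proof (induction s)
    case Nil
    then show ?case using tensor_eq.refl[OF formal_sums_Nil] by simp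
  next
    case (Cons p s)
    obtain x y where p: "p = (x, y)" by force
    have xy: "x \<in> carrier X" "y \<in> carrier Y" and s: "s \<in> formal_sums X Y"
      using Cons.prems by (auto simp: p formal_sums_def)
    have neg: "\<ominus> \<one> \<odot>\<^bsub>X\<^esub> x \<in> carrier X" using xy by simp
    \<comment> \<open>Carries the head of the list across the scaled tail to its own negative, so
      that the two cancel and the induction hypothesis applies to the rest.\<close>
    have "tensor_eq R X Y (smult_sum X (\<ominus> \<one>) s @ [(x, y)]) ([(x, y)] @ smult_sum X (\<ominus> \<one>) s)"
      using xy by (intro tensor_eq.commute formal_sums_smult assms s) (auto simp: formal_sums_def)
    then have "tensor_eq R X Y ([(\<ominus> \<one> \<odot>\<^bsub>X\<^esub> x, y)] @ (smult_sum X (\<ominus> \<one>) s @ [(x, y)]) @ s)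
        ([(\<ominus> \<one> \<odot>\<^bsub>X\<^esub> x, y)] @ ([(x, y)] @ smult_sum X (\<ominus> \<one>) s) @ s)"
      using xy neg s tensor_eq.refl[of "[(\<ominus> \<one> \<odot>\<^bsub>X\<^esub> x, y)]" X Y R] tensor_eq.refl[OF s, of R]
      by (blast intro: tensor_eq.append formal_sums_single)
    moreover have "tensor_eq R X Y [(\<ominus> \<one> \<odot>\<^bsub>X\<^esub> x, y), (x, y)] []"
    proof -
      have "\<ominus> \<one> \<odot>\<^bsub>X\<^esub> x \<oplus>\<^bsub>X\<^esub> x = \<zero>\<^bsub>X\<^esub>"
        using xy X.smult_l_distr[of "\<ominus> \<one>" \<one> x] by (simp add: l_neg X.smult_l_null)
      then show ?thesis
        using tensor_eq.add_left[OF neg xy(1) xy(2)] tensor_eq.zero[OF xy(2)]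
        by (metis tensor_eq.sym tensor_eq.trans)
    qed
    then have "tensor_eq R X Y ([(\<ominus> \<one> \<odot>\<^bsub>X\<^esub> x, y), (x, y)] @ (smult_sum X (\<ominus> \<one>) s @ s)) ([] @ [])"
      using Cons.IH[OF s] by (rule tensor_eq.append)
    ultimately show ?case by (auto simp: p intro: tensor_eq.trans)
  qed
qed

lemma tensor_module:
  assumes "module R X" "module R Y"
  shows "module R (tensor R X Y)"
proof -
  interpret X: module R X by fact
  interpret Y: module R Y by fact
  note [simp] = tsum_append tsum_smult[OF assms] tsum_zero tsum_closed formal_sums_append
    formal_sums_smult[OF assms(1)] formal_sums_Nil tsum_eq_iff
  have ag: "abelian_group (tensor R X Y)"
  proof (rule abelian_groupI)
    fix a b assume "a \<in> carrier (tensor R X Y)" "b \<in> carrier (tensor R X Y)"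
    then show "a \<oplus>\<^bsub>tensor R X Y\<^esub> b \<in> carrier (tensor R X Y)"
      by (elim tensor_cases) simp
  next
    show "\<zero>\<^bsub>tensor R X Y\<^esub> \<in> carrier (tensor R X Y)" by simp
  next
    fix a b c assume "a \<in> carrier (tensor R X Y)" "b \<in> carrier (tensor R X Y)" "c \<in> carrier (tensor R X Y)"
    then show "a \<oplus>\<^bsub>tensor R X Y\<^esub> b \<oplus>\<^bsub>tensor R X Y\<^esub> c = a \<oplus>\<^bsub>tensor R X Y\<^esub> (b \<oplus>\<^bsub>tensor R X Y\<^esub> c)"
      by (elim tensor_cases) (simp add: tensor_eq.refl)
  next
    fix a b assume "a \<in> carrier (tensor R X Y)" "b \<in> carrier (tensor R X Y)"
    then show "a \<oplus>\<^bsub>tensor R X Y\<^esub> b = b \<oplus>\<^bsub>tensor R X Y\<^esub> a"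
      by (elim tensor_cases) (simp add: tensor_eq.commute)
  next
    fix a assume "a \<in> carrier (tensor R X Y)"
    then show "\<zero>\<^bsub>tensor R X Y\<^esub> \<oplus>\<^bsub>tensor R X Y\<^esub> a = a"
      by (elim tensor_cases) (simp add: tensor_eq.refl)
  next
    fix a assume "a \<in> carrier (tensor R X Y)"
    then obtain s where s: "s \<in> formal_sums X Y" "a = tsum R X Y s" by (rule tensor_cases)
    show "\<exists>b\<in>carrier (tensor R X Y). b \<oplus>\<^bsub>tensor R X Y\<^esub> a = \<zero>\<^bsub>tensor R X Y\<^esub>"
      using s by (intro bexI[of _ "tsum R X Y (smult_sum X (\<ominus> \<one>) s)"])
        (simp_all add: tensor_eq_neg[OF assms])
  qed
  \<comment> \<open>Splitting the head yields two entries, of which the second must still be moved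
    past the first scaled tail.\<close>
  have dist: "tensor_eq R X Y (smult_sum X (r \<oplus> r') s) (smult_sum X r s @ smult_sum X r' s)"
    if r: "r \<in> carrier R" "r' \<in> carrier R" and "s \<in> formal_sums X Y" for r r' s
    using that(3)
  proof (induction s)
    case Nil
    then show ?case using tensor_eq.refl[OF formal_sums_Nil] by simp
  next
    case (Cons p s)
    obtain x y where p: "p = (x, y)" by force
    have xy: "x \<in> carrier X" "y \<in> carrier Y" and s: "s \<in> formal_sums X Y"
      using Cons.prems by (auto simp: p formal_sums_def)
    have "tensor_eq R X Y ([((r \<oplus> r') \<odot>\<^bsub>X\<^esub> x, y)] @ smult_sum X (r \<oplus> r') s)
        ([(r \<odot>\<^bsub>X\<^esub> x, y), (r' \<odot>\<^bsub>X\<^esub> x, y)] @ smult_sum X r s @ smult_sum X r' s)"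
      using xy r by (intro tensor_eq.append Cons.IH s) (simp add: X.smult_l_distr tensor_eq.add_left)
    moreover have "tensor_eq R X Y ([(r \<odot>\<^bsub>X\<^esub> x, y)] @ ([(r' \<odot>\<^bsub>X\<^esub> x, y)] @ smult_sum X r s) @ smult_sum X r' s)
       ([(r \<odot>\<^bsub>X\<^esub> x, y)] @ (smult_sum X r s @ [(r' \<odot>\<^bsub>X\<^esub> x, y)]) @ smult_sum X r' s)"
      using xy r s by (intro tensor_eq.append tensor_eq.commute tensor_eq.refl formal_sums_smult assms)
        (auto simp: formal_sums_def)
    ultimately show ?case by (auto simp: p intro: tensor_eq.trans)
  qed
  \<comment> \<open>This law and the next hold for the lists themselves, not merely up to
    \<open>tensor_eq\<close>.\<close>
  have comp: "smult_sum X (r \<otimes> r') s = smult_sum X r (smult_sum X r' s)"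
    if "r \<in> carrier R" "r' \<in> carrier R" "s \<in> formal_sums X Y" for r r' s
    using that by (auto simp: formal_sums_def X.smult_assoc1)
  have one: "smult_sum X \<one> s = s" if "s \<in> formal_sums X Y" for s
    using that by (intro map_idI) (auto simp: formal_sums_def)
  show ?thesis
    by (intro moduleI ag is_cring; (elim tensor_cases)?)
      (simp_all add: dist comp one tensor_eq.refl del: map_map)
qed

section \<open>Pure tensors as generators\<close>

lemma pure_closed:
  "\<lbrakk>x \<in> carrier X; y \<in> carrier Y\<rbrakk> \<Longrightarrow> pure R X Y x y \<in> carrier (tensor R X Y)"
  by (simp add: pure_def tsum_closed formal_sums_def)

lemma pure_bilinear:
  assumes "module R X" "module R Y"
  shows "bilinear_map R X Y (tensor R X Y) (pure R X Y)"
proof -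
  interpret X: module R X by fact
  interpret Y: module R Y by fact
  have 1: "tensor_eq R X Y [(x, r \<odot>\<^bsub>Y\<^esub> y)] [(r \<odot>\<^bsub>X\<^esub> x, y)]"
    if "r \<in> carrier R" "x \<in> carrier X" "y \<in> carrier Y" for r x y
    using that by (blast intro: tensor_eq.sym tensor_eq.balanced)
  show ?thesis
    by (auto simp: bilinear_map_def linear_map_def pure_closed pure_def tsum_append tsum_smult assms
        tsum_closed formal_sums_def tsum_eq_iff tensor_eq.intros 1 intro: tensor_eq.refl)
qed

lemma tsum_Cons:
  "\<lbrakk>x \<in> carrier X; y \<in> carrier Y; s \<in> formal_sums X Y\<rbrakk>
    \<Longrightarrow> tsum R X Y ((x, y) # s) = pure R X Y x y \<oplus>\<^bsub>tensor R X Y\<^esub> tsum R X Y s"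
  by (simp add: pure_def tsum_append formal_sums_def)

lemma tensor_induct [consumes 1, case_names zero pure add]:
  assumes "a \<in> carrier (tensor R X Y)"
    and zero: "P \<zero>\<^bsub>tensor R X Y\<^esub>"
    and pure: "\<And>x y. x \<in> carrier X \<Longrightarrow> y \<in> carrier Y \<Longrightarrow> P (pure R X Y x y)"
    and add: "\<And>a b. \<lbrakk>a \<in> carrier (tensor R X Y); b \<in> carrier (tensor R X Y); P a; P b\<rbrakk>
      \<Longrightarrow> P (a \<oplus>\<^bsub>tensor R X Y\<^esub> b)"
  shows "P a"
proof -
  obtain s where s: "s \<in> formal_sums X Y" "a = tsum R X Y s"
    using assms(1) by (rule tensor_cases)
  have "P (tsum R X Y s)" using s(1)
  proof (induction s)
    case Nil
    then show ?case using zero by (simp add: tsum_zero)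
  next
    case (Cons p s)
    obtain x y where p: "p = (x, y)" by force
    have xy: "x \<in> carrier X" "y \<in> carrier Y" and s: "s \<in> formal_sums X Y"
      using Cons.prems by (auto simp: p formal_sums_def)
    show ?case
      unfolding p using xy s by (simp add: tsum_Cons add pure Cons.IH pure_closed tsum_closed)
  qed
  then show ?thesis by (simp add: s)
qed

text \<open>The uniqueness half of the universal property. Later uses rotate the premises so that
  the membership of a, which fixes X and Y, comes first; P does not occur in the conclusion and is
  therefore given explicitly.\<close>

lemma tensor_linear_eqI:
  assumes "linear_map R (tensor R X Y) P f" "linear_map R (tensor R X Y) P g"
    and "\<And>x y. x \<in> carrier X \<Longrightarrow> y \<in> carrier Y \<Longrightarrow> f (pure R X Y x y) = g (pure R X Y x y)"
    and "a \<in> carrier (tensor R X Y)" "module R X" "module R Y" "module R P"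
  shows "f a = g a"
  using assms(4)
  by (induction rule: tensor_induct)
    (simp_all add: assms linear_map_zero[OF assms(1)] linear_map_zero[OF assms(2)] tensor_module
      linear_map_add[OF assms(1)] linear_map_add[OF assms(2)])

section \<open>The existence half of the universal property\<close>

definition formal_eval :: "('u, 'p) module \<Rightarrow> ('u \<Rightarrow> 'u \<Rightarrow> 'p) \<Rightarrow> ('u \<times> 'u) list \<Rightarrow> 'p" where
  "formal_eval P b s = foldr (\<lambda>(x, y) p. b x y \<oplus>\<^bsub>P\<^esub> p) s \<zero>\<^bsub>P\<^esub>"

lemma formal_eval_closed:
  assumes "module R P" "\<And>x y. x \<in> carrier X \<Longrightarrow> y \<in> carrier Y \<Longrightarrow> b x y \<in> carrier P"
    and "s \<in> formal_sums X Y"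
  shows "formal_eval P b s \<in> carrier P"
proof -
  interpret P: module R P by fact
  show ?thesis using assms(3) by (induction s) (auto simp: formal_eval_def formal_sums_def assms(2))
qed

lemma formal_eval_append:
  assumes "module R P" "\<And>x y. x \<in> carrier X \<Longrightarrow> y \<in> carrier Y \<Longrightarrow> b x y \<in> carrier P"
    and "s \<in> formal_sums X Y" "t \<in> formal_sums X Y"
  shows "formal_eval P b (s @ t) = formal_eval P b s \<oplus>\<^bsub>P\<^esub> formal_eval P b t"
proof -
  interpret P: module R P by fact
  have t: "formal_eval P b t \<in> carrier P"
    using assms by (intro formal_eval_closed[of P X Y])
  show ?thesis using assms(3)
  proof (induction s)
    case Nil
    then show ?case using t by (simp add: formal_eval_def)
  next
    case (Cons p s)
    obtain x y where p: "p = (x, y)" by force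
    have xy: "b x y \<in> carrier P" and s: "s \<in> formal_sums X Y"
      using Cons.prems by (auto simp: p formal_sums_def assms)
    have "formal_eval P b s \<in> carrier P"
      using assms s by (intro formal_eval_closed[of P X Y])
    then show ?case using Cons.IH[OF s] t xy by (simp add: formal_eval_def p P.a_assoc)
  qed
qed

text \<open>Makes \<open>tlift\<close> independent of the representative that \<open>trep\<close>
  happens to pick: after evaluation the generating relations become the laws of a bilinear map and
  the commutativity of addition in P.\<close>

lemma formal_eval_cong:
  assumes "module R X" "module R Y" "module R P" "bilinear_map R X Y P b" "tensor_eq R X Y s t"
  shows "formal_eval P b s = formal_eval P b t"
proof -
  interpret X: module R X by fact
  interpret Y: module R Y by fact
  interpret P: module R P by fact
  have b: "b x y \<in> carrier P" if "x \<in> carrier X" "y \<in> carrier Y" for x y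
    using assms(4) that by (simp add: bilinear_map_def linear_map_def)
  note b_left = bilinear_map_left[OF assms(4)] and b_right = bilinear_map_right[OF assms(4)]
  show ?thesis using assms(5)
  proof induction
    case (append s s' t t')
    then show ?case
      using tensor_eq_formal_sums[OF assms(1,2)] b
      by (metis formal_eval_append[of P X Y b, OF assms(3)])
  next
    case (commute s t)
    then show ?case
      by (simp add: formal_eval_append[of P X Y b, OF assms(3) b] formal_eval_closed[of P X Y b, OF assms(3) b]
          P.a_comm)
  next
    case (zero y)
    then show ?case
      using linear_map_zero[OF b_left[OF zero] assms(1,3)] by (simp add: formal_eval_def)
  next
    case (add_left x x' y)
    then show ?case
      using linear_map_add[OF b_left] by (simp add: formal_eval_def b P.a_assoc)
  next
    case (add_right x y y')
    then show ?case
      using linear_map_add[OF b_right] by (simp add: formal_eval_def b P.a_assoc)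
  next
    case (balanced r x y)
    then show ?case
      using linear_map_smult[OF b_right] linear_map_smult[OF b_left] by (simp add: formal_eval_def b)
  qed simp_all
qed

lemma tlift_eq: "a \<in> carrier (tensor R X Y) \<Longrightarrow> tlift R X Y P b a = formal_eval P b (trep R X Y a)"
  by (simp add: tlift_def formal_eval_def)

lemma tlift_tsum:
  assumes "module R X" "module R Y" "module R P" "bilinear_map R X Y P b" "s \<in> formal_sums X Y"
  shows "tlift R X Y P b (tsum R X Y s) = formal_eval P b s"
  by (simp add: tlift_eq tsum_closed assms formal_eval_cong[OF assms(1-4) trep_tsum])

lemma tlift_pure:
  assumes "bilinear_map R X Y P b" "x \<in> carrier X" "y \<in> carrier Y"
    "module R X" "module R Y" "module R P"
  shows "tlift R X Y P b (pure R X Y x y) = b x y"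
proof -
  interpret P: module R P by fact
  have "b x y \<in> carrier P"
    using assms by (simp add: bilinear_map_def linear_map_def)
  then show ?thesis
    using tlift_tsum[of X Y P b "[(x, y)]"] assms by (simp add: pure_def formal_sums_def formal_eval_def)
qed

lemma tlift_lin:
  assumes "bilinear_map R X Y P b" "module R X" "module R Y" "module R P"
  shows "tlift R X Y P b \<in> lin R (tensor R X Y) P"
proof -
  interpret P: module R P by fact
  interpret X: module R X by fact
  have b: "b x y \<in> carrier P" if "x \<in> carrier X" "y \<in> carrier Y" for x y
    using assms(1) that by (simp add: bilinear_map_def linear_map_def)
  note t = tlift_tsum[OF assms(2,3,4,1)]
  have c: "formal_eval P b s \<in> carrier P" if "s \<in> formal_sums X Y" for s
    using formal_eval_closed[of P X Y b s] assms(4) b that by simp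
  have s: "formal_eval P b (smult_sum X r s) = r \<odot>\<^bsub>P\<^esub> formal_eval P b s"
    if r: "r \<in> carrier R" and "s \<in> formal_sums X Y" for r s
    using that(2)
  proof (induction s)
    case Nil
    then show ?case using r by (simp add: formal_eval_def P.smult_r_null)
  next
    case (Cons p s)
    obtain x y where p: "p = (x, y)" by force
    have xy: "x \<in> carrier X" "y \<in> carrier Y" and s: "s \<in> formal_sums X Y"
      using Cons.prems by (auto simp: p formal_sums_def)
    have "b (r \<odot>\<^bsub>X\<^esub> x) y = r \<odot>\<^bsub>P\<^esub> b x y"
      using linear_map_smult[OF bilinear_map_left[OF assms(1)]] xy r by simp
    then show ?case
      using Cons.IH[OF s] c[OF s] xy r b[OF xy] by (simp add: p formal_eval_def P.smult_r_distr)
  qed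
  show ?thesis
    unfolding lin_iff linear_map_def
  proof (intro conjI ballI)
    show "tlift R X Y P b \<in> extensional (carrier (tensor R X Y))" by (simp add: tlift_def)
  qed (elim tensor_cases; simp add: t c s tsum_append tsum_smult assms(2,3) formal_sums_append
      formal_sums_smult formal_eval_append[of P X Y b, OF assms(4) b])+
qed

text \<open>The two lifts agree as functions, also off the carrier where both are undefined. This
  lets the lemma serve as a congruence rule for rewriting inside a lift.\<close>

lemma tlift_cong:
  assumes "\<And>x y. x \<in> carrier X \<Longrightarrow> y \<in> carrier Y \<Longrightarrow> b x y = b' x y"
  shows "tlift R X Y P b = tlift R X Y P b'"
proof
  fix a
  have "formal_eval P b s = formal_eval P b' s" if "s \<in> formal_sums X Y" for s
    using that by (induction s) (auto simp: formal_eval_def formal_sums_def assms)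
  then show "tlift R X Y P b a = tlift R X Y P b' a"
    by (cases "a \<in> carrier (tensor R X Y)") (simp_all add: tlift_eq trep, simp add: tlift_def)
qed

lemma linear_map_tlift:
  "\<lbrakk>linear_map R L (tensor R X Y) h; bilinear_map R X Y P b; module R X; module R Y; module R P\<rbrakk>
    \<Longrightarrow> linear_map R L P (\<lambda>z. tlift R X Y P b (h z))"
  by (rule linear_map_lin[OF tlift_lin])

text \<open>Needed for nested lifts, where the bilinear map itself depends on an outer variable.
  Along the fixed representative of a the lift is a finite sum, and each summand is linear in the
  parameter.\<close>

lemma linear_map_tlift_param:
  assumes "\<And>x y. x \<in> carrier X \<Longrightarrow> y \<in> carrier Y \<Longrightarrow> linear_map R L P (\<lambda>z. b z x y)"
    and "module R P" "module R L" "a \<in> carrier (tensor R X Y)"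
  shows "linear_map R L P (\<lambda>z. tlift R X Y P (b z) a)"
proof -
  interpret P: module R P by fact
  interpret L: module R L by fact
  have "linear_map R L P (\<lambda>z. formal_eval P (b z) s)" if "s \<in> formal_sums X Y" for s
    using that
  proof (induction s)
    case Nil
    then show ?case by (simp add: formal_eval_def linear_map_def P.smult_r_null)
  next
    case (Cons p s)
    obtain x y where p: "p = (x, y)" by force
    have xy: "x \<in> carrier X" "y \<in> carrier Y" and s: "s \<in> formal_sums X Y"
      using Cons.prems by (auto simp: p formal_sums_def)
    have IH: "linear_map R L P (\<lambda>z. foldr (\<lambda>(x, y) p. b z x y \<oplus>\<^bsub>P\<^esub> p) s \<zero>\<^bsub>P\<^esub>)"
      using Cons.IH[OF s] by (simp add: formal_eval_def)
    show ?case
      using assms(1)[OF xy] IH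
      by (simp add: p formal_eval_def linear_map_def P.a_ac P.smult_r_distr)
  qed
  then show ?thesis using assms(4) by (simp add: tlift_eq trep)
qed

end

section \<open>Canonical maps between tensor products\<close>

text \<open>The default rule also unfolds unapplied restrictions, in particular identity arrows.\<close>

declare restrict_apply [simp del] restrict_apply' [simp]

context tensor_products
begin

abbreviation tensor_infix (infixl "\<boxtimes>" 75) where "X \<boxtimes> Y \<equiv> tensor R X Y"
abbreviation idm :: "('u, 'x) module \<Rightarrow> 'x \<Rightarrow> 'x" where "idm X \<equiv> (\<lambda>x\<in>carrier X. x)"
abbreviation unit_module ("\<I>") where "\<I> \<equiv> ring_module R"

lemma carrier_unit_module [simp]: "carrier \<I> = carrier R"
  by (simp add: ring_module_def)

lemma mult_unit_module [simp]: "r \<odot>\<^bsub>\<I>\<^esub> s = r \<otimes> s"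
  by (simp add: ring_module_def)

section \<open>Tensor products of maps, unitors, associator and middle swap\<close>

lemma linear_map_pure_left:
  assumes "linear_map R L X h" "y \<in> carrier Y" "module R X" "module R Y"
  shows "linear_map R L (X \<boxtimes> Y) (\<lambda>z. pure R X Y (h z) y)"
  by (rule linear_map_compose[OF bilinear_map_left[OF pure_bilinear]]) (use assms in auto)

lemma linear_map_pure_right:
  assumes "linear_map R L Y h" "x \<in> carrier X" "module R X" "module R Y"
  shows "linear_map R L (X \<boxtimes> Y) (\<lambda>z. pure R X Y x (h z))"
  by (rule linear_map_compose[OF bilinear_map_right[OF pure_bilinear]]) (use assms in auto)

lemma pure_smult_left:
  "\<lbrakk>r \<in> carrier R; x \<in> carrier X; y \<in> carrier Y; module R X; module R Y\<rbrakk>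
    \<Longrightarrow> pure R X Y (r \<odot>\<^bsub>X\<^esub> x) y = r \<odot>\<^bsub>X \<boxtimes> Y\<^esub> pure R X Y x y"
  by (rule linear_map_smult[OF bilinear_map_left[OF pure_bilinear]])

lemma pure_smult_right:
  "\<lbrakk>r \<in> carrier R; x \<in> carrier X; y \<in> carrier Y; module R X; module R Y\<rbrakk>
    \<Longrightarrow> pure R X Y x (r \<odot>\<^bsub>Y\<^esub> y) = r \<odot>\<^bsub>X \<boxtimes> Y\<^esub> pure R X Y x y"
  by (rule linear_map_smult[OF bilinear_map_right[OF pure_bilinear]])

lemma bilinear_tmap:
  assumes "f \<in> lin R X X'" "g \<in> lin R Y Y'"
    and "module R X" "module R X'" "module R Y" "module R Y'"
  shows "bilinear_map R X Y (X' \<boxtimes> Y') (\<lambda>x y. pure R X' Y' (f x) (g y))"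
  by (intro bilinear_mapI linear_map_pure_left linear_map_pure_right lin_linear
      lin_closed[OF assms(1)] lin_closed[OF assms(2)] assms)

lemma tmap_lin:
  assumes "f \<in> lin R X X'" "g \<in> lin R Y Y'"
    and "module R X" "module R X'" "module R Y" "module R Y'"
  shows "tmap R X X' Y Y' f g \<in> lin R (X \<boxtimes> Y) (X' \<boxtimes> Y')"
  unfolding tmap_def by (intro tlift_lin bilinear_tmap tensor_module assms)

lemma tmap_pure:
  assumes "x \<in> carrier X" "y \<in> carrier Y" "f \<in> lin R X X'" "g \<in> lin R Y Y'"
    and "module R X" "module R X'" "module R Y" "module R Y'"
  shows "tmap R X X' Y Y' f g (pure R X Y x y) = pure R X' Y' (f x) (g y)"
  unfolding tmap_def by (intro tlift_pure bilinear_tmap tensor_module assms)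

lemma linear_map_tmap:
  assumes "linear_map R L (X \<boxtimes> Y) h" "f \<in> lin R X X'" "g \<in> lin R Y Y'"
    and "module R X" "module R X'" "module R Y" "module R Y'"
  shows "linear_map R L (X' \<boxtimes> Y') (\<lambda>z. tmap R X X' Y Y' f g (h z))"
  by (intro linear_map_lin[OF tmap_lin] assms)

lemma bilinear_tlunit: "module R X \<Longrightarrow> bilinear_map R \<I> X X (\<lambda>r x. r \<odot>\<^bsub>X\<^esub> x)"
  by (intro bilinear_mapI linear_map_smult_const linear_map_smult_vector linear_map_ident)
    simp_all

lemma bilinear_trunit: "module R X \<Longrightarrow> bilinear_map R X \<I> X (\<lambda>x r. r \<odot>\<^bsub>X\<^esub> x)"
  by (intro bilinear_mapI linear_map_smult_const linear_map_smult_vector linear_map_ident)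
    simp_all

lemma tlunit_lin: "module R X \<Longrightarrow> tlunit R X \<in> lin R (\<I> \<boxtimes> X) X"
  and trunit_lin: "module R X \<Longrightarrow> trunit R X \<in> lin R (X \<boxtimes> \<I>) X"
  unfolding tlunit_def trunit_def
  by (intro tlift_lin bilinear_tlunit bilinear_trunit R_module; assumption)+

lemma tlunit_pure:
  "\<lbrakk>r \<in> carrier R; x \<in> carrier X; module R X\<rbrakk> \<Longrightarrow> tlunit R X (pure R \<I> X r x) = r \<odot>\<^bsub>X\<^esub> x"
  unfolding tlunit_def by (subst tlift_pure) (simp_all add: bilinear_tlunit R_module)

lemma trunit_pure:
  "\<lbrakk>r \<in> carrier R; x \<in> carrier X; module R X\<rbrakk> \<Longrightarrow> trunit R X (pure R X \<I> x r) = r \<odot>\<^bsub>X\<^esub> x"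
  unfolding trunit_def by (subst tlift_pure) (simp_all add: bilinear_trunit R_module)

lemma linear_map_tlunit:
  "\<lbrakk>linear_map R L (\<I> \<boxtimes> X) h; module R X\<rbrakk> \<Longrightarrow> linear_map R L X (\<lambda>z. tlunit R X (h z))"
  by (intro linear_map_lin[OF tlunit_lin])

lemma linear_map_trunit:
  "\<lbrakk>linear_map R L (X \<boxtimes> \<I>) h; module R X\<rbrakk> \<Longrightarrow> linear_map R L X (\<lambda>z. trunit R X (h z))"
  by (intro linear_map_lin[OF trunit_lin])

lemma bilinear_tassoc_inner:
  assumes "z \<in> carrier Z" "module R X" "module R Y" "module R Z"
  shows "bilinear_map R X Y (X \<boxtimes> (Y \<boxtimes> Z)) (\<lambda>x y. pure R X (Y \<boxtimes> Z) x (pure R Y Z y z))"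
  by (intro bilinear_mapI linear_map_pure_left linear_map_pure_right linear_map_ident tensor_module
      pure_closed assms)

text \<open>The associator is a lift inside a lift: linearity in the inner tensor belongs to the
  inner lift, linearity in z is that of a lift in a parameter. The middle swap below has one more
  level.\<close>

lemma bilinear_tassoc:
  assumes "module R X" "module R Y" "module R Z"
  shows "bilinear_map R (X \<boxtimes> Y) Z (X \<boxtimes> (Y \<boxtimes> Z))
    (\<lambda>a z. tlift R X Y (X \<boxtimes> (Y \<boxtimes> Z)) (\<lambda>x y. pure R X (Y \<boxtimes> Z) x (pure R Y Z y z)) a)"
  by (intro bilinear_mapI linear_map_tlift_param linear_map_tlift linear_map_pure_right
      linear_map_ident bilinear_tassoc_inner tensor_module assms)

lemma tassoc_lin:
  assumes "module R X" "module R Y" "module R Z"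
  shows "tassoc R X Y Z \<in> lin R (X \<boxtimes> Y \<boxtimes> Z) (X \<boxtimes> (Y \<boxtimes> Z))"
  unfolding tassoc_def Let_def by (intro tlift_lin bilinear_tassoc tensor_module assms)

lemma tassoc_pure:
  assumes "x \<in> carrier X" "y \<in> carrier Y" "z \<in> carrier Z" "module R X" "module R Y" "module R Z"
  shows "tassoc R X Y Z (pure R (X \<boxtimes> Y) Z (pure R X Y x y) z) = pure R X (Y \<boxtimes> Z) x (pure R Y Z y z)"
  unfolding tassoc_def Let_def
  by (simp add: tlift_pure bilinear_tassoc bilinear_tassoc_inner tensor_module pure_closed assms)

lemma linear_map_tassoc:
  "\<lbrakk>linear_map R L (X \<boxtimes> Y \<boxtimes> Z) h; module R X; module R Y; module R Z\<rbrakk>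
    \<Longrightarrow> linear_map R L (X \<boxtimes> (Y \<boxtimes> Z)) (\<lambda>t. tassoc R X Y Z (h t))"
  by (intro linear_map_lin[OF tassoc_lin])

lemma bilinear_tswap_inner:
  assumes "x \<in> carrier X" "c \<in> carrier C" "module R X" "module R C" "module R Y" "module R D"
  shows "bilinear_map R Y D (X \<boxtimes> Y \<boxtimes> (C \<boxtimes> D))
    (\<lambda>y d. pure R (X \<boxtimes> Y) (C \<boxtimes> D) (pure R X Y x y) (pure R C D c d))"
  by (intro bilinear_mapI linear_map_pure_left linear_map_pure_right linear_map_ident tensor_module
      pure_closed assms)

lemma bilinear_tswap_middle:
  assumes "b \<in> carrier (Y \<boxtimes> D)" "module R X" "module R C" "module R Y" "module R D"
  shows "bilinear_map R X C (X \<boxtimes> Y \<boxtimes> (C \<boxtimes> D))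
    (\<lambda>x c. tlift R Y D (X \<boxtimes> Y \<boxtimes> (C \<boxtimes> D))
      (\<lambda>y d. pure R (X \<boxtimes> Y) (C \<boxtimes> D) (pure R X Y x y) (pure R C D c d)) b)"
  by (intro bilinear_mapI linear_map_tlift_param linear_map_pure_left linear_map_pure_right
      linear_map_ident tensor_module pure_closed assms)

lemma bilinear_tswap:
  assumes "module R X" "module R C" "module R Y" "module R D"
  shows "bilinear_map R (X \<boxtimes> C) (Y \<boxtimes> D) (X \<boxtimes> Y \<boxtimes> (C \<boxtimes> D))
    (\<lambda>a b. tlift R X C (X \<boxtimes> Y \<boxtimes> (C \<boxtimes> D)) (\<lambda>x c. tlift R Y D (X \<boxtimes> Y \<boxtimes> (C \<boxtimes> D))
      (\<lambda>y d. pure R (X \<boxtimes> Y) (C \<boxtimes> D) (pure R X Y x y) (pure R C D c d)) b) a)"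
  by (intro bilinear_mapI linear_map_tlift[OF linear_map_ident] linear_map_tlift_param
      bilinear_tswap_middle bilinear_tswap_inner tensor_module assms)

lemma tswap_lin:
  assumes "module R X" "module R C" "module R Y" "module R D"
  shows "tswap_middle R X C Y D \<in> lin R (X \<boxtimes> C \<boxtimes> (Y \<boxtimes> D)) (X \<boxtimes> Y \<boxtimes> (C \<boxtimes> D))"
  unfolding tswap_middle_def Let_def by (intro tlift_lin bilinear_tswap tensor_module assms)

lemma tswap_pure:
  assumes "x \<in> carrier X" "c \<in> carrier C" "y \<in> carrier Y" "d \<in> carrier D"
    and "module R X" "module R C" "module R Y" "module R D"
  shows "tswap_middle R X C Y D (pure R (X \<boxtimes> C) (Y \<boxtimes> D) (pure R X C x c) (pure R Y D y d))
    = pure R (X \<boxtimes> Y) (C \<boxtimes> D) (pure R X Y x y) (pure R C D c d)"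
  unfolding tswap_middle_def Let_def
  by (simp add: tlift_pure bilinear_tswap bilinear_tswap_middle bilinear_tswap_inner tensor_module
      pure_closed assms)

lemma linear_map_tswap:
  "\<lbrakk>linear_map R L (X \<boxtimes> C \<boxtimes> (Y \<boxtimes> D)) h; module R X; module R C; module R Y; module R D\<rbrakk>
    \<Longrightarrow> linear_map R L (X \<boxtimes> Y \<boxtimes> (C \<boxtimes> D)) (\<lambda>t. tswap_middle R X C Y D (h t))"
  by (intro linear_map_lin[OF tswap_lin])

lemmas tensor_closed = pure_closed lin_closed[OF tmap_lin] lin_closed[OF tlunit_lin]
  lin_closed[OF trunit_lin] lin_closed[OF tassoc_lin] lin_closed[OF tswap_lin]

text \<open>The simplifier turns \<open>carrier \<I>\<close> into \<open>carrier R\<close>, after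
  which \<open>lin_ident\<close> no longer matches the identity of the unit module.\<close>

lemma lin_ident_unit: "(\<lambda>x\<in>carrier R. x) \<in> lin R \<I> \<I>"
  using lin_ident[OF R_module] by simp

lemmas tensor_lin = lin_ident_unit tmap_lin tlunit_lin trunit_lin tassoc_lin tswap_lin lin_ident

lemmas tensor_pure = tmap_pure tlunit_pure trunit_pure tassoc_pure tswap_pure

text \<open>Each of the map rules is stated for a canonical map after an arbitrary linear h, so that
  they chain along a composite of any length.\<close>

lemmas tensor_linear = linear_map_pure_left linear_map_pure_right linear_map_tmap
  linear_map_tlunit linear_map_trunit linear_map_tassoc linear_map_tswap linear_map_ident

text \<open>Evaluates composites of canonical maps on nested pure tensors. Together with
  \<open>tensor_linear\<close> for the linearity premises this settles most identities between such
  maps.\<close>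

lemmas tensor_simps = tensor_closed tensor_lin tensor_pure tensor_module R_module lin_closed

lemma tmap_ident:
  assumes "module R X" "module R Y"
  shows "tmap R X X Y Y (idm X) (idm Y) = idm (X \<boxtimes> Y)"
proof (rule lin_eqI[of _ R "X \<boxtimes> Y" "X \<boxtimes> Y"])
  fix t assume "t \<in> carrier (X \<boxtimes> Y)"
  then show "tmap R X X Y Y (idm X) (idm Y) t = idm (X \<boxtimes> Y) t"
    by (rule tensor_linear_eqI[rotated 3, where P = "X \<boxtimes> Y"])
      (use assms in \<open>simp_all add: tensor_simps lin_linear\<close>)
qed (use assms in \<open>simp_all add: tensor_simps\<close>)

lemma tmap_tmap:
  assumes "f \<in> lin R X X'" "f' \<in> lin R X' X''" "g \<in> lin R Y Y'" "g' \<in> lin R Y' Y''"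
    and "module R X" "module R X'" "module R X''" "module R Y" "module R Y'" "module R Y''"
    and "t \<in> carrier (X \<boxtimes> Y)"
  shows "tmap R X' X'' Y' Y'' f' g' (tmap R X X' Y Y' f g t)
    = tmap R X X'' Y Y'' (compose (carrier X) f' f) (compose (carrier Y) g' g) t"
  using assms(11)
  by (rule tensor_linear_eqI[rotated 3, where P = "X'' \<boxtimes> Y''"])
    (use assms(1-10) in \<open>simp_all add: tensor_simps tensor_linear lin_compose compose_eq lin_linear\<close>)

section \<open>Multilinear maps that agree on pure tensors\<close>

lemma tensor_bilinear_eqI:
  assumes "bilinear_map R (X \<boxtimes> Y) (U \<boxtimes> V) P f" "bilinear_map R (X \<boxtimes> Y) (U \<boxtimes> V) P g"
    and eq: "\<And>x y u v. \<lbrakk>x \<in> carrier X; y \<in> carrier Y; u \<in> carrier U; v \<in> carrier V\<rbrakk>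
      \<Longrightarrow> f (pure R X Y x y) (pure R U V u v) = g (pure R X Y x y) (pure R U V u v)"
    and t: "t \<in> carrier (X \<boxtimes> Y)" and s: "s \<in> carrier (U \<boxtimes> V)"
    and m: "module R X" "module R Y" "module R U" "module R V" "module R P"
  shows "f t s = g t s"
proof (rule tensor_linear_eqI[where P = P and f = "\<lambda>t. f t s" and g = "\<lambda>t. g t s"])
  fix x y assume xy: "x \<in> carrier X" "y \<in> carrier Y"
  show "f (pure R X Y x y) s = g (pure R X Y x y) s"
  proof (rule tensor_linear_eqI[OF _ _ _ s m(3,4,5)])
    show "linear_map R (U \<boxtimes> V) P (f (pure R X Y x y))" "linear_map R (U \<boxtimes> V) P (g (pure R X Y x y))"
      using assms(1,2) pure_closed[OF xy] by (simp_all add: bilinear_map_def)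
  qed (rule eq[OF xy])
qed (simp_all add: t m tensor_module bilinear_map_left[OF assms(1) s] bilinear_map_left[OF assms(2) s])

lemma tensor3_linear_eqI:
  assumes "linear_map R (X \<boxtimes> Y \<boxtimes> Z) P f" "linear_map R (X \<boxtimes> Y \<boxtimes> Z) P g"
    and eq: "\<And>x y z. \<lbrakk>x \<in> carrier X; y \<in> carrier Y; z \<in> carrier Z\<rbrakk>
      \<Longrightarrow> f (pure R (X \<boxtimes> Y) Z (pure R X Y x y) z) = g (pure R (X \<boxtimes> Y) Z (pure R X Y x y) z)"
    and t: "t \<in> carrier (X \<boxtimes> Y \<boxtimes> Z)"
    and m: "module R X" "module R Y" "module R Z" "module R P"
  shows "f t = g t"
proof (rule tensor_linear_eqI[OF assms(1,2) _ t])
  fix a z assume ax: "a \<in> carrier (X \<boxtimes> Y)" "z \<in> carrier Z"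
  show "f (pure R (X \<boxtimes> Y) Z a z) = g (pure R (X \<boxtimes> Y) Z a z)"
    by (rule tensor_linear_eqI[where P = P and f = "\<lambda>a. f (pure R (X \<boxtimes> Y) Z a z)"
          and g = "\<lambda>a. g (pure R (X \<boxtimes> Y) Z a z)", OF _ _ _ ax(1)])
      (simp_all add: ax eq m linear_map_compose[OF assms(1)] linear_map_compose[OF assms(2)]
        tensor_linear tensor_simps)
qed (use m in \<open>auto simp: tensor_module\<close>)

lemma tensor3'_linear_eqI:
  assumes "linear_map R (X \<boxtimes> (Y \<boxtimes> Z)) P f" "linear_map R (X \<boxtimes> (Y \<boxtimes> Z)) P g"
    and eq: "\<And>x y z. \<lbrakk>x \<in> carrier X; y \<in> carrier Y; z \<in> carrier Z\<rbrakk>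
      \<Longrightarrow> f (pure R X (Y \<boxtimes> Z) x (pure R Y Z y z)) = g (pure R X (Y \<boxtimes> Z) x (pure R Y Z y z))"
    and t: "t \<in> carrier (X \<boxtimes> (Y \<boxtimes> Z))"
    and m: "module R X" "module R Y" "module R Z" "module R P"
  shows "f t = g t"
proof (rule tensor_linear_eqI[OF assms(1,2) _ t])
  fix x a assume ax: "x \<in> carrier X" "a \<in> carrier (Y \<boxtimes> Z)"
  show "f (pure R X (Y \<boxtimes> Z) x a) = g (pure R X (Y \<boxtimes> Z) x a)"
    by (rule tensor_linear_eqI[where P = P and f = "\<lambda>a. f (pure R X (Y \<boxtimes> Z) x a)"
          and g = "\<lambda>a. g (pure R X (Y \<boxtimes> Z) x a)", OF _ _ _ ax(2)])
      (simp_all add: ax eq m linear_map_compose[OF assms(1)] linear_map_compose[OF assms(2)]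
        tensor_linear tensor_simps)
qed (use m in \<open>auto simp: tensor_module\<close>)

lemma tensor4_linear_eqI:
  assumes "linear_map R (V \<boxtimes> X \<boxtimes> Y \<boxtimes> Z) P f" "linear_map R (V \<boxtimes> X \<boxtimes> Y \<boxtimes> Z) P g"
    and eq: "\<And>v x y z. \<lbrakk>v \<in> carrier V; x \<in> carrier X; y \<in> carrier Y; z \<in> carrier Z\<rbrakk>
      \<Longrightarrow> f (pure R (V \<boxtimes> X \<boxtimes> Y) Z (pure R (V \<boxtimes> X) Y (pure R V X v x) y) z)
        = g (pure R (V \<boxtimes> X \<boxtimes> Y) Z (pure R (V \<boxtimes> X) Y (pure R V X v x) y) z)"
    and t: "t \<in> carrier (V \<boxtimes> X \<boxtimes> Y \<boxtimes> Z)"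
    and m: "module R V" "module R X" "module R Y" "module R Z" "module R P"
  shows "f t = g t"
proof (rule tensor_linear_eqI[OF assms(1,2) _ t])
  fix a z assume ax: "a \<in> carrier (V \<boxtimes> X \<boxtimes> Y)" "z \<in> carrier Z"
  show "f (pure R (V \<boxtimes> X \<boxtimes> Y) Z a z) = g (pure R (V \<boxtimes> X \<boxtimes> Y) Z a z)"
    by (rule tensor3_linear_eqI[where P = P and f = "\<lambda>a. f (pure R (V \<boxtimes> X \<boxtimes> Y) Z a z)"
          and g = "\<lambda>a. g (pure R (V \<boxtimes> X \<boxtimes> Y) Z a z)", OF _ _ _ ax(1)])
      (simp_all add: ax eq m linear_map_compose[OF assms(1)] linear_map_compose[OF assms(2)]
        tensor_linear tensor_simps)
qed (use m in \<open>auto simp: tensor_module\<close>)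

text \<open>Fits the domain of the middle swap, a tensor product of two tensor products.\<close>

lemma tensor22_linear_eqI:
  assumes "linear_map R (X \<boxtimes> Y \<boxtimes> (U \<boxtimes> V)) P f" "linear_map R (X \<boxtimes> Y \<boxtimes> (U \<boxtimes> V)) P g"
    and eq: "\<And>x y u v. \<lbrakk>x \<in> carrier X; y \<in> carrier Y; u \<in> carrier U; v \<in> carrier V\<rbrakk>
      \<Longrightarrow> f (pure R (X \<boxtimes> Y) (U \<boxtimes> V) (pure R X Y x y) (pure R U V u v))
        = g (pure R (X \<boxtimes> Y) (U \<boxtimes> V) (pure R X Y x y) (pure R U V u v))"
    and t: "t \<in> carrier (X \<boxtimes> Y \<boxtimes> (U \<boxtimes> V))"
    and m: "module R X" "module R Y" "module R U" "module R V" "module R P"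
  shows "f t = g t"
proof (rule tensor_linear_eqI[OF assms(1,2) _ t])
  fix a b assume ax: "a \<in> carrier (X \<boxtimes> Y)" "b \<in> carrier (U \<boxtimes> V)"
  show "f (pure R (X \<boxtimes> Y) (U \<boxtimes> V) a b) = g (pure R (X \<boxtimes> Y) (U \<boxtimes> V) a b)"
    by (rule tensor_bilinear_eqI[where P = P and f = "\<lambda>a b. f (pure R (X \<boxtimes> Y) (U \<boxtimes> V) a b)"
          and g = "\<lambda>a b. g (pure R (X \<boxtimes> Y) (U \<boxtimes> V) a b)", OF bilinear_mapI bilinear_mapI _ ax])
      (simp_all add: ax eq m linear_map_compose[OF assms(1)] linear_map_compose[OF assms(2)]
        tensor_linear tensor_simps)
qed (use m in \<open>auto simp: tensor_module\<close>)

section \<open>Naturality and coherence of the canonical maps\<close>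

lemma tassoc_natural:
  assumes "f \<in> lin R X X'" "g \<in> lin R Y Y'" "h \<in> lin R Z Z'"
    and m: "module R X" "module R X'" "module R Y" "module R Y'" "module R Z" "module R Z'"
    and "t \<in> carrier (X \<boxtimes> Y \<boxtimes> Z)"
  shows "tassoc R X' Y' Z' (tmap R (X \<boxtimes> Y) (X' \<boxtimes> Y') Z Z' (tmap R X X' Y Y' f g) h t)
    = tmap R X X' (Y \<boxtimes> Z) (Y' \<boxtimes> Z') f (tmap R Y Y' Z Z' g h) (tassoc R X Y Z t)"
  using assms(10)
  by (rule tensor3_linear_eqI[rotated 3, where P = "X' \<boxtimes> (Y' \<boxtimes> Z')"])
    (use assms in \<open>simp_all add: tensor_simps tensor_linear\<close>)

lemma tlunit_natural:
  assumes "f \<in> lin R X X'" and m: "module R X" "module R X'" and "t \<in> carrier (\<I> \<boxtimes> X)"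
  shows "tlunit R X' (tmap R \<I> \<I> X X' (idm \<I>) f t) = f (tlunit R X t)"
  using assms(4)
  by (rule tensor_linear_eqI[rotated 3, where P = X'])
    (use assms in \<open>simp_all add: tensor_simps tensor_linear linear_map_lin[OF assms(1)]
      linear_map_smult[OF lin_linear]\<close>)

lemma trunit_natural:
  assumes "f \<in> lin R X X'" and m: "module R X" "module R X'" and "t \<in> carrier (X \<boxtimes> \<I>)"
  shows "trunit R X' (tmap R X X' \<I> \<I> f (idm \<I>) t) = f (trunit R X t)"
  using assms(4)
  by (rule tensor_linear_eqI[rotated 3, where P = X'])
    (use assms in \<open>simp_all add: tensor_simps tensor_linear linear_map_lin[OF assms(1)]
      linear_map_smult[OF lin_linear]\<close>)

lemma tassoc_pentagon:
  assumes m: "module R V" "module R X" "module R Y" "module R Z"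
    and "t \<in> carrier (V \<boxtimes> X \<boxtimes> Y \<boxtimes> Z)"
  shows "tassoc R V X (Y \<boxtimes> Z) (tassoc R (V \<boxtimes> X) Y Z t)
    = tmap R V V (X \<boxtimes> Y \<boxtimes> Z) (X \<boxtimes> (Y \<boxtimes> Z)) (idm V) (tassoc R X Y Z) (tassoc R V (X \<boxtimes> Y) Z
        (tmap R (V \<boxtimes> X \<boxtimes> Y) (V \<boxtimes> (X \<boxtimes> Y)) Z Z (tassoc R V X Y) (idm Z) t))"
  using assms(5)
  by (rule tensor4_linear_eqI[rotated 3, where P = "V \<boxtimes> (X \<boxtimes> (Y \<boxtimes> Z))"])
    (use assms in \<open>simp_all add: tensor_simps tensor_linear\<close>)

text \<open>On x \<otimes> r \<otimes> y the scalar is absorbed by y on one side and by x on the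
  other; bilinearity of the pure tensor turns both into the multiple of x \<otimes> y by r.\<close>

lemma tassoc_triangle:
  assumes m: "module R X" "module R Y" and "t \<in> carrier (X \<boxtimes> \<I> \<boxtimes> Y)"
  shows "tmap R X X (\<I> \<boxtimes> Y) Y (idm X) (tlunit R Y) (tassoc R X \<I> Y t)
    = tmap R (X \<boxtimes> \<I>) X Y Y (trunit R X) (idm Y) t"
  using assms(3)
proof (rule tensor3_linear_eqI[rotated 3, where P = "X \<boxtimes> Y"])
  fix x r y assume "x \<in> carrier X" "r \<in> carrier \<I>" "y \<in> carrier Y"
  moreover from this have "r \<odot>\<^bsub>X\<^esub> x \<in> carrier X" "r \<odot>\<^bsub>Y\<^esub> y \<in> carrier Y"
    using m by (auto simp: module.smult_closed)
  ultimately show "tmap R X X (\<I> \<boxtimes> Y) Y (idm X) (tlunit R Y)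
      (tassoc R X \<I> Y (pure R (X \<boxtimes> \<I>) Y (pure R X \<I> x r) y))
    = tmap R (X \<boxtimes> \<I>) X Y Y (trunit R X) (idm Y) (pure R (X \<boxtimes> \<I>) Y (pure R X \<I> x r) y)"
    using m by (simp add: tensor_simps pure_smult_left pure_smult_right)
qed (use m in \<open>simp_all add: tensor_simps tensor_linear\<close>)

lemma tswap_natural:
  assumes "f \<in> lin R X X'" "g \<in> lin R C C'" "h \<in> lin R Y Y'" "k \<in> lin R D D'"
    and m: "module R X" "module R X'" "module R Y" "module R Y'"
      "module R C" "module R C'" "module R D" "module R D'"
    and "t \<in> carrier (X \<boxtimes> C \<boxtimes> (Y \<boxtimes> D))"
  shows "tswap_middle R X' C' Y' D' (tmap R (X \<boxtimes> C) (X' \<boxtimes> C') (Y \<boxtimes> D) (Y' \<boxtimes> D')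
      (tmap R X X' C C' f g) (tmap R Y Y' D D' h k) t)
    = tmap R (X \<boxtimes> Y) (X' \<boxtimes> Y') (C \<boxtimes> D) (C' \<boxtimes> D') (tmap R X X' Y Y' f h) (tmap R C C' D D' g k)
        (tswap_middle R X C Y D t)"
  using assms(13)
  by (rule tensor22_linear_eqI[rotated 3, where P = "X' \<boxtimes> Y' \<boxtimes> (C' \<boxtimes> D')"])
    (use assms in \<open>simp_all add: tensor_simps tensor_linear\<close>)

section \<open>Tensor products of coactions\<close>

text \<open>The comodule axioms detached from the records. For X = C and
  \<open>\<delta> = \<Delta>\<close> they are coassociativity and the right counit law of a
  coalgebra, so each result about coactions also serves for comultiplications.\<close>

definition coaction ::
  "('u, 'u) module \<Rightarrow> ('u, 'u) module \<Rightarrow> ('u \<Rightarrow> 'u) \<Rightarrow> ('u \<Rightarrow> 'u) \<Rightarrow> ('u \<Rightarrow> 'u) \<Rightarrow> bool" where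
  "coaction X C \<Delta> \<epsilon> \<delta> \<longleftrightarrow> \<delta> \<in> lin R X (X \<boxtimes> C) \<and>
     (\<forall>x\<in>carrier X. tassoc R X C C (tmap R X (X \<boxtimes> C) C C \<delta> (idm C) (\<delta> x)) =
        tmap R X X C (C \<boxtimes> C) (idm X) \<Delta> (\<delta> x)) \<and>
     (\<forall>x\<in>carrier X. trunit R X (tmap R X X C \<I> (idm X) \<epsilon> (\<delta> x)) = x)"

text \<open>Covers both halves of an arrow of comodules: (k, g) between coactions says that k is a
  comodule map out of the corestriction along g, and (g, g) between comultiplications says that g is
  comultiplicative.\<close>

definition intertwines ::
  "('u, 'u) module \<Rightarrow> ('u, 'u) module \<Rightarrow> ('u \<Rightarrow> 'u) \<Rightarrow> ('u, 'u) module \<Rightarrow> ('u, 'u) module \<Rightarrow> ('u \<Rightarrow> 'u)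
    \<Rightarrow> ('u \<Rightarrow> 'u) \<Rightarrow> ('u \<Rightarrow> 'u) \<Rightarrow> bool" where
  "intertwines X C \<delta> Y D \<gamma> k g \<longleftrightarrow> (\<forall>x\<in>carrier X. \<gamma> (k x) = tmap R X Y C D k g (\<delta> x))"

definition tensor_coact ::
  "('u, 'u) module \<Rightarrow> ('u, 'u) module \<Rightarrow> ('u, 'u) module \<Rightarrow> ('u, 'u) module
    \<Rightarrow> ('u \<Rightarrow> 'u) \<Rightarrow> ('u \<Rightarrow> 'u) \<Rightarrow> 'u \<Rightarrow> 'u" where
  "tensor_coact X C Y D \<delta> \<gamma> = compose (carrier (X \<boxtimes> Y)) (tswap_middle R X C Y D)
     (tmap R X (X \<boxtimes> C) Y (Y \<boxtimes> D) \<delta> \<gamma>)"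

definition tensor_counit ::
  "('u, 'u) module \<Rightarrow> ('u, 'u) module \<Rightarrow> ('u \<Rightarrow> 'u) \<Rightarrow> ('u \<Rightarrow> 'u) \<Rightarrow> 'u \<Rightarrow> 'u" where
  "tensor_counit C D \<epsilon> \<epsilon>' = tlift R C D \<I> (\<lambda>c d. \<epsilon> c \<otimes> \<epsilon>' d)"

definition unit_coact :: "'u \<Rightarrow> 'u" where
  "unit_coact = (\<lambda>r\<in>carrier R. pure R \<I> \<I> r \<one>)"

lemma tensor_coact_lin:
  "\<lbrakk>\<delta> \<in> lin R X (X \<boxtimes> C); \<gamma> \<in> lin R Y (Y \<boxtimes> D); module R X; module R C; module R Y; module R D\<rbrakk>
    \<Longrightarrow> tensor_coact X C Y D \<delta> \<gamma> \<in> lin R (X \<boxtimes> Y) (X \<boxtimes> Y \<boxtimes> (C \<boxtimes> D))"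
  unfolding tensor_coact_def by (rule lin_compose[OF tswap_lin tmap_lin]) (simp_all add: tensor_simps)

lemma tensor_coact_pure:
  "\<lbrakk>x \<in> carrier X; y \<in> carrier Y;
    \<delta> \<in> lin R X (X \<boxtimes> C); \<gamma> \<in> lin R Y (Y \<boxtimes> D); module R X; module R C; module R Y; module R D\<rbrakk>
    \<Longrightarrow> tensor_coact X C Y D \<delta> \<gamma> (pure R X Y x y) =
      tswap_middle R X C Y D (pure R (X \<boxtimes> C) (Y \<boxtimes> D) (\<delta> x) (\<gamma> y))"
  by (simp add: tensor_coact_def compose_eq tensor_simps)

lemma linear_map_tensor_coact:
  "\<lbrakk>linear_map R L (X \<boxtimes> Y) h;
    \<delta> \<in> lin R X (X \<boxtimes> C); \<gamma> \<in> lin R Y (Y \<boxtimes> D); module R X; module R C; module R Y; module R D\<rbrakk>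
    \<Longrightarrow> linear_map R L (X \<boxtimes> Y \<boxtimes> (C \<boxtimes> D)) (\<lambda>t. tensor_coact X C Y D \<delta> \<gamma> (h t))"
  by (intro linear_map_lin[OF tensor_coact_lin])

lemma bilinear_tensor_counit:
  assumes "\<epsilon> \<in> lin R C \<I>" "\<epsilon>' \<in> lin R D \<I>"
  shows "bilinear_map R C D \<I> (\<lambda>c d. \<epsilon> c \<otimes> \<epsilon>' d)"
  using lin_linear[OF assms(1)] lin_linear[OF assms(2)]
  by (auto simp: bilinear_map_def linear_map_def ring_module_def l_distr r_distr m_assoc m_lcomm)

lemma tensor_counit_lin:
  "\<lbrakk>\<epsilon> \<in> lin R C \<I>; \<epsilon>' \<in> lin R D \<I>; module R C; module R D\<rbrakk>
    \<Longrightarrow> tensor_counit C D \<epsilon> \<epsilon>' \<in> lin R (C \<boxtimes> D) \<I>"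
  unfolding tensor_counit_def by (intro tlift_lin bilinear_tensor_counit R_module)

lemma tensor_counit_pure:
  "\<lbrakk>c \<in> carrier C; d \<in> carrier D; \<epsilon> \<in> lin R C \<I>; \<epsilon>' \<in> lin R D \<I>; module R C; module R D\<rbrakk>
    \<Longrightarrow> tensor_counit C D \<epsilon> \<epsilon>' (pure R C D c d) = \<epsilon> c \<otimes> \<epsilon>' d"
  unfolding tensor_counit_def by (intro tlift_pure bilinear_tensor_counit R_module)

lemma linear_map_tensor_counit:
  "\<lbrakk>linear_map R L (C \<boxtimes> D) h; \<epsilon> \<in> lin R C \<I>; \<epsilon>' \<in> lin R D \<I>; module R C; module R D\<rbrakk>
    \<Longrightarrow> linear_map R L \<I> (\<lambda>t. tensor_counit C D \<epsilon> \<epsilon>' (h t))"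
  by (intro linear_map_lin[OF tensor_counit_lin])

lemma unit_lin_closed: "\<epsilon> \<in> lin R C \<I> \<Longrightarrow> c \<in> carrier C \<Longrightarrow> \<epsilon> c \<in> carrier R"
  using lin_closed[of \<epsilon> R C \<I> c] by simp

lemma unit_coact_lin: "unit_coact \<in> lin R \<I> (\<I> \<boxtimes> \<I>)"
  unfolding unit_coact_def
  using linear_restrict_lin[OF linear_map_pure_left[OF linear_map_ident, of \<one> \<I> \<I>] R_module]
  by (simp add: R_module)

lemma unit_coact_apply: "r \<in> carrier R \<Longrightarrow> unit_coact r = pure R \<I> \<I> r \<one>"
  by (simp add: unit_coact_def)

lemmas coact_simps = tensor_simps tensor_coact_lin tensor_coact_pure tensor_counit_lin
  tensor_counit_pure unit_lin_closed unit_coact_lin unit_coact_apply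

lemmas coact_linear = tensor_linear linear_map_tensor_coact linear_map_tensor_counit

text \<open>In the proofs below a coaction enters only through its values \<open>\<delta> x\<close>, which are replaced by
  arbitrary elements of \<open>X \<otimes> C\<close>; both sides being multilinear in these, pure tensors suffice.\<close>

lemma tensor_coact_coassoc:
  assumes lin: "\<delta> \<in> lin R X (X \<boxtimes> C)" "\<gamma> \<in> lin R Y (Y \<boxtimes> D)"
    and m: "module R X" "module R C" "module R Y" "module R D"
    and t: "t \<in> carrier (X \<boxtimes> C)" and s: "s \<in> carrier (Y \<boxtimes> D)"
  shows "tassoc R (X \<boxtimes> Y) (C \<boxtimes> D) (C \<boxtimes> D)
      (tmap R (X \<boxtimes> Y) (X \<boxtimes> Y \<boxtimes> (C \<boxtimes> D)) (C \<boxtimes> D) (C \<boxtimes> D) (tensor_coact X C Y D \<delta> \<gamma>) (idm (C \<boxtimes> D))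
        (tswap_middle R X C Y D (pure R (X \<boxtimes> C) (Y \<boxtimes> D) t s))) =
    tmap R (X \<boxtimes> Y) (X \<boxtimes> Y) (C \<boxtimes> C \<boxtimes> (D \<boxtimes> D)) (C \<boxtimes> D \<boxtimes> (C \<boxtimes> D)) (idm (X \<boxtimes> Y)) (tswap_middle R C C D D)
      (tswap_middle R X (C \<boxtimes> C) Y (D \<boxtimes> D) (pure R (X \<boxtimes> (C \<boxtimes> C)) (Y \<boxtimes> (D \<boxtimes> D))
        (tassoc R X C C (tmap R X (X \<boxtimes> C) C C \<delta> (idm C) t))
        (tassoc R Y D D (tmap R Y (Y \<boxtimes> D) D D \<gamma> (idm D) s))))"
proof -
  \<comment> \<open>When t and s are pure, the coactions are applied to their first entries and give
    arbitrary a and b, which need not be pure. This inner claim carries out the second reduction to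
    pure tensors.\<close>
  have pure: "tassoc R (X \<boxtimes> Y) (C \<boxtimes> D) (C \<boxtimes> D)
      (pure R (X \<boxtimes> Y \<boxtimes> (C \<boxtimes> D)) (C \<boxtimes> D) (tswap_middle R X C Y D (pure R (X \<boxtimes> C) (Y \<boxtimes> D) a b))
        (pure R C D c d)) =
    tmap R (X \<boxtimes> Y) (X \<boxtimes> Y) (C \<boxtimes> C \<boxtimes> (D \<boxtimes> D)) (C \<boxtimes> D \<boxtimes> (C \<boxtimes> D)) (idm (X \<boxtimes> Y)) (tswap_middle R C C D D)
      (tswap_middle R X (C \<boxtimes> C) Y (D \<boxtimes> D) (pure R (X \<boxtimes> (C \<boxtimes> C)) (Y \<boxtimes> (D \<boxtimes> D))
        (tassoc R X C C (pure R (X \<boxtimes> C) C a c)) (tassoc R Y D D (pure R (Y \<boxtimes> D) D b d))))"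
    if "c \<in> carrier C" "d \<in> carrier D" "a \<in> carrier (X \<boxtimes> C)" "b \<in> carrier (Y \<boxtimes> D)" for a b c d
    using that(3,4)
    by (rule tensor_bilinear_eqI[rotated 3, where P = "X \<boxtimes> Y \<boxtimes> (C \<boxtimes> D \<boxtimes> (C \<boxtimes> D))"])
      (use that(1,2) m in \<open>simp_all add: coact_simps coact_linear bilinear_mapI\<close>)
  show ?thesis
    using t s
    by (rule tensor_bilinear_eqI[rotated 3, where P = "X \<boxtimes> Y \<boxtimes> (C \<boxtimes> D \<boxtimes> (C \<boxtimes> D))"])
      (use m lin in \<open>simp_all add: coact_simps coact_linear bilinear_mapI pure\<close>)
qed

text \<open>The right side is that of \<open>tensor_coact_coassoc\<close> with the twice coacted t
  and s replaced by the comultiplied ones. Coassociativity of the two factors identifies them, hence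
  also the left sides.\<close>

lemma tensor_coact_comult:
  assumes lin: "\<Delta> \<in> lin R C (C \<boxtimes> C)" "\<Delta>' \<in> lin R D (D \<boxtimes> D)"
    and m: "module R X" "module R C" "module R Y" "module R D"
    and t: "t \<in> carrier (X \<boxtimes> C)" and s: "s \<in> carrier (Y \<boxtimes> D)"
  shows "tmap R (X \<boxtimes> Y) (X \<boxtimes> Y) (C \<boxtimes> D) (C \<boxtimes> D \<boxtimes> (C \<boxtimes> D)) (idm (X \<boxtimes> Y)) (tensor_coact C C D D \<Delta> \<Delta>')
      (tswap_middle R X C Y D (pure R (X \<boxtimes> C) (Y \<boxtimes> D) t s)) =
    tmap R (X \<boxtimes> Y) (X \<boxtimes> Y) (C \<boxtimes> C \<boxtimes> (D \<boxtimes> D)) (C \<boxtimes> D \<boxtimes> (C \<boxtimes> D)) (idm (X \<boxtimes> Y)) (tswap_middle R C C D D)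
      (tswap_middle R X (C \<boxtimes> C) Y (D \<boxtimes> D) (pure R (X \<boxtimes> (C \<boxtimes> C)) (Y \<boxtimes> (D \<boxtimes> D))
        (tmap R X X C (C \<boxtimes> C) (idm X) \<Delta> t) (tmap R Y Y D (D \<boxtimes> D) (idm Y) \<Delta>' s)))"
  using t s
  by (rule tensor_bilinear_eqI[rotated 3, where P = "X \<boxtimes> Y \<boxtimes> (C \<boxtimes> D \<boxtimes> (C \<boxtimes> D))"])
    (use m lin in \<open>simp_all add: coact_simps coact_linear bilinear_mapI\<close>)

text \<open>The counits leave two scalars on x \<otimes> y: on the left as one product, on the right
  as one scalar at each factor. Collecting them uses that R is commutative.\<close>

lemma tensor_counit_right:
  assumes lin: "\<epsilon> \<in> lin R C \<I>" "\<epsilon>' \<in> lin R D \<I>"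
    and m: "module R X" "module R C" "module R Y" "module R D"
    and t: "t \<in> carrier (X \<boxtimes> C)" and s: "s \<in> carrier (Y \<boxtimes> D)"
  shows "trunit R (X \<boxtimes> Y) (tmap R (X \<boxtimes> Y) (X \<boxtimes> Y) (C \<boxtimes> D) \<I> (idm (X \<boxtimes> Y)) (tensor_counit C D \<epsilon> \<epsilon>')
      (tswap_middle R X C Y D (pure R (X \<boxtimes> C) (Y \<boxtimes> D) t s))) =
    pure R X Y (trunit R X (tmap R X X C \<I> (idm X) \<epsilon> t)) (trunit R Y (tmap R Y Y D \<I> (idm Y) \<epsilon>' s))"
  using t s
proof (rule tensor_bilinear_eqI[rotated 3, where P = "X \<boxtimes> Y"])
  fix x c y d assume "x \<in> carrier X" "c \<in> carrier C" "y \<in> carrier Y" "d \<in> carrier D"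
  then show "trunit R (X \<boxtimes> Y) (tmap R (X \<boxtimes> Y) (X \<boxtimes> Y) (C \<boxtimes> D) \<I> (idm (X \<boxtimes> Y)) (tensor_counit C D \<epsilon> \<epsilon>')
      (tswap_middle R X C Y D (pure R (X \<boxtimes> C) (Y \<boxtimes> D) (pure R X C x c) (pure R Y D y d)))) =
    pure R X Y (trunit R X (tmap R X X C \<I> (idm X) \<epsilon> (pure R X C x c)))
      (trunit R Y (tmap R Y Y D \<I> (idm Y) \<epsilon>' (pure R Y D y d)))"
    using m lin by (simp add: coact_simps pure_smult_left pure_smult_right module.smult_closed
        module.smult_assoc1[OF tensor_module, symmetric] m_comm)
qed (use m lin in \<open>simp_all add: coact_simps coact_linear bilinear_mapI\<close>)

text \<open>The predicate \<open>coaction\<close> contains the right counit law only. This is the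
  counterpart on the other side, which is meaningful for coalgebras and completes their
  axioms.\<close>

lemma tensor_counit_left:
  assumes lin: "\<epsilon> \<in> lin R C \<I>" "\<epsilon>' \<in> lin R D \<I>"
    and m: "module R C" "module R D"
    and t: "t \<in> carrier (C \<boxtimes> C)" and s: "s \<in> carrier (D \<boxtimes> D)"
  shows "tlunit R (C \<boxtimes> D) (tmap R (C \<boxtimes> D) \<I> (C \<boxtimes> D) (C \<boxtimes> D) (tensor_counit C D \<epsilon> \<epsilon>') (idm (C \<boxtimes> D))
      (tswap_middle R C C D D (pure R (C \<boxtimes> C) (D \<boxtimes> D) t s))) =
    pure R C D (tlunit R C (tmap R C \<I> C C \<epsilon> (idm C) t)) (tlunit R D (tmap R D \<I> D D \<epsilon>' (idm D) s))"
  using t s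
proof (rule tensor_bilinear_eqI[rotated 3, where P = "C \<boxtimes> D"])
  fix x c y d assume "x \<in> carrier C" "c \<in> carrier C" "y \<in> carrier D" "d \<in> carrier D"
  then show "tlunit R (C \<boxtimes> D) (tmap R (C \<boxtimes> D) \<I> (C \<boxtimes> D) (C \<boxtimes> D) (tensor_counit C D \<epsilon> \<epsilon>') (idm (C \<boxtimes> D))
      (tswap_middle R C C D D (pure R (C \<boxtimes> C) (D \<boxtimes> D) (pure R C C x c) (pure R D D y d)))) =
    pure R C D (tlunit R C (tmap R C \<I> C C \<epsilon> (idm C) (pure R C C x c)))
      (tlunit R D (tmap R D \<I> D D \<epsilon>' (idm D) (pure R D D y d)))"
    using m lin by (simp add: coact_simps pure_smult_left pure_smult_right module.smult_closed
        module.smult_assoc1[OF tensor_module, symmetric] m_comm)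
qed (use m lin in \<open>simp_all add: coact_simps coact_linear bilinear_mapI\<close>)

text \<open>Used for the tensor product of comodules and, with comultiplications as the coactions,
  for the tensor product of coalgebras.\<close>

lemma coaction_tensor:
  assumes \<delta>: "coaction X C \<Delta> \<epsilon> \<delta>" and \<gamma>: "coaction Y D \<Delta>' \<epsilon>' \<gamma>"
    and lin: "\<Delta> \<in> lin R C (C \<boxtimes> C)" "\<Delta>' \<in> lin R D (D \<boxtimes> D)" "\<epsilon> \<in> lin R C \<I>" "\<epsilon>' \<in> lin R D \<I>"
    and m: "module R X" "module R C" "module R Y" "module R D"
  shows "coaction (X \<boxtimes> Y) (C \<boxtimes> D) (tensor_coact C C D D \<Delta> \<Delta>') (tensor_counit C D \<epsilon> \<epsilon>')
    (tensor_coact X C Y D \<delta> \<gamma>)"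
  unfolding coaction_def
proof (intro conjI ballI)
  have \<delta>\<gamma>: "\<delta> \<in> lin R X (X \<boxtimes> C)" "\<gamma> \<in> lin R Y (Y \<boxtimes> D)"
    using \<delta> \<gamma> by (simp_all add: coaction_def)
  note simps = coact_simps coact_linear linear_map_lin[OF \<delta>\<gamma>(1)] linear_map_lin[OF \<delta>\<gamma>(2)]
    lin_closed[OF \<delta>\<gamma>(1)] lin_closed[OF \<delta>\<gamma>(2)] lin \<delta>\<gamma> m
  show "tensor_coact X C Y D \<delta> \<gamma> \<in> lin R (X \<boxtimes> Y) (X \<boxtimes> Y \<boxtimes> (C \<boxtimes> D))"
    by (simp add: simps)
  fix t assume t: "t \<in> carrier (X \<boxtimes> Y)"
  show "tassoc R (X \<boxtimes> Y) (C \<boxtimes> D) (C \<boxtimes> D) (tmap R (X \<boxtimes> Y) (X \<boxtimes> Y \<boxtimes> (C \<boxtimes> D)) (C \<boxtimes> D) (C \<boxtimes> D)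
      (tensor_coact X C Y D \<delta> \<gamma>) (idm (C \<boxtimes> D)) (tensor_coact X C Y D \<delta> \<gamma> t)) =
    tmap R (X \<boxtimes> Y) (X \<boxtimes> Y) (C \<boxtimes> D) (C \<boxtimes> D \<boxtimes> (C \<boxtimes> D)) (idm (X \<boxtimes> Y)) (tensor_coact C C D D \<Delta> \<Delta>')
      (tensor_coact X C Y D \<delta> \<gamma> t)"
    using t
    by (rule tensor_linear_eqI[rotated 3, where P = "X \<boxtimes> Y \<boxtimes> (C \<boxtimes> D \<boxtimes> (C \<boxtimes> D))"])
      (use \<delta> \<gamma> in \<open>simp_all add: simps tensor_coact_coassoc tensor_coact_comult coaction_def\<close>)
  show "trunit R (X \<boxtimes> Y) (tmap R (X \<boxtimes> Y) (X \<boxtimes> Y) (C \<boxtimes> D) \<I> (idm (X \<boxtimes> Y)) (tensor_counit C D \<epsilon> \<epsilon>')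
      (tensor_coact X C Y D \<delta> \<gamma> t)) = t"
    using t
    by (rule tensor_linear_eqI[rotated 3, where P = "X \<boxtimes> Y"])
      (use \<delta> \<gamma> in \<open>simp_all add: simps tensor_counit_right coaction_def\<close>)
qed

lemma tensor_comult_counit_left:
  assumes lin: "\<Delta> \<in> lin R C (C \<boxtimes> C)" "\<Delta>' \<in> lin R D (D \<boxtimes> D)" "\<epsilon> \<in> lin R C \<I>" "\<epsilon>' \<in> lin R D \<I>"
    and m: "module R C" "module R D"
    and "\<And>c. c \<in> carrier C \<Longrightarrow> tlunit R C (tmap R C \<I> C C \<epsilon> (idm C) (\<Delta> c)) = c"
    and "\<And>d. d \<in> carrier D \<Longrightarrow> tlunit R D (tmap R D \<I> D D \<epsilon>' (idm D) (\<Delta>' d)) = d"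
    and t: "t \<in> carrier (C \<boxtimes> D)"
  shows "tlunit R (C \<boxtimes> D) (tmap R (C \<boxtimes> D) \<I> (C \<boxtimes> D) (C \<boxtimes> D) (tensor_counit C D \<epsilon> \<epsilon>') (idm (C \<boxtimes> D))
    (tensor_coact C C D D \<Delta> \<Delta>' t)) = t"
  using t
  by (rule tensor_linear_eqI[rotated 3, where P = "C \<boxtimes> D"])
    (use assms in \<open>simp_all add: coact_simps coact_linear tensor_counit_left\<close>)

lemma coaction_unit: "coaction \<I> \<I> unit_coact (idm \<I>) unit_coact"
  unfolding coaction_def by (simp add: coact_simps)

section \<open>Intertwining maps and the structural isomorphisms\<close>

lemma intertwines_ident:
  assumes "\<delta> \<in> lin R X (X \<boxtimes> C)" "module R X" "module R C"
  shows "intertwines X C \<delta> X C \<delta> (idm X) (idm C)"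
  using assms lin_closed[OF assms(1)] by (simp add: intertwines_def tmap_ident)

lemma intertwines_compose:
  assumes "intertwines X C \<delta> Y D \<gamma> k g" "intertwines Y D \<gamma> Z E \<zeta> k' g'"
    and lin: "\<delta> \<in> lin R X (X \<boxtimes> C)" "k \<in> lin R X Y" "g \<in> lin R C D" "k' \<in> lin R Y Z" "g' \<in> lin R D E"
    and m: "module R X" "module R C" "module R Y" "module R D" "module R Z" "module R E"
  shows "intertwines X C \<delta> Z E \<zeta> (compose (carrier X) k' k) (compose (carrier C) g' g)"
  using assms lin_closed[OF lin(1)] lin_closed[OF lin(2)]
  by (simp add: intertwines_def compose_eq tmap_tmap)

text \<open>Write y as k(k' y), let k and g intertwine, and cancel. This spares a computation with
  the coactions for the inverses of the associator and the unitors.\<close>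

lemma intertwines_inverse:
  assumes "intertwines X C \<delta> Y D \<gamma> k g"
    and lin: "\<delta> \<in> lin R X (X \<boxtimes> C)" "k \<in> lin R X Y" "g \<in> lin R C D" "k' \<in> lin R Y X" "g' \<in> lin R D C"
    and m: "module R X" "module R C" "module R Y" "module R D"
    and inv: "compose (carrier X) k' k = idm X" "compose (carrier C) g' g = idm C"
      "\<And>y. y \<in> carrier Y \<Longrightarrow> k (k' y) = y"
  shows "intertwines Y D \<gamma> X C \<delta> k' g'"
  unfolding intertwines_def
proof
  fix y assume y: "y \<in> carrier Y"
  note c = lin_closed[OF lin(1) lin_closed[OF lin(4) y]] lin_closed[OF lin(4) y]
  have "tmap R Y X D C k' g' (\<gamma> y) = tmap R Y X D C k' g' (\<gamma> (k (k' y)))"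
    by (simp add: inv y)
  also have "\<dots> = tmap R Y X D C k' g' (tmap R X Y C D k g (\<delta> (k' y)))"
    using assms(1) c by (simp add: intertwines_def)
  also have "\<dots> = \<delta> (k' y)"
    using c lin m by (simp add: tmap_tmap inv tmap_ident)
  finally show "\<delta> (k' y) = tmap R Y X D C k' g' (\<gamma> y)" by simp
qed

lemma intertwines_tensor:
  assumes "intertwines X C \<delta> X' C' \<delta>' k g" "intertwines Y D \<gamma> Y' D' \<gamma>' k' g'"
    and lin: "\<delta> \<in> lin R X (X \<boxtimes> C)" "\<delta>' \<in> lin R X' (X' \<boxtimes> C')" "\<gamma> \<in> lin R Y (Y \<boxtimes> D)" "\<gamma>' \<in> lin R Y' (Y' \<boxtimes> D')"
      "k \<in> lin R X X'" "g \<in> lin R C C'" "k' \<in> lin R Y Y'" "g' \<in> lin R D D'"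
    and m: "module R X" "module R C" "module R Y" "module R D"
      "module R X'" "module R C'" "module R Y'" "module R D'"
  shows "intertwines (X \<boxtimes> Y) (C \<boxtimes> D) (tensor_coact X C Y D \<delta> \<gamma>)
    (X' \<boxtimes> Y') (C' \<boxtimes> D') (tensor_coact X' C' Y' D' \<delta>' \<gamma>') (tmap R X X' Y Y' k k') (tmap R C C' D D' g g')"
  unfolding intertwines_def
proof
  have tswap: "tswap_middle R X' C' Y' D' (pure R (X' \<boxtimes> C') (Y' \<boxtimes> D')
      (tmap R X X' C C' k g a) (tmap R Y Y' D D' k' g' b)) =
    tmap R (X \<boxtimes> Y) (X' \<boxtimes> Y') (C \<boxtimes> D) (C' \<boxtimes> D') (tmap R X X' Y Y' k k') (tmap R C C' D D' g g')
      (tswap_middle R X C Y D (pure R (X \<boxtimes> C) (Y \<boxtimes> D) a b))"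
    if "a \<in> carrier (X \<boxtimes> C)" "b \<in> carrier (Y \<boxtimes> D)" for a b
    using that lin m by (subst tswap_natural[symmetric]) (simp_all add: tensor_simps)
  fix t assume "t \<in> carrier (X \<boxtimes> Y)"
  then show "tensor_coact X' C' Y' D' \<delta>' \<gamma>' (tmap R X X' Y Y' k k' t) =
    tmap R (X \<boxtimes> Y) (X' \<boxtimes> Y') (C \<boxtimes> D) (C' \<boxtimes> D') (tmap R X X' Y Y' k k') (tmap R C C' D D' g g')
      (tensor_coact X C Y D \<delta> \<gamma> t)"
    by (rule tensor_linear_eqI[rotated 3, where P = "X' \<boxtimes> Y' \<boxtimes> (C' \<boxtimes> D')"])
      (use assms in \<open>simp_all add: coact_simps coact_linear tswap intertwines_def\<close>)
qed

lemma intertwines_tassoc: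
  assumes lin: "\<delta> \<in> lin R X (X \<boxtimes> C)" "\<gamma> \<in> lin R Y (Y \<boxtimes> D)" "\<zeta> \<in> lin R Z (Z \<boxtimes> E)"
    and m: "module R X" "module R C" "module R Y" "module R D" "module R Z" "module R E"
  shows "intertwines (X \<boxtimes> Y \<boxtimes> Z) (C \<boxtimes> D \<boxtimes> E)
      (tensor_coact (X \<boxtimes> Y) (C \<boxtimes> D) Z E (tensor_coact X C Y D \<delta> \<gamma>) \<zeta>)
    (X \<boxtimes> (Y \<boxtimes> Z)) (C \<boxtimes> (D \<boxtimes> E))
      (tensor_coact X C (Y \<boxtimes> Z) (D \<boxtimes> E) \<delta> (tensor_coact Y D Z E \<gamma> \<zeta>))
    (tassoc R X Y Z) (tassoc R C D E)"
  unfolding intertwines_def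
proof
  \<comment> \<open>With the three coaction values replaced by arbitrary a, b, c the claim is
    trilinear. It is first shown in a and b for a pure third argument and then extended to all
    c.\<close>
  have 1: "tswap_middle R X C (Y \<boxtimes> Z) (D \<boxtimes> E) (pure R (X \<boxtimes> C) (Y \<boxtimes> Z \<boxtimes> (D \<boxtimes> E)) a
      (tswap_middle R Y D Z E (pure R (Y \<boxtimes> D) (Z \<boxtimes> E) b (pure R Z E z e)))) =
    tmap R (X \<boxtimes> Y \<boxtimes> Z) (X \<boxtimes> (Y \<boxtimes> Z)) (C \<boxtimes> D \<boxtimes> E) (C \<boxtimes> (D \<boxtimes> E)) (tassoc R X Y Z) (tassoc R C D E)
      (tswap_middle R (X \<boxtimes> Y) (C \<boxtimes> D) Z E (pure R (X \<boxtimes> Y \<boxtimes> (C \<boxtimes> D)) (Z \<boxtimes> E)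
        (tswap_middle R X C Y D (pure R (X \<boxtimes> C) (Y \<boxtimes> D) a b)) (pure R Z E z e)))"
    if "z \<in> carrier Z" "e \<in> carrier E" "a \<in> carrier (X \<boxtimes> C)" "b \<in> carrier (Y \<boxtimes> D)" for z e a b
    using that(3,4)
    by (rule tensor_bilinear_eqI[rotated 3, where P = "X \<boxtimes> (Y \<boxtimes> Z) \<boxtimes> (C \<boxtimes> (D \<boxtimes> E))"])
      (use that(1,2) m in \<open>simp_all add: coact_simps coact_linear bilinear_mapI\<close>)
  have 2: "tswap_middle R X C (Y \<boxtimes> Z) (D \<boxtimes> E) (pure R (X \<boxtimes> C) (Y \<boxtimes> Z \<boxtimes> (D \<boxtimes> E)) a
      (tswap_middle R Y D Z E (pure R (Y \<boxtimes> D) (Z \<boxtimes> E) b c))) =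
    tmap R (X \<boxtimes> Y \<boxtimes> Z) (X \<boxtimes> (Y \<boxtimes> Z)) (C \<boxtimes> D \<boxtimes> E) (C \<boxtimes> (D \<boxtimes> E)) (tassoc R X Y Z) (tassoc R C D E)
      (tswap_middle R (X \<boxtimes> Y) (C \<boxtimes> D) Z E (pure R (X \<boxtimes> Y \<boxtimes> (C \<boxtimes> D)) (Z \<boxtimes> E)
        (tswap_middle R X C Y D (pure R (X \<boxtimes> C) (Y \<boxtimes> D) a b)) c))"
    if "a \<in> carrier (X \<boxtimes> C)" "b \<in> carrier (Y \<boxtimes> D)" "c \<in> carrier (Z \<boxtimes> E)" for a b c
    using that(3)
    by (rule tensor_linear_eqI[rotated 3, where P = "X \<boxtimes> (Y \<boxtimes> Z) \<boxtimes> (C \<boxtimes> (D \<boxtimes> E))"])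
      (use that(1,2) m in \<open>simp_all add: coact_simps coact_linear 1\<close>)
  fix t assume "t \<in> carrier (X \<boxtimes> Y \<boxtimes> Z)"
  then show "tensor_coact X C (Y \<boxtimes> Z) (D \<boxtimes> E) \<delta> (tensor_coact Y D Z E \<gamma> \<zeta>) (tassoc R X Y Z t) =
    tmap R (X \<boxtimes> Y \<boxtimes> Z) (X \<boxtimes> (Y \<boxtimes> Z)) (C \<boxtimes> D \<boxtimes> E) (C \<boxtimes> (D \<boxtimes> E)) (tassoc R X Y Z) (tassoc R C D E)
      (tensor_coact (X \<boxtimes> Y) (C \<boxtimes> D) Z E (tensor_coact X C Y D \<delta> \<gamma>) \<zeta> t)"
    by (rule tensor3_linear_eqI[rotated 3, where P = "X \<boxtimes> (Y \<boxtimes> Z) \<boxtimes> (C \<boxtimes> (D \<boxtimes> E))"])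
      (use lin m in \<open>simp_all add: coact_simps coact_linear 2\<close>)
qed

lemma intertwines_tlunit:
  assumes lin: "\<delta> \<in> lin R X (X \<boxtimes> C)" and m: "module R X" "module R C"
  shows "intertwines (\<I> \<boxtimes> X) (\<I> \<boxtimes> C) (tensor_coact \<I> \<I> X C unit_coact \<delta>) X C \<delta> (tlunit R X) (tlunit R C)"
  unfolding intertwines_def
proof
  \<comment> \<open>R coacts by \<open>r \<mapsto> r \<otimes> 1\<close>. The unitor of X absorbs r
    and that of C absorbs 1, so an arbitrary t in place of the coaction value is merely multiplied
    by r.\<close>
  have 1: "tmap R (\<I> \<boxtimes> X) X (\<I> \<boxtimes> C) C (tlunit R X) (tlunit R C)
      (tswap_middle R \<I> \<I> X C (pure R (\<I> \<boxtimes> \<I>) (X \<boxtimes> C) (pure R \<I> \<I> r \<one>) t)) = r \<odot>\<^bsub>X \<boxtimes> C\<^esub> t"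
    if "r \<in> carrier R" "t \<in> carrier (X \<boxtimes> C)" for r t
    using that(2)
    by (rule tensor_linear_eqI[rotated 3, where P = "X \<boxtimes> C"])
      (use that(1) m in \<open>simp_all add: coact_simps coact_linear linear_map_smult_const
        module.smult_closed module.smult_one pure_smult_left\<close>)
  fix t assume "t \<in> carrier (\<I> \<boxtimes> X)"
  then show "\<delta> (tlunit R X t) = tmap R (\<I> \<boxtimes> X) X (\<I> \<boxtimes> C) C (tlunit R X) (tlunit R C)
      (tensor_coact \<I> \<I> X C unit_coact \<delta> t)"
    by (rule tensor_linear_eqI[rotated 3, where P = "X \<boxtimes> C"])
      (use lin m in \<open>simp_all add: coact_simps coact_linear 1 linear_map_lin[OF lin]
        linear_map_smult[OF lin_linear]\<close>)
qed

lemma intertwines_trunit: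
  assumes lin: "\<delta> \<in> lin R X (X \<boxtimes> C)" and m: "module R X" "module R C"
  shows "intertwines (X \<boxtimes> \<I>) (C \<boxtimes> \<I>) (tensor_coact X C \<I> \<I> \<delta> unit_coact) X C \<delta> (trunit R X) (trunit R C)"
  unfolding intertwines_def
proof
  have 1: "tmap R (X \<boxtimes> \<I>) X (C \<boxtimes> \<I>) C (trunit R X) (trunit R C)
      (tswap_middle R X C \<I> \<I> (pure R (X \<boxtimes> C) (\<I> \<boxtimes> \<I>) t (pure R \<I> \<I> r \<one>))) = r \<odot>\<^bsub>X \<boxtimes> C\<^esub> t"
    if "r \<in> carrier R" "t \<in> carrier (X \<boxtimes> C)" for r t
    using that(2)
    by (rule tensor_linear_eqI[rotated 3, where P = "X \<boxtimes> C"])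
      (use that(1) m in \<open>simp_all add: coact_simps coact_linear linear_map_smult_const
        module.smult_closed module.smult_one pure_smult_left\<close>)
  fix t assume "t \<in> carrier (X \<boxtimes> \<I>)"
  then show "\<delta> (trunit R X t) = tmap R (X \<boxtimes> \<I>) X (C \<boxtimes> \<I>) C (trunit R X) (trunit R C)
      (tensor_coact X C \<I> \<I> \<delta> unit_coact t)"
    by (rule tensor_linear_eqI[rotated 3, where P = "X \<boxtimes> C"])
      (use lin m in \<open>simp_all add: coact_simps coact_linear 1 linear_map_lin[OF lin]
        linear_map_smult[OF lin_linear]\<close>)
qed

section \<open>Counits under the structural maps\<close>

lemma tensor_counit_tmap:
  assumes lin: "\<epsilon> \<in> lin R C \<I>" "\<epsilon>' \<in> lin R D \<I>" "\<xi> \<in> lin R C' \<I>" "\<xi>' \<in> lin R D' \<I>"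
      "g \<in> lin R C C'" "g' \<in> lin R D D'"
    and m: "module R C" "module R D" "module R C'" "module R D'"
    and "\<And>c. c \<in> carrier C \<Longrightarrow> \<xi> (g c) = \<epsilon> c" "\<And>d. d \<in> carrier D \<Longrightarrow> \<xi>' (g' d) = \<epsilon>' d"
    and t: "t \<in> carrier (C \<boxtimes> D)"
  shows "tensor_counit C' D' \<xi> \<xi>' (tmap R C C' D D' g g' t) = tensor_counit C D \<epsilon> \<epsilon>' t"
  using t
  by (rule tensor_linear_eqI[rotated 3, where P = \<I>])
    (use assms in \<open>simp_all add: coact_simps coact_linear\<close>)

lemma tensor_counit_tassoc:
  assumes lin: "\<epsilon> \<in> lin R C \<I>" "\<epsilon>' \<in> lin R D \<I>" "\<epsilon>'' \<in> lin R E \<I>"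
    and m: "module R C" "module R D" "module R E"
    and t: "t \<in> carrier (C \<boxtimes> D \<boxtimes> E)"
  shows "tensor_counit C (D \<boxtimes> E) \<epsilon> (tensor_counit D E \<epsilon>' \<epsilon>'') (tassoc R C D E t) =
    tensor_counit (C \<boxtimes> D) E (tensor_counit C D \<epsilon> \<epsilon>') \<epsilon>'' t"
  using t
  by (rule tensor3_linear_eqI[rotated 3, where P = \<I>])
    (use assms in \<open>simp_all add: coact_simps coact_linear m_assoc\<close>)

lemma tensor_counit_tlunit:
  assumes lin: "\<epsilon> \<in> lin R C \<I>" and m: "module R C" and t: "t \<in> carrier (\<I> \<boxtimes> C)"
  shows "\<epsilon> (tlunit R C t) = tensor_counit \<I> C (idm \<I>) \<epsilon> t"
  using t
  by (rule tensor_linear_eqI[rotated 3, where P = \<I>])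
    (use assms in \<open>simp_all add: coact_simps coact_linear linear_map_lin[OF lin]
      linear_map_smult[OF lin_linear[OF lin]]\<close>)

lemma tensor_counit_trunit:
  assumes lin: "\<epsilon> \<in> lin R C \<I>" and m: "module R C" and t: "t \<in> carrier (C \<boxtimes> \<I>)"
  shows "\<epsilon> (trunit R C t) = tensor_counit C \<I> \<epsilon> (idm \<I>) t"
  using t
  by (rule tensor_linear_eqI[rotated 3, where P = \<I>])
    (use assms in \<open>simp_all add: coact_simps coact_linear linear_map_lin[OF lin]
      linear_map_smult[OF lin_linear[OF lin]] m_comm\<close>)

section \<open>The monoidal category of comodules\<close>

text \<open>A coalgebra is a module coacting on itself by its comultiplication, subject also to the
  left counit law. In this form the lemmas on coactions apply directly.\<close>

lemma is_coalgebra_iff: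
  "is_coalgebra R C \<longleftrightarrow> module R (cmod C) \<and> counit C \<in> lin R (cmod C) \<I> \<and>
     coaction (cmod C) (cmod C) (comult C) (counit C) (comult C) \<and>
     (\<forall>c\<in>carrier (cmod C). tlunit R (cmod C)
        (tmap R (cmod C) \<I> (cmod C) (cmod C) (counit C) (idm (cmod C)) (comult C c)) = c)"
  by (auto simp: is_coalgebra_def coaction_def Let_def)

lemma is_comodule_iff:
  "is_comodule R X \<longleftrightarrow> is_coalgebra R (coalg X) \<and> module R (xmod X) \<and>
     coaction (xmod X) (cmod (coalg X)) (comult (coalg X)) (counit (coalg X)) (coact X)"
  by (auto simp: is_comodule_def coaction_def Let_def)

lemma comodule_facts:
  assumes "is_comodule R X"
  shows "module R (xmod X)" "module R (cmod (coalg X))"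
    "coact X \<in> lin R (xmod X) (xmod X \<boxtimes> cmod (coalg X))"
    "comult (coalg X) \<in> lin R (cmod (coalg X)) (cmod (coalg X) \<boxtimes> cmod (coalg X))"
    "counit (coalg X) \<in> lin R (cmod (coalg X)) \<I>"
  using assms by (simp_all add: is_comodule_iff is_coalgebra_iff coaction_def)

lemma tensor_coalgebra_simps:
  "cmod (tensor_coalgebra R C D) = cmod C \<boxtimes> cmod D"
  "comult (tensor_coalgebra R C D) = tensor_coact (cmod C) (cmod C) (cmod D) (cmod D) (comult C) (comult D)"
  "counit (tensor_coalgebra R C D) = tensor_counit (cmod C) (cmod D) (counit C) (counit D)"
  by (simp_all add: tensor_coalgebra_def Let_def tensor_coact_def tensor_counit_def)

lemma tensor_comodule_simps:
  "coalg (tensor_comodule R X Y) = tensor_coalgebra R (coalg X) (coalg Y)"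
  "xmod (tensor_comodule R X Y) = xmod X \<boxtimes> xmod Y"
  "coact (tensor_comodule R X Y) =
    tensor_coact (xmod X) (cmod (coalg X)) (xmod Y) (cmod (coalg Y)) (coact X) (coact Y)"
  by (simp_all add: tensor_comodule_def Let_def tensor_coact_def)

lemma ring_comodule_simps:
  "coalg (ring_comodule R) = ring_coalgebra R"
  "xmod (ring_comodule R) = \<I>"
  "coact (ring_comodule R) = unit_coact"
  "cmod (ring_coalgebra R) = \<I>"
  "comult (ring_coalgebra R) = unit_coact"
  "counit (ring_coalgebra R) = idm \<I>"
  by (simp_all add: ring_comodule_def ring_coalgebra_def unit_coact_def)

lemma is_coalgebra_tensor:
  assumes "is_coalgebra R C" "is_coalgebra R D"
  shows "is_coalgebra R (tensor_coalgebra R C D)"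
proof -
  have "comult C \<in> lin R (cmod C) (cmod C \<boxtimes> cmod C)" "comult D \<in> lin R (cmod D) (cmod D \<boxtimes> cmod D)"
    using assms by (simp_all add: is_coalgebra_iff coaction_def)
  then show ?thesis
    using assms unfolding is_coalgebra_iff tensor_coalgebra_simps
    by (auto intro!: tensor_module tensor_counit_lin coaction_tensor tensor_comult_counit_left)
qed

lemma is_comodule_tensor:
  assumes "is_comodule R X" "is_comodule R Y"
  shows "is_comodule R (tensor_comodule R X Y)"
  using assms comodule_facts[OF assms(1)] comodule_facts[OF assms(2)]
  unfolding is_comodule_iff tensor_comodule_simps tensor_coalgebra_simps
  by (auto intro!: tensor_module is_coalgebra_tensor coaction_tensor)

lemma is_comodule_ring: "is_comodule R (ring_comodule R)"
  unfolding is_comodule_iff is_coalgebra_iff ring_comodule_simps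
  using coaction_unit by (simp add: coact_simps)

lemma compose_ident_left: "h \<in> lin R M N \<Longrightarrow> compose (carrier M) (idm N) h = h"
  and compose_ident_right: "h \<in> lin R M N \<Longrightarrow> compose (carrier M) h (idm M) = h"
  using lin_extensional[of h R M N] lin_closed[of h R M N]
  by (auto intro!: extensionalityI[of _ "carrier M"] simp: compose_eq)

text \<open>The comodule condition over the target coalgebra reads (k \<otimes> 1)(1 \<otimes> g)
  after the coaction; functoriality of the tensor product merges the two maps into k \<otimes> g,
  and the corestricted comodule disappears.\<close>

lemma Comod_hom_iff:
  assumes "is_comodule R X" "is_comodule R Y"
  shows "p \<in> Comod_hom R X Y \<longleftrightarrow>
    fst p \<in> lin R (xmod X) (xmod Y) \<and> snd p \<in> lin R (cmod (coalg X)) (cmod (coalg Y)) \<and>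
    intertwines (xmod X) (cmod (coalg X)) (coact X) (xmod Y) (cmod (coalg Y)) (coact Y) (fst p) (snd p) \<and>
    intertwines (cmod (coalg X)) (cmod (coalg X)) (comult (coalg X))
      (cmod (coalg Y)) (cmod (coalg Y)) (comult (coalg Y)) (snd p) (snd p) \<and>
    (\<forall>c\<in>carrier (cmod (coalg X)). counit (coalg Y) (snd p c) = counit (coalg X) c)"
proof -
  note X = comodule_facts[OF assms(1)] and Y = comodule_facts[OF assms(2)]
  have eq: "tmap R (xmod X) (xmod Y) (cmod (coalg Y)) (cmod (coalg Y)) k (idm (cmod (coalg Y)))
      (coact (corestrict R (coalg Y) g X) x) =
    tmap R (xmod X) (xmod Y) (cmod (coalg X)) (cmod (coalg Y)) k g (coact X x)"
    if "x \<in> carrier (xmod X)" "k \<in> lin R (xmod X) (xmod Y)" "g \<in> lin R (cmod (coalg X)) (cmod (coalg Y))"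
    for x k g
  proof -
    show ?thesis
      using that X Y lin_closed[OF X(3) that(1)]
      by (simp add: corestrict_def compose_eq tmap_tmap lin_ident compose_ident_left compose_ident_right)
  qed
  show ?thesis
    \<comment> \<open>Only the module and the coalgebra of the corestriction are unfolded; its
      coaction stays folded so that \<open>eq\<close> can rewrite it.\<close>
    by (cases p) (auto simp: Comod_hom_def coalgebra_hom_def comodule_maps_def Let_def intertwines_def eq
        corestrict_def[of _ _ _ X, THEN arg_cong[of _ _ xmod]]
        corestrict_def[of _ _ _ X, THEN arg_cong[of _ _ coalg]])
qed

lemma Comod_simps:
  "objs (Comod R) = {X. is_comodule R X}"
  "arrs (Comod R) = Comod_hom R"
  "ident (Comod R) = (\<lambda>X. (idm (xmod X), idm (cmod (coalg X))))"
  "cmp (Comod R) X Y Z q p = Comod_cmp X q p"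
  "unit_obj (Comod R) = ring_comodule R"
  "tobj (Comod R) = tensor_comodule R"
  "tarr (Comod R) X X' Y Y' p q =
     (tmap R (xmod X) (xmod X') (xmod Y) (xmod Y') (fst p) (fst q),
      tmap R (cmod (coalg X)) (cmod (coalg X')) (cmod (coalg Y)) (cmod (coalg Y')) (snd p) (snd q))"
  "assoc_arr (Comod R) X Y Z = (tassoc R (xmod X) (xmod Y) (xmod Z),
     tassoc R (cmod (coalg X)) (cmod (coalg Y)) (cmod (coalg Z)))"
  "lunit_arr (Comod R) X = (tlunit R (xmod X), tlunit R (cmod (coalg X)))"
  "runit_arr (Comod R) X = (trunit R (xmod X), trunit R (cmod (coalg X)))"
  by (simp_all add: Comod_def)

section \<open>Closure properties of arrows of comodules\<close>

lemma Comod_ident: "is_comodule R X \<Longrightarrow> (idm (xmod X), idm (cmod (coalg X))) \<in> Comod_hom R X X"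
  by (simp add: Comod_hom_iff comodule_facts intertwines_ident lin_ident)

lemma Comod_cmp_closed:
  assumes "is_comodule R X" "is_comodule R Y" "is_comodule R Z"
    and "p \<in> Comod_hom R X Y" "q \<in> Comod_hom R Y Z"
  shows "Comod_cmp X q p \<in> Comod_hom R X Z"
  using assms comodule_facts[OF assms(1)] comodule_facts[OF assms(2)] comodule_facts[OF assms(3)]
  by (auto simp: Comod_hom_iff Comod_cmp_def lin_compose compose_eq lin_closed intro!: intertwines_compose)

lemma Comod_tarr_closed:
  assumes "is_comodule R X" "is_comodule R X'" "is_comodule R Y" "is_comodule R Y'"
    and "p \<in> Comod_hom R X X'" "q \<in> Comod_hom R Y Y'"
  shows "tarr (Comod R) X X' Y Y' p q \<in> Comod_hom R (tensor_comodule R X Y) (tensor_comodule R X' Y')"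
  using assms comodule_facts[OF assms(1)] comodule_facts[OF assms(2)]
    comodule_facts[OF assms(3)] comodule_facts[OF assms(4)]
  by (auto simp: Comod_hom_iff is_comodule_tensor Comod_simps tensor_comodule_simps tensor_coalgebra_simps
      intro!: tmap_lin intertwines_tensor tensor_counit_tmap)

lemma Comod_assoc_closed:
  assumes "is_comodule R X" "is_comodule R Y" "is_comodule R Z"
  shows "assoc_arr (Comod R) X Y Z \<in>
    Comod_hom R (tensor_comodule R (tensor_comodule R X Y) Z) (tensor_comodule R X (tensor_comodule R Y Z))"
  using assms comodule_facts[OF assms(1)] comodule_facts[OF assms(2)] comodule_facts[OF assms(3)]
  by (auto simp: Comod_hom_iff is_comodule_tensor Comod_simps tensor_comodule_simps tensor_coalgebra_simps
      intro!: tassoc_lin intertwines_tassoc tensor_counit_tassoc)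

lemma Comod_lunit_closed:
  assumes "is_comodule R X"
  shows "lunit_arr (Comod R) X \<in> Comod_hom R (tensor_comodule R (ring_comodule R) X) X"
  using assms comodule_facts[OF assms(1)]
  by (auto simp: Comod_hom_iff is_comodule_tensor is_comodule_ring Comod_simps tensor_comodule_simps
      tensor_coalgebra_simps ring_comodule_simps
      intro!: tlunit_lin intertwines_tlunit tensor_counit_tlunit[simplified])

lemma Comod_runit_closed:
  assumes "is_comodule R X"
  shows "runit_arr (Comod R) X \<in> Comod_hom R (tensor_comodule R X (ring_comodule R)) X"
  using assms comodule_facts[OF assms(1)]
  by (auto simp: Comod_hom_iff is_comodule_tensor is_comodule_ring Comod_simps tensor_comodule_simps
      tensor_coalgebra_simps ring_comodule_simps
      intro!: trunit_lin intertwines_trunit tensor_counit_trunit[simplified])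

text \<open>Linear inverses of both components suffice: compatibility of the inverse with coactions
  and comultiplications is \<open>intertwines_inverse\<close>, and its compatibility with the
  counits follows by writing d as g(g' d).\<close>

lemma Comod_iso:
  assumes "is_comodule R X" "is_comodule R Y" "(k, g) \<in> Comod_hom R X Y"
    and k': "k' \<in> lin R (xmod Y) (xmod X)" and g': "g' \<in> lin R (cmod (coalg Y)) (cmod (coalg X))"
    and "\<And>x. x \<in> carrier (xmod X) \<Longrightarrow> k' (k x) = x" "\<And>y. y \<in> carrier (xmod Y) \<Longrightarrow> k (k' y) = y"
    and "\<And>c. c \<in> carrier (cmod (coalg X)) \<Longrightarrow> g' (g c) = c"
      "\<And>d. d \<in> carrier (cmod (coalg Y)) \<Longrightarrow> g (g' d) = d"
  shows "inverse_arrows (Comod R) X Y (k, g) (k', g')"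
proof -
  note X = comodule_facts[OF assms(1)] and Y = comodule_facts[OF assms(2)]
  have kg: "k \<in> lin R (xmod X) (xmod Y)" "g \<in> lin R (cmod (coalg X)) (cmod (coalg Y))"
    using assms(1-3) by (simp_all add: Comod_hom_iff)
  have inv: "compose (carrier (xmod X)) k' k = idm (xmod X)" "compose (carrier (xmod Y)) k k' = idm (xmod Y)"
    "compose (carrier (cmod (coalg X))) g' g = idm (cmod (coalg X))"
    "compose (carrier (cmod (coalg Y))) g g' = idm (cmod (coalg Y))"
    using assms(6-9) by (auto simp: compose_def cong: restrict_cong)
  have "counit (coalg X) (g' d) = counit (coalg Y) d" if "d \<in> carrier (cmod (coalg Y))" for d
    using that lin_closed[OF g' that] assms(1-3,9) by (force simp: Comod_hom_iff)
  then have "(k', g') \<in> Comod_hom R Y X"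
    using assms(1-3) kg k' g' X Y inv assms(7,9)
    by (auto simp: Comod_hom_iff intro: intertwines_inverse[where k = k and g = g] intertwines_inverse[where k = g and g = g])
  then show ?thesis
    using assms(3) inv by (simp add: inverse_arrows_def Comod_simps Comod_cmp_def)
qed

section \<open>Linear inverses of the structural maps\<close>

definition tassoc_inv where
  "tassoc_inv X Y Z = tlift R X (Y \<boxtimes> Z) (X \<boxtimes> Y \<boxtimes> Z)
     (\<lambda>x a. tlift R Y Z (X \<boxtimes> Y \<boxtimes> Z) (\<lambda>y z. pure R (X \<boxtimes> Y) Z (pure R X Y x y) z) a)"

lemma bilinear_tassoc_inv_inner:
  assumes "x \<in> carrier X" "module R X" "module R Y" "module R Z"
  shows "bilinear_map R Y Z (X \<boxtimes> Y \<boxtimes> Z) (\<lambda>y z. pure R (X \<boxtimes> Y) Z (pure R X Y x y) z)"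
  by (intro bilinear_mapI linear_map_pure_left linear_map_pure_right linear_map_ident tensor_module
      pure_closed assms)

lemma bilinear_tassoc_inv:
  assumes "module R X" "module R Y" "module R Z"
  shows "bilinear_map R X (Y \<boxtimes> Z) (X \<boxtimes> Y \<boxtimes> Z)
    (\<lambda>x a. tlift R Y Z (X \<boxtimes> Y \<boxtimes> Z) (\<lambda>y z. pure R (X \<boxtimes> Y) Z (pure R X Y x y) z) a)"
  by (intro bilinear_mapI linear_map_tlift_param linear_map_tlift linear_map_pure_left
      linear_map_ident bilinear_tassoc_inv_inner tensor_module assms)

lemma tassoc_inv_lin:
  assumes "module R X" "module R Y" "module R Z"
  shows "tassoc_inv X Y Z \<in> lin R (X \<boxtimes> (Y \<boxtimes> Z)) (X \<boxtimes> Y \<boxtimes> Z)"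
  unfolding tassoc_inv_def by (intro tlift_lin bilinear_tassoc_inv tensor_module assms)

lemma tassoc_inv_pure:
  assumes "x \<in> carrier X" "y \<in> carrier Y" "z \<in> carrier Z" "module R X" "module R Y" "module R Z"
  shows "tassoc_inv X Y Z (pure R X (Y \<boxtimes> Z) x (pure R Y Z y z)) = pure R (X \<boxtimes> Y) Z (pure R X Y x y) z"
  unfolding tassoc_inv_def
  by (simp add: tlift_pure bilinear_tassoc_inv bilinear_tassoc_inv_inner tensor_module pure_closed assms)

lemma tassoc_inv_tassoc:
  assumes m: "module R X" "module R Y" "module R Z" and "t \<in> carrier (X \<boxtimes> Y \<boxtimes> Z)"
  shows "tassoc_inv X Y Z (tassoc R X Y Z t) = t"
  using assms(4)
  by (rule tensor3_linear_eqI[rotated 3, where P = "X \<boxtimes> Y \<boxtimes> Z"])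
    (use m in \<open>simp_all add: tensor_simps tensor_linear tassoc_inv_pure linear_map_lin[OF tassoc_inv_lin]\<close>)

lemma tassoc_tassoc_inv:
  assumes m: "module R X" "module R Y" "module R Z" and "t \<in> carrier (X \<boxtimes> (Y \<boxtimes> Z))"
  shows "tassoc R X Y Z (tassoc_inv X Y Z t) = t"
  using assms(4)
  by (rule tensor3'_linear_eqI[rotated 3, where P = "X \<boxtimes> (Y \<boxtimes> Z)"])
    (use m in \<open>simp_all add: tensor_simps tensor_linear tassoc_inv_pure linear_map_lin[OF tassoc_inv_lin]\<close>)

lemma tlunit_inv_lin: "module R X \<Longrightarrow> (\<lambda>x\<in>carrier X. pure R \<I> X \<one> x) \<in> lin R X (\<I> \<boxtimes> X)"
  and trunit_inv_lin: "module R X \<Longrightarrow> (\<lambda>x\<in>carrier X. pure R X \<I> x \<one>) \<in> lin R X (X \<boxtimes> \<I>)"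
  by (intro linear_restrict_lin linear_map_pure_left linear_map_pure_right linear_map_ident; simp add: R_module)+

lemma tlunit_inv_tlunit:
  assumes "module R X" "t \<in> carrier (\<I> \<boxtimes> X)"
  shows "(\<lambda>x\<in>carrier X. pure R \<I> X \<one> x) (tlunit R X t) = t"
proof -
  have "pure R \<I> X \<one> (tlunit R X t) = t"
    using assms(2)
  proof (rule tensor_linear_eqI[rotated 3, where P = "\<I> \<boxtimes> X"])
    fix r x assume "r \<in> carrier \<I>" "x \<in> carrier X"
    then show "pure R \<I> X \<one> (tlunit R X (pure R \<I> X r x)) = pure R \<I> X r x"
      using assms(1) pure_smult_left[of r \<one> \<I> x X, symmetric] by (simp add: tensor_simps pure_smult_right)
  qed (use assms(1) in \<open>simp_all add: tensor_simps tensor_linear\<close>)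
  then show ?thesis using assms by (simp add: tensor_simps)
qed

lemma trunit_inv_trunit:
  assumes "module R X" "t \<in> carrier (X \<boxtimes> \<I>)"
  shows "(\<lambda>x\<in>carrier X. pure R X \<I> x \<one>) (trunit R X t) = t"
proof -
  have "pure R X \<I> (trunit R X t) \<one> = t"
    using assms(2)
  proof (rule tensor_linear_eqI[rotated 3, where P = "X \<boxtimes> \<I>"])
    fix x r assume "x \<in> carrier X" "r \<in> carrier \<I>"
    then show "pure R X \<I> (trunit R X (pure R X \<I> x r)) \<one> = pure R X \<I> x r"
      using assms(1) pure_smult_right[of r x X \<one> \<I>, symmetric] by (simp add: tensor_simps pure_smult_left)
  qed (use assms(1) in \<open>simp_all add: tensor_simps tensor_linear\<close>)
  then show ?thesis using assms by (simp add: tensor_simps)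
qed

lemma tlunit_tlunit_inv:
  "\<lbrakk>module R X; x \<in> carrier X\<rbrakk> \<Longrightarrow> tlunit R X ((\<lambda>x\<in>carrier X. pure R \<I> X \<one> x) x) = x"
  and trunit_trunit_inv:
  "\<lbrakk>module R X; x \<in> carrier X\<rbrakk> \<Longrightarrow> trunit R X ((\<lambda>x\<in>carrier X. pure R X \<I> x \<one>) x) = x"
  by (simp_all add: tensor_simps module.smult_one)

lemma Comod_assoc_iso:
  assumes "is_comodule R X" "is_comodule R Y" "is_comodule R Z"
  shows "iso_arrow (Comod R) (tensor_comodule R (tensor_comodule R X Y) Z)
    (tensor_comodule R X (tensor_comodule R Y Z)) (assoc_arr (Comod R) X Y Z)"
  unfolding iso_arrow_def Comod_simps
  by (rule exI, rule Comod_iso[where k' = "tassoc_inv (xmod X) (xmod Y) (xmod Z)"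
        and g' = "tassoc_inv (cmod (coalg X)) (cmod (coalg Y)) (cmod (coalg Z))"])
    (use assms Comod_assoc_closed[OF assms] in \<open>simp_all add: is_comodule_tensor Comod_simps
      tensor_comodule_simps tensor_coalgebra_simps comodule_facts tassoc_inv_lin tassoc_inv_tassoc
      tassoc_tassoc_inv\<close>)

text \<open>The inverse is given explicitly, not just asserted to exist, since the inverse left
  unitor of the unit occurs in the composition of the underlying category and has to be evaluated
  there.\<close>

lemma Comod_lunit_inverse:
  assumes "is_comodule R X"
  shows "inverse_arrows (Comod R) (tensor_comodule R (ring_comodule R) X) X (lunit_arr (Comod R) X)
    (\<lambda>x\<in>carrier (xmod X). pure R \<I> (xmod X) \<one> x, \<lambda>x\<in>carrier (cmod (coalg X)). pure R \<I> (cmod (coalg X)) \<one> x)"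
  unfolding Comod_simps
  by (rule Comod_iso) (use assms Comod_lunit_closed[OF assms] comodule_facts[OF assms] in
      \<open>simp_all only: is_comodule_tensor is_comodule_ring Comod_simps ring_comodule_simps
      tensor_comodule_simps tensor_coalgebra_simps tlunit_inv_lin tlunit_inv_tlunit tlunit_tlunit_inv\<close>)

lemma Comod_runit_iso:
  assumes "is_comodule R X"
  shows "iso_arrow (Comod R) (tensor_comodule R X (ring_comodule R)) X (runit_arr (Comod R) X)"
  unfolding iso_arrow_def Comod_simps
  by (rule exI, rule Comod_iso[where k' = "\<lambda>x\<in>carrier (xmod X). pure R (xmod X) \<I> x \<one>"
        and g' = "\<lambda>x\<in>carrier (cmod (coalg X)). pure R (cmod (coalg X)) \<I> x \<one>"])
    (use assms Comod_runit_closed[OF assms] comodule_facts[OF assms] in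
      \<open>simp_all only: is_comodule_tensor is_comodule_ring Comod_simps ring_comodule_simps
      tensor_comodule_simps tensor_coalgebra_simps trunit_inv_lin trunit_inv_trunit trunit_trunit_inv\<close>)

section \<open>The category and monoidal category laws\<close>

lemma Comod_homD:
  assumes "p \<in> Comod_hom R X Y" "is_comodule R X" "is_comodule R Y"
  shows "fst p \<in> lin R (xmod X) (xmod Y)" "snd p \<in> lin R (cmod (coalg X)) (cmod (coalg Y))"
  using assms by (simp_all add: Comod_hom_iff)

lemma compose_lin_assoc:
  "f \<in> lin R L M \<Longrightarrow> compose (carrier L) (compose (carrier M) h g) f = compose (carrier L) h (compose (carrier L) g f)"
  by (rule compose_assoc[symmetric]) (auto intro: lin_closed)

lemma compose_cong:
  "(\<And>x. x \<in> A \<Longrightarrow> g (f x) = g' (f' x)) \<Longrightarrow> compose A g f = compose A g' f'"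
  unfolding compose_def by (rule restrict_cong) (simp_all add: simp_implies_def)

lemma tmap_compose:
  assumes "f \<in> lin R X X'" "f' \<in> lin R X' X''" "g \<in> lin R Y Y'" "g' \<in> lin R Y' Y''"
    and "module R X" "module R X'" "module R X''" "module R Y" "module R Y'" "module R Y''"
  shows "tmap R X X'' Y Y'' (compose (carrier X) f' f) (compose (carrier Y) g' g) =
    compose (carrier (X \<boxtimes> Y)) (tmap R X' X'' Y' Y'' f' g') (tmap R X X' Y Y' f g)"
  using assms
  by (intro lin_eqI[of _ R "X \<boxtimes> Y" "X'' \<boxtimes> Y''"])
    (auto simp: compose_eq tmap_tmap intro!: tmap_lin lin_compose lin_compose[OF tmap_lin tmap_lin] tensor_module)

lemma category_Comod: "category (Comod R)"
proof
  fix X Y f assume "X \<in> objs (Comod R)" "Y \<in> objs (Comod R)" "f \<in> arrs (Comod R) X Y"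
  then show "cmp (Comod R) X Y Y (ident (Comod R) Y) f = f" "cmp (Comod R) X X Y f (ident (Comod R) X) = f"
    using Comod_homD[of f X Y]
    by (simp_all add: Comod_simps Comod_cmp_def compose_ident_left compose_ident_right)
next
  fix W X Y Z f g h
  assume "W \<in> objs (Comod R)" "X \<in> objs (Comod R)" "Y \<in> objs (Comod R)" "Z \<in> objs (Comod R)"
    "f \<in> arrs (Comod R) W X" "g \<in> arrs (Comod R) X Y" "h \<in> arrs (Comod R) Y Z"
  then show "cmp (Comod R) W X Z (cmp (Comod R) X Y Z h g) f = cmp (Comod R) W Y Z h (cmp (Comod R) W X Y g f)"
    by (auto simp: Comod_simps Comod_cmp_def intro!: compose_lin_assoc Comod_homD)
qed (auto simp: Comod_simps intro: Comod_cmp_closed Comod_ident)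

text \<open>Each structural arrow consists of one canonical linear map taken twice, at the comodules
  and at their coalgebras. Every axiom is thus a law for modules over R, applied to both
  components.\<close>

lemma monoidal_category_Comod: "monoidal_category (Comod R)"
proof -
  interpret category "Comod R" by (rule category_Comod)
  note simps = Comod_simps Comod_cmp_def tensor_comodule_simps tensor_coalgebra_simps ring_comodule_simps
  show ?thesis
  proof
    show "unit_obj (Comod R) \<in> objs (Comod R)"
      by (simp add: Comod_simps is_comodule_ring)
  next
    fix X Y assume "X \<in> objs (Comod R)" "Y \<in> objs (Comod R)"
    then show "tobj (Comod R) X Y \<in> objs (Comod R)"
      by (simp add: Comod_simps is_comodule_tensor)
  next
    fix X X' Y Y' f g
    assume "X \<in> objs (Comod R)" "X' \<in> objs (Comod R)" "Y \<in> objs (Comod R)" "Y' \<in> objs (Comod R)"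
      "f \<in> arrs (Comod R) X X'" "g \<in> arrs (Comod R) Y Y'"
    then show "tarr (Comod R) X X' Y Y' f g \<in> arrs (Comod R) (tobj (Comod R) X Y) (tobj (Comod R) X' Y')"
      using Comod_tarr_closed by (simp add: Comod_simps)
  next
    fix X Y assume "X \<in> objs (Comod R)" "Y \<in> objs (Comod R)"
    then show "tarr (Comod R) X X Y Y (ident (Comod R) X) (ident (Comod R) Y) =
        ident (Comod R) (tobj (Comod R) X Y)"
      by (simp add: simps tmap_ident comodule_facts)
  next
    fix X X' X'' Y Y' Y'' f f' g g'
    assume "X \<in> objs (Comod R)" "X' \<in> objs (Comod R)" "X'' \<in> objs (Comod R)"
      "Y \<in> objs (Comod R)" "Y' \<in> objs (Comod R)" "Y'' \<in> objs (Comod R)"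
      "f \<in> arrs (Comod R) X X'" "f' \<in> arrs (Comod R) X' X''"
      "g \<in> arrs (Comod R) Y Y'" "g' \<in> arrs (Comod R) Y' Y''"
    then show "tarr (Comod R) X X'' Y Y'' (cmp (Comod R) X X' X'' f' f) (cmp (Comod R) Y Y' Y'' g' g) =
        cmp (Comod R) (tobj (Comod R) X Y) (tobj (Comod R) X' Y') (tobj (Comod R) X'' Y'')
          (tarr (Comod R) X' X'' Y' Y'' f' g') (tarr (Comod R) X X' Y Y' f g)"
      using Comod_homD[of f X X'] Comod_homD[of f' X' X''] Comod_homD[of g Y Y'] Comod_homD[of g' Y' Y'']
      by (simp add: simps tmap_compose comodule_facts)
  next
    fix X Y Z assume "X \<in> objs (Comod R)" "Y \<in> objs (Comod R)" "Z \<in> objs (Comod R)"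
    then show "iso_arrow (Comod R) (tobj (Comod R) (tobj (Comod R) X Y) Z)
        (tobj (Comod R) X (tobj (Comod R) Y Z)) (assoc_arr (Comod R) X Y Z)"
      using Comod_assoc_iso[of X Y Z] by (simp add: Comod_simps)
  next
    fix X X' Y Y' Z Z' f g h
    assume "X \<in> objs (Comod R)" "X' \<in> objs (Comod R)" "Y \<in> objs (Comod R)" "Y' \<in> objs (Comod R)"
      "Z \<in> objs (Comod R)" "Z' \<in> objs (Comod R)"
      "f \<in> arrs (Comod R) X X'" "g \<in> arrs (Comod R) Y Y'" "h \<in> arrs (Comod R) Z Z'"
    then show "cmp (Comod R) (tobj (Comod R) (tobj (Comod R) X Y) Z) (tobj (Comod R) (tobj (Comod R) X' Y') Z')
          (tobj (Comod R) X' (tobj (Comod R) Y' Z')) (assoc_arr (Comod R) X' Y' Z')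
          (tarr (Comod R) (tobj (Comod R) X Y) (tobj (Comod R) X' Y') Z Z' (tarr (Comod R) X X' Y Y' f g) h) =
        cmp (Comod R) (tobj (Comod R) (tobj (Comod R) X Y) Z) (tobj (Comod R) X (tobj (Comod R) Y Z))
          (tobj (Comod R) X' (tobj (Comod R) Y' Z'))
          (tarr (Comod R) X X' (tobj (Comod R) Y Z) (tobj (Comod R) Y' Z') f (tarr (Comod R) Y Y' Z Z' g h))
          (assoc_arr (Comod R) X Y Z)"
      using Comod_homD[of f X X'] Comod_homD[of g Y Y'] Comod_homD[of h Z Z']
      by (auto simp: simps comodule_facts intro!: compose_cong tassoc_natural)
  next
    fix X assume "X \<in> objs (Comod R)"
    then show "iso_arrow (Comod R) (tobj (Comod R) (unit_obj (Comod R)) X) X (lunit_arr (Comod R) X)"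
      "iso_arrow (Comod R) (tobj (Comod R) X (unit_obj (Comod R))) X (runit_arr (Comod R) X)"
      using Comod_lunit_inverse[of X] Comod_runit_iso[of X]
      unfolding Comod_simps(1,5,6) by (auto simp: iso_arrow_def)
  next
    fix X X' f assume "X \<in> objs (Comod R)" "X' \<in> objs (Comod R)" "f \<in> arrs (Comod R) X X'"
    then show "cmp (Comod R) (tobj (Comod R) (unit_obj (Comod R)) X) (tobj (Comod R) (unit_obj (Comod R)) X') X'
          (lunit_arr (Comod R) X')
          (tarr (Comod R) (unit_obj (Comod R)) (unit_obj (Comod R)) X X' (ident (Comod R) (unit_obj (Comod R))) f) =
        cmp (Comod R) (tobj (Comod R) (unit_obj (Comod R)) X) X X' f (lunit_arr (Comod R) X)"
      "cmp (Comod R) (tobj (Comod R) X (unit_obj (Comod R))) (tobj (Comod R) X' (unit_obj (Comod R))) X'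
          (runit_arr (Comod R) X')
          (tarr (Comod R) X X' (unit_obj (Comod R)) (unit_obj (Comod R)) f (ident (Comod R) (unit_obj (Comod R)))) =
        cmp (Comod R) (tobj (Comod R) X (unit_obj (Comod R))) X X' f (runit_arr (Comod R) X)"
      using Comod_homD[of f X X']
      by (auto simp: simps comodule_facts
          intro!: compose_cong tlunit_natural[simplified] trunit_natural[simplified])
  next
    fix V X Y Z
    assume "V \<in> objs (Comod R)" "X \<in> objs (Comod R)" "Y \<in> objs (Comod R)" "Z \<in> objs (Comod R)"
    then show "cmp (Comod R) (tobj (Comod R) (tobj (Comod R) (tobj (Comod R) V X) Y) Z)
          (tobj (Comod R) (tobj (Comod R) V X) (tobj (Comod R) Y Z))
          (tobj (Comod R) V (tobj (Comod R) X (tobj (Comod R) Y Z)))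
          (assoc_arr (Comod R) V X (tobj (Comod R) Y Z)) (assoc_arr (Comod R) (tobj (Comod R) V X) Y Z) =
        cmp (Comod R) (tobj (Comod R) (tobj (Comod R) (tobj (Comod R) V X) Y) Z)
          (tobj (Comod R) V (tobj (Comod R) (tobj (Comod R) X Y) Z))
          (tobj (Comod R) V (tobj (Comod R) X (tobj (Comod R) Y Z)))
          (tarr (Comod R) V V (tobj (Comod R) (tobj (Comod R) X Y) Z) (tobj (Comod R) X (tobj (Comod R) Y Z))
            (ident (Comod R) V) (assoc_arr (Comod R) X Y Z))
          (cmp (Comod R) (tobj (Comod R) (tobj (Comod R) (tobj (Comod R) V X) Y) Z)
            (tobj (Comod R) (tobj (Comod R) V (tobj (Comod R) X Y)) Z)
            (tobj (Comod R) V (tobj (Comod R) (tobj (Comod R) X Y) Z))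
            (assoc_arr (Comod R) V (tobj (Comod R) X Y) Z)
            (tarr (Comod R) (tobj (Comod R) (tobj (Comod R) V X) Y) (tobj (Comod R) V (tobj (Comod R) X Y)) Z Z
              (assoc_arr (Comod R) V X Y) (ident (Comod R) Z)))"
      by (auto simp: simps comodule_facts compose_eq tassoc_pentagon intro!: compose_cong)
  next
    fix X Y assume "X \<in> objs (Comod R)" "Y \<in> objs (Comod R)"
    then show "cmp (Comod R) (tobj (Comod R) (tobj (Comod R) X (unit_obj (Comod R))) Y)
          (tobj (Comod R) X (tobj (Comod R) (unit_obj (Comod R)) Y)) (tobj (Comod R) X Y)
          (tarr (Comod R) X X (tobj (Comod R) (unit_obj (Comod R)) Y) Y (ident (Comod R) X) (lunit_arr (Comod R) Y))
          (assoc_arr (Comod R) X (unit_obj (Comod R)) Y) =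
        tarr (Comod R) (tobj (Comod R) X (unit_obj (Comod R))) X Y Y (runit_arr (Comod R) X) (ident (Comod R) Y)"
      by (auto simp: simps comodule_facts compose_eq tassoc_triangle tensor_simps
          intro!: extensionalityI compose_extensional intro: lin_extensional[OF tmap_lin])
  qed
qed

end

section \<open>Measurings\<close>

lemma bilinear_map_compose:
  assumes "bilinear_map R M N P b" "linear_map R X M f" "linear_map R Y N g"
  shows "bilinear_map R X Y P (\<lambda>x y. b (f x) (g y))"
  using assms by (simp add: bilinear_map_def linear_map_def)

lemma bilinear_map_flip: "bilinear_map R X Y P b \<Longrightarrow> bilinear_map R Y X P (\<lambda>y x. b x y)"
  by (simp add: bilinear_map_def)

lemma is_amodule_modules: "is_amodule R M \<Longrightarrow> module R (nmod M)" "is_amodule R M \<Longrightarrow> module R (alg M)"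
  by (simp_all add: is_amodule_def Let_def is_algebra_def)

lemma is_amodule_ring: "is_amodule R M \<Longrightarrow> ring (alg M)"
  by (simp add: is_amodule_def Let_def is_algebra_def)

lemma is_amodule_one: "is_amodule R M \<Longrightarrow> \<one>\<^bsub>alg M\<^esub> \<in> carrier (alg M)"
  and is_amodule_mult: "\<lbrakk>is_amodule R M; a \<in> carrier (alg M); b \<in> carrier (alg M)\<rbrakk>
    \<Longrightarrow> a \<otimes>\<^bsub>alg M\<^esub> b \<in> carrier (alg M)"
  by (simp_all add: monoid.one_closed monoid.m_closed ring.is_monoid[OF is_amodule_ring])

lemma is_amodule_act:
  "\<lbrakk>is_amodule R M; a \<in> carrier (alg M); x \<in> carrier (nmod M)\<rbrakk> \<Longrightarrow> act M a x \<in> carrier (nmod M)"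
  by (simp add: is_amodule_def Let_def)

lemma bilinear_map_act: "is_amodule R M \<Longrightarrow> bilinear_map R (alg M) (nmod M) (nmod M) (act M)"
  by (auto simp: is_amodule_def Let_def bilinear_map_def linear_map_def)

lemma bilinear_map_algebra_mult:
  assumes "is_algebra R A"
  shows "bilinear_map R A A A (mult A)"
proof -
  interpret ring A using assms by (simp add: is_algebra_def)
  show ?thesis
    using assms by (auto simp: is_algebra_def bilinear_map_def linear_map_def l_distr r_distr)
qed

lemma bilinear_map_alg_mult: "is_amodule R M \<Longrightarrow> bilinear_map R (alg M) (alg M) (alg M) (mult (alg M))"
  by (rule bilinear_map_algebra_mult) (simp add: is_amodule_def Let_def)

text \<open>Currying: a linear map into a module of linear maps is a map linear in each variable and
  extensional in both. All later work with measurings uses this two-variable form.\<close>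

lemma lin_lin_module_iff:
  assumes "module R M"
  shows "u \<in> lin R M (lin_module R X N) \<longleftrightarrow> u \<in> extensional (carrier M) \<and>
    (\<forall>a\<in>carrier M. u a \<in> lin R X N) \<and> (\<forall>x\<in>carrier X. linear_map R M N (\<lambda>a. u a x))"
    (is "?l \<longleftrightarrow> ?r")
proof -
  interpret module R M by fact
  show ?thesis
  proof
    assume ?l
    then have u: "u \<in> extensional (carrier M)" "\<And>a. a \<in> carrier M \<Longrightarrow> u a \<in> lin R X N"
      "\<And>a b. a \<in> carrier M \<Longrightarrow> b \<in> carrier M \<Longrightarrow> u (a \<oplus>\<^bsub>M\<^esub> b) = (\<lambda>x\<in>carrier X. u a x \<oplus>\<^bsub>N\<^esub> u b x)"
      "\<And>r a. r \<in> carrier R \<Longrightarrow> a \<in> carrier M \<Longrightarrow> u (r \<odot>\<^bsub>M\<^esub> a) = (\<lambda>x\<in>carrier X. r \<odot>\<^bsub>N\<^esub> u a x)"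
      by (auto simp: lin_iff[of u] linear_map_def lin_module_def)
    then show ?r by (auto simp: linear_map_def[of _ M] intro: lin_closed)
  next
    assume r: ?r
    then have "u (a \<oplus>\<^bsub>M\<^esub> b) = (\<lambda>x\<in>carrier X. u a x \<oplus>\<^bsub>N\<^esub> u b x)"
      if "a \<in> carrier M" "b \<in> carrier M" for a b
      using that by (intro extensionalityI[of _ "carrier X"]) (auto simp: linear_map_def intro: lin_extensional[of _ R X N])
    moreover have "u (c \<odot>\<^bsub>M\<^esub> a) = (\<lambda>x\<in>carrier X. c \<odot>\<^bsub>N\<^esub> u a x)"
      if "c \<in> carrier R" "a \<in> carrier M" for c a
      using that r by (intro extensionalityI[of _ "carrier X"]) (auto simp: linear_map_def intro: lin_extensional[of _ R X N])
    ultimately show ?l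
      using r by (simp add: lin_iff[of u] linear_map_def[of _ M] lin_module_def)
  qed
qed

lemma lin_lin_moduleD:
  assumes "u \<in> lin R M (lin_module R X N)" "module R M"
  shows "a \<in> carrier M \<Longrightarrow> u a \<in> lin R X N" "x \<in> carrier X \<Longrightarrow> linear_map R M N (\<lambda>a. u a x)"
    "u \<in> extensional (carrier M)"
  using assms by (simp_all add: lin_lin_module_iff)

lemma lin_lin_module_eqI:
  assumes "u \<in> lin R M (lin_module R X N)" "v \<in> lin R M (lin_module R X N)" "module R M"
    and "\<And>a x. a \<in> carrier M \<Longrightarrow> x \<in> carrier X \<Longrightarrow> u a x = v a x"
  shows "u = v"
proof (rule extensionalityI)
  fix a assume "a \<in> carrier M"
  then show "u a = v a"
    using lin_lin_moduleD[OF assms(1,3)] lin_lin_moduleD[OF assms(2,3)] assms(4)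
    by (intro lin_eqI[of _ R X N]) auto
qed (use lin_lin_moduleD[OF assms(1,3)] lin_lin_moduleD[OF assms(2,3)] in auto)

lemma bilinear_lin_module:
  assumes "u \<in> lin R M (lin_module R X N)" "module R M"
  shows "bilinear_map R M X N u"
  using lin_lin_moduleD[OF assms] by (simp add: bilinear_map_def lin_linear)

text \<open>A measuring is a pair of curried maps of the same shape, one for modules and one for
  algebras. The operations are set up for a single such map and later applied to both
  components.\<close>

definition lin_precompose ::
  "('r, 'a) module \<Rightarrow> ('r, 'x) module \<Rightarrow> ('a \<Rightarrow> 'y \<Rightarrow> 'e) \<Rightarrow> ('x \<Rightarrow> 'y) \<Rightarrow> 'a \<Rightarrow> 'x \<Rightarrow> 'e" where
  "lin_precompose A X u k = (\<lambda>a\<in>carrier A. compose (carrier X) (u a) k)"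

lemma lin_precompose_apply:
  "\<lbrakk>a \<in> carrier A; x \<in> carrier X\<rbrakk> \<Longrightarrow> lin_precompose A X u k a x = u a (k x)"
  by (simp add: lin_precompose_def compose_eq)

lemma lin_precompose_closed:
  assumes "u \<in> lin R A (lin_module R Y E)" "k \<in> lin R X Y" "module R A" "module R X"
  shows "lin_precompose A X u k \<in> lin R A (lin_module R X E)"
  unfolding lin_lin_module_iff[OF assms(3)]
proof (intro conjI ballI)
  note u = lin_lin_moduleD[OF assms(1,3)]
  show "lin_precompose A X u k \<in> extensional (carrier A)" by (simp add: lin_precompose_def)
  show "lin_precompose A X u k a \<in> lin R X E" if "a \<in> carrier A" for a
    using that by (simp add: lin_precompose_def lin_compose[OF u(1) assms(2,4)])
  fix x assume x: "x \<in> carrier X"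
  show "linear_map R A E (\<lambda>a. lin_precompose A X u k a x)"
    by (rule linear_map_cong[OF u(2)[OF lin_closed[OF assms(2) x]]])
      (simp_all add: lin_precompose_apply x assms)
qed

context tensor_products
begin

section \<open>Composition and units of curried maps\<close>

lemma tlift_tmap:
  assumes "bilinear_map R X' Y' P b" "f \<in> lin R X X'" "g \<in> lin R Y Y'" "t \<in> carrier (X \<boxtimes> Y)"
    and m: "module R X" "module R X'" "module R Y" "module R Y'" "module R P"
  shows "tlift R X' Y' P b (tmap R X X' Y Y' f g t) = tlift R X Y P (\<lambda>x y. b (f x) (g y)) t"
proof -
  note b = bilinear_map_compose[OF assms(1) lin_linear lin_linear, OF assms(2,3)]
  show ?thesis
    using assms(4)
    by (rule tensor_linear_eqI[rotated 3, where P = P])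
      (use assms in \<open>simp_all add: tensor_simps tensor_linear linear_map_tlift b tlift_pure\<close>)
qed

text \<open>This is u followed by Hom(X,v), read through the identification of Hom(X, Hom(Y,E)) with
  Hom(X \<otimes> Y, E).\<close>

definition lin_tensor_compose ::
  "('u, 'a) module \<Rightarrow> ('u, 'u) module \<Rightarrow> ('u, 'u) module \<Rightarrow> ('u, 'e) module
    \<Rightarrow> ('a \<Rightarrow> 'u \<Rightarrow> 'b) \<Rightarrow> ('b \<Rightarrow> 'u \<Rightarrow> 'e) \<Rightarrow> 'a \<Rightarrow> 'u \<Rightarrow> 'e" where
  "lin_tensor_compose A X Y E u v = (\<lambda>a\<in>carrier A. tlift R X Y E (\<lambda>x y. v (u a x) y))"

lemma bilinear_lin_tensor_compose:
  assumes "h \<in> lin R X B" "v \<in> lin R B (lin_module R Y E)" "module R B"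
  shows "bilinear_map R X Y E (\<lambda>x y. v (h x) y)"
  by (rule bilinear_map_compose[OF bilinear_lin_module[OF assms(2,3)] lin_linear[OF assms(1)] linear_map_ident])

lemma lin_tensor_compose_pure:
  assumes "u \<in> lin R A (lin_module R X B)" "v \<in> lin R B (lin_module R Y E)"
    and m: "module R A" "module R B" "module R X" "module R Y" "module R E"
    and "a \<in> carrier A" "x \<in> carrier X" "y \<in> carrier Y"
  shows "lin_tensor_compose A X Y E u v a (pure R X Y x y) = v (u a x) y"
  using assms(3-10) bilinear_lin_tensor_compose[OF lin_lin_moduleD(1)[OF assms(1,3,8)] assms(2,4)]
  by (simp add: lin_tensor_compose_def tlift_pure)

lemma lin_tensor_compose_closed:
  assumes u: "u \<in> lin R A (lin_module R X B)" and v: "v \<in> lin R B (lin_module R Y E)"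
    and m: "module R A" "module R B" "module R X" "module R Y" "module R E"
  shows "lin_tensor_compose A X Y E u v \<in> lin R A (lin_module R (X \<boxtimes> Y) E)"
  unfolding lin_lin_module_iff[OF m(1)]
proof (intro conjI ballI)
  show "lin_tensor_compose A X Y E u v \<in> extensional (carrier A)"
    by (simp add: lin_tensor_compose_def)
  show "lin_tensor_compose A X Y E u v a \<in> lin R (X \<boxtimes> Y) E" if "a \<in> carrier A" for a
    using that m bilinear_lin_tensor_compose[OF lin_lin_moduleD(1)[OF u m(1) that] v m(2)]
    by (simp add: lin_tensor_compose_def tlift_lin)
  fix t assume t: "t \<in> carrier (X \<boxtimes> Y)"
  have "linear_map R A E (\<lambda>a. v (u a x) y)" if "x \<in> carrier X" "y \<in> carrier Y" for x y
    by (rule linear_map_compose[OF lin_lin_moduleD(2)[OF v m(2) that(2)] lin_lin_moduleD(2)[OF u m(1) that(1)]])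
  then have "linear_map R A E (\<lambda>a. tlift R X Y E (\<lambda>x y. v (u a x) y) t)"
    using t m by (intro linear_map_tlift_param)
  then show "linear_map R A E (\<lambda>a. lin_tensor_compose A X Y E u v a t)"
    by (rule linear_map_cong) (simp_all add: lin_tensor_compose_def m)
qed

lemma lin_tensor_compose_lin:
  assumes "u \<in> lin R A (lin_module R X B)" "v \<in> lin R B (lin_module R Y E)" "a \<in> carrier A"
    and m: "module R A" "module R B" "module R X" "module R Y" "module R E"
  shows "lin_tensor_compose A X Y E u v a \<in> lin R (X \<boxtimes> Y) E"
  using lin_lin_moduleD(1)[OF lin_tensor_compose_closed[OF assms(1,2) m] m(1)] assms(3) .

lemma lin_tensor_compose_assoc:
  assumes u: "u \<in> lin R A (lin_module R X B)" and v: "v \<in> lin R B (lin_module R Y C)"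
    and w: "w \<in> lin R C (lin_module R Z E)"
    and m: "module R A" "module R B" "module R C" "module R X" "module R Y" "module R Z" "module R E"
    and a: "a \<in> carrier A" and t: "t \<in> carrier (X \<boxtimes> Y \<boxtimes> Z)"
  shows "lin_tensor_compose A X (Y \<boxtimes> Z) E u (lin_tensor_compose B Y Z E v w) a (tassoc R X Y Z t) =
    lin_tensor_compose A (X \<boxtimes> Y) Z E (lin_tensor_compose A X Y C u v) w a t"
proof -
  note vw = lin_tensor_compose_closed[OF v w m(2,3,5,6,7)]
    and uv = lin_tensor_compose_closed[OF u v m(1,2,4,5,3)]
  note lin = linear_map_lin[OF lin_tensor_compose_lin[OF u vw a]] lin_linear[OF lin_tensor_compose_lin[OF uv w a]]
  note simps = lin_tensor_compose_pure[OF u vw] lin_tensor_compose_pure[OF uv w]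
    lin_tensor_compose_pure[OF u v] lin_tensor_compose_pure[OF v w]
  show ?thesis
    using t
    by (rule tensor3_linear_eqI[rotated 3, where P = E])
      (use m a u in \<open>simp_all add: tensor_simps tensor_linear lin simps lin_closed[OF lin_lin_moduleD(1)[OF u]]\<close>)
qed

lemma lin_tensor_compose_tmap:
  assumes u: "u \<in> lin R A (lin_module R X' B)" and v: "v \<in> lin R B (lin_module R Y' E)"
    and k: "k \<in> lin R X X'" and k': "k' \<in> lin R Y Y'"
    and m: "module R A" "module R B" "module R X" "module R X'" "module R Y" "module R Y'" "module R E"
    and a: "a \<in> carrier A" and t: "t \<in> carrier (X \<boxtimes> Y)"
  shows "lin_tensor_compose A X' Y' E u v a (tmap R X X' Y Y' k k' t) =
    lin_tensor_compose A X Y E (lin_precompose A X u k) (lin_precompose B Y v k') a t"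
proof -
  have "tlift R X Y E (\<lambda>x y. v (u a (k x)) (k' y)) =
      tlift R X Y E (\<lambda>x y. lin_precompose B Y v k' (lin_precompose A X u k a x) y)"
    using a k lin_closed[OF lin_lin_moduleD(1)[OF u m(1) a]]
    by (intro tlift_cong) (simp add: lin_precompose_apply lin_closed[OF k])
  then show ?thesis
    using a t m k k' tlift_tmap[OF bilinear_lin_tensor_compose[OF lin_lin_moduleD(1)[OF u m(1) a] v m(2)]
        k k' t m(3,4,5,6,7)]
    by (simp add: lin_tensor_compose_def)
qed

text \<open>The canonical isomorphism from A to Hom(R,A), whose inverse is evaluation at 1.\<close>

definition lin_unit :: "('u, 'a) module \<Rightarrow> 'a \<Rightarrow> 'u \<Rightarrow> 'a" where
  "lin_unit A = (\<lambda>a\<in>carrier A. \<lambda>r\<in>carrier R. r \<odot>\<^bsub>A\<^esub> a)"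

lemma lin_unit_apply: "\<lbrakk>a \<in> carrier A; r \<in> carrier R\<rbrakk> \<Longrightarrow> lin_unit A a r = r \<odot>\<^bsub>A\<^esub> a"
  by (simp add: lin_unit_def)

lemma linear_map_smult_unit:
  "\<lbrakk>module R A; a \<in> carrier A\<rbrakk> \<Longrightarrow> linear_map R \<I> A (\<lambda>r. r \<odot>\<^bsub>A\<^esub> a)"
  by (rule linear_map_smult_vector[OF _ linear_map_ident])

lemma smult_unit_lin: "\<lbrakk>module R A; a \<in> carrier A\<rbrakk> \<Longrightarrow> (\<lambda>r\<in>carrier R. r \<odot>\<^bsub>A\<^esub> a) \<in> lin R \<I> A"
  using linear_restrict_lin[OF linear_map_smult_unit R_module] by simp

lemma lin_unit_closed:
  assumes "module R A"
  shows "lin_unit A \<in> lin R A (lin_module R \<I> A)"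
  unfolding lin_lin_module_iff[OF assms]
proof (intro conjI ballI)
  show "lin_unit A \<in> extensional (carrier A)" by (simp add: lin_unit_def)
  show "lin_unit A a \<in> lin R \<I> A" if "a \<in> carrier A" for a
    using that smult_unit_lin[OF assms] by (simp add: lin_unit_def)
  show "linear_map R A A (\<lambda>a. lin_unit A a r)" if "r \<in> carrier \<I>" for r
    using that by (intro linear_map_cong[OF linear_map_smult_const[OF assms linear_map_ident, of r] assms])
      (simp_all add: lin_unit_apply)
qed

lemma lin_tensor_compose_unit_left:
  assumes u: "u \<in> lin R A (lin_module R X B)" and m: "module R A" "module R B" "module R X"
    and a: "a \<in> carrier A" and t: "t \<in> carrier (\<I> \<boxtimes> X)"
  shows "lin_tensor_compose A \<I> X B (lin_unit A) u a t = u a (tlunit R X t)"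
proof -
  note ua = lin_lin_moduleD(1)[OF u m(1) a]
  show ?thesis
    using t
    by (rule tensor_linear_eqI[rotated 3, where P = B])
      (use m a in \<open>simp_all add: tensor_simps tensor_linear linear_map_lin[OF ua] lin_unit_apply
        lin_linear[OF lin_tensor_compose_lin[OF lin_unit_closed u a]]
        lin_tensor_compose_pure[OF lin_unit_closed u] linear_map_smult[OF lin_linear[OF ua]]
        linear_map_smult[OF lin_lin_moduleD(2)[OF u]]\<close>)
qed

lemma lin_tensor_compose_unit_right:
  assumes u: "u \<in> lin R A (lin_module R X B)" and m: "module R A" "module R B" "module R X"
    and a: "a \<in> carrier A" and t: "t \<in> carrier (X \<boxtimes> \<I>)"
  shows "lin_tensor_compose A X \<I> B u (lin_unit B) a t = u a (trunit R X t)"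
proof -
  note ua = lin_lin_moduleD(1)[OF u m(1) a]
  show ?thesis
    using t
    by (rule tensor_linear_eqI[rotated 3, where P = B])
      (use m a in \<open>simp_all add: tensor_simps tensor_linear linear_map_lin[OF ua] lin_unit_apply
        lin_linear[OF lin_tensor_compose_lin[OF u lin_unit_closed a]]
        lin_tensor_compose_pure[OF u lin_unit_closed] linear_map_smult[OF lin_linear[OF ua]]
        lin_closed[OF ua]\<close>)
qed

text \<open>Needed twice: with \<open>\<beta>\<close> and \<open>\<beta>'\<close> the (flipped) actions on the modules, and with \<open>\<beta>\<close> and \<open>\<beta>'\<close> the
  multiplications of the algebras.\<close>

lemma measuring_tensor_compose:
  assumes u: "u1 \<in> lin R X1 B1" "u2 \<in> lin R X2 B2"
    and v: "v1 \<in> lin R B1 (lin_module R Y1 E1)" "v2 \<in> lin R B2 (lin_module R Y2 E2)"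
      "v3 \<in> lin R B3 (lin_module R Y3 E3)"
    and \<beta>: "bilinear_map R B1 B2 B3 \<beta>" "bilinear_map R E1 E2 E3 \<beta>'" and \<delta>: "\<delta> \<in> lin R Y3 (Y1 \<boxtimes> Y2)"
    and v3: "\<And>b1 b2 y. \<lbrakk>b1 \<in> carrier B1; b2 \<in> carrier B2; y \<in> carrier Y3\<rbrakk>
      \<Longrightarrow> v3 (\<beta> b1 b2) y = tlift R Y1 Y2 E3 (\<lambda>y1 y2. \<beta>' (v1 b1 y1) (v2 b2 y2)) (\<delta> y)"
    and m: "module R X1" "module R X2" "module R Y1" "module R Y2" "module R Y3"
      "module R B1" "module R B2" "module R B3" "module R E1" "module R E2" "module R E3"
    and t: "t \<in> carrier (X1 \<boxtimes> X2)" and y: "y \<in> carrier Y3"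
  shows "v3 (tlift R X1 X2 B3 (\<lambda>x1 x2. \<beta> (u1 x1) (u2 x2)) t) y =
    tlift R (X1 \<boxtimes> Y1) (X2 \<boxtimes> Y2) E3
      (\<lambda>p q. \<beta>' (tlift R X1 Y1 E1 (\<lambda>x y. v1 (u1 x) y) p) (tlift R X2 Y2 E2 (\<lambda>x y. v2 (u2 x) y) q))
      (tswap_middle R X1 X2 Y1 Y2 (pure R (X1 \<boxtimes> X2) (Y1 \<boxtimes> Y2) t (\<delta> y)))"
proof -
  note bu = bilinear_map_compose[OF \<beta>(1) lin_linear[OF u(1)] lin_linear[OF u(2)]]
  note b1 = bilinear_lin_tensor_compose[OF u(1) v(1) m(6)] and b2 = bilinear_lin_tensor_compose[OF u(2) v(2) m(7)]
  note l1 = tlift_lin[OF b1 m(1,3,9)] and l2 = tlift_lin[OF b2 m(2,4,10)]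
  note b12 = bilinear_map_compose[OF \<beta>(2) lin_linear[OF l1] lin_linear[OF l2]]
  \<comment> \<open>The case of a pure t, after \<open>v3\<close> has rewritten the left side. The
    value \<open>\<delta> y\<close> is replaced by an arbitrary s, in which both sides are
    linear.\<close>
  have *: "tlift R Y1 Y2 E3 (\<lambda>y1 y2. \<beta>' (v1 (u1 x1) y1) (v2 (u2 x2) y2)) s =
    tlift R (X1 \<boxtimes> Y1) (X2 \<boxtimes> Y2) E3
      (\<lambda>p q. \<beta>' (tlift R X1 Y1 E1 (\<lambda>x y. v1 (u1 x) y) p) (tlift R X2 Y2 E2 (\<lambda>x y. v2 (u2 x) y) q))
      (tswap_middle R X1 X2 Y1 Y2 (pure R (X1 \<boxtimes> X2) (Y1 \<boxtimes> Y2) (pure R X1 X2 x1 x2) s))"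
    if x: "x1 \<in> carrier X1" "x2 \<in> carrier X2" and "s \<in> carrier (Y1 \<boxtimes> Y2)" for x1 x2 s
  proof -
    note bv = bilinear_map_compose[OF \<beta>(2)
        lin_linear[OF lin_lin_moduleD(1)[OF v(1) m(6) lin_closed[OF u(1) x(1)]]]
        lin_linear[OF lin_lin_moduleD(1)[OF v(2) m(7) lin_closed[OF u(2) x(2)]]]]
    show ?thesis
      using that(3)
      by (rule tensor_linear_eqI[rotated 3, where P = E3])
        (use m x in \<open>simp_all add: tensor_simps tensor_linear linear_map_tlift bv b12 b1 b2 tlift_pure\<close>)
  qed
  show ?thesis
    using t
    by (rule tensor_linear_eqI[rotated 3, where P = E3])
      (use m y in \<open>simp_all add: tensor_simps tensor_linear linear_map_tlift bu b12 tlift_pure v3 *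
        linear_map_compose[OF lin_lin_moduleD(2)[OF v(3)]] lin_closed[OF u(1)] lin_closed[OF u(2)] lin_closed[OF \<delta>]\<close>)
qed

section \<open>Measurings and their pullbacks\<close>

abbreviation measurings where
  "measurings X M N \<equiv> Mod_hom R M (Hom_obj R X N)"

text \<open>Translates arrows into Hom(X,N) into identities between elements of N and its algebra.
  These are genuine modules, whereas Hom(X,N) may fail the module laws.\<close>

lemma measurings_iff:
  assumes "is_comodule R X" "is_amodule R M" "is_amodule R N"
  shows "u \<in> measurings X M N \<longleftrightarrow>
    fst u \<in> lin R (nmod M) (lin_module R (xmod X) (nmod N)) \<and>
    snd u \<in> lin R (alg M) (lin_module R (cmod (coalg X)) (alg N)) \<and>
    (\<forall>a\<in>carrier (alg M). \<forall>b\<in>carrier (alg M). \<forall>c\<in>carrier (cmod (coalg X)).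
       snd u (a \<otimes>\<^bsub>alg M\<^esub> b) c = tlift R (cmod (coalg X)) (cmod (coalg X)) (alg N)
         (\<lambda>c1 c2. snd u a c1 \<otimes>\<^bsub>alg N\<^esub> snd u b c2) (comult (coalg X) c)) \<and>
    (\<forall>c\<in>carrier (cmod (coalg X)). snd u \<one>\<^bsub>alg M\<^esub> c = counit (coalg X) c \<odot>\<^bsub>alg N\<^esub> \<one>\<^bsub>alg N\<^esub>) \<and>
    (\<forall>a\<in>carrier (alg M). \<forall>x\<in>carrier (nmod M). \<forall>z\<in>carrier (xmod X).
       fst u (act M a x) z = tlift R (xmod X) (cmod (coalg X)) (nmod N)
         (\<lambda>x0 x1. act N (snd u a x1) (fst u x x0)) (coact X z))"
proof -
  let ?C = "cmod (coalg X)"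
  \<comment> \<open>The convolution algebra differs from the module of linear maps only in product
    and unit, which \<open>lin\<close> does not see.\<close>
  have conv: "lin R (alg M) (convolution_algebra R (coalg X) (alg N)) = lin R (alg M) (lin_module R ?C (alg N))"
    by (simp add: lin_def convolution_algebra_def Let_def lin_module_def)
  have eq: "h = (\<lambda>c\<in>carrier C. k c) \<longleftrightarrow> (\<forall>c\<in>carrier C. h c = k c)"
    if "h \<in> lin R C E" for h C E k
    using lin_extensional[OF that] by (auto intro: extensionalityI)
  have hom: "f \<in> ring_hom (alg M) (convolution_algebra R (coalg X) (alg N)) \<longleftrightarrow>
      (\<forall>a\<in>carrier (alg M). \<forall>b\<in>carrier (alg M). \<forall>c\<in>carrier ?C. f (a \<otimes>\<^bsub>alg M\<^esub> b) c =
         tlift R ?C ?C (alg N) (\<lambda>c1 c2. f a c1 \<otimes>\<^bsub>alg N\<^esub> f b c2) (comult (coalg X) c)) \<and>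
      (\<forall>c\<in>carrier ?C. f \<one>\<^bsub>alg M\<^esub> c = counit (coalg X) c \<odot>\<^bsub>alg N\<^esub> \<one>\<^bsub>alg N\<^esub>)"
    if f: "f \<in> lin R (alg M) (lin_module R ?C (alg N))" for f
  proof -
    note D = lin_lin_moduleD[OF f is_amodule_modules(2)[OF assms(2)]]
    \<comment> \<open>Additivity, required by \<open>ring_hom\<close>, already follows from
      linearity; the conditions on product and unit are what remains.\<close>
    have "f (a \<oplus>\<^bsub>alg M\<^esub> b) = f a \<oplus>\<^bsub>convolution_algebra R (coalg X) (alg N)\<^esub> f b"
      if "a \<in> carrier (alg M)" "b \<in> carrier (alg M)" for a b
      using linear_map_add[OF lin_linear[OF f] that]
      by (simp add: convolution_algebra_def Let_def lin_module_def)
    then show ?thesis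
      using D(1) eq[OF D(1)] is_amodule_mult[OF assms(2)] is_amodule_one[OF assms(2)]
      by (auto simp: ring_hom_def convolution_algebra_def Let_def lin_module_def)
  qed
  have mod: "m \<in> module_maps R M (restrict_scalars (alg M) f (Hom_obj R X N)) \<longleftrightarrow>
      m \<in> lin R (nmod M) (lin_module R (xmod X) (nmod N)) \<and>
      (\<forall>a\<in>carrier (alg M). \<forall>x\<in>carrier (nmod M). \<forall>z\<in>carrier (xmod X). m (act M a x) z =
         tlift R (xmod X) ?C (nmod N) (\<lambda>x0 x1. act N (f a x1) (m x x0)) (coact X z))" for m f
  proof (cases "m \<in> lin R (nmod M) (lin_module R (xmod X) (nmod N))")
    case True
    note D = lin_lin_moduleD[OF True is_amodule_modules(1)[OF assms(2)]]
    show ?thesis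
      using True eq[OF D(1)] is_amodule_act[OF assms(2)]
      by (simp add: module_maps_def restrict_scalars_def Hom_obj_def)
  qed (simp add: module_maps_def restrict_scalars_def Hom_obj_def)
  show ?thesis
    by (cases u) (auto simp: Mod_hom_def algebra_hom_def mod hom conv
        Hom_obj_def[of _ X N, THEN arg_cong[of _ _ alg]])
qed

lemma measuringsD:
  assumes "u \<in> measurings X M N" "is_comodule R X" "is_amodule R M" "is_amodule R N"
  shows "fst u \<in> lin R (nmod M) (lin_module R (xmod X) (nmod N))"
    "snd u \<in> lin R (alg M) (lin_module R (cmod (coalg X)) (alg N))"
    "\<And>a b c. \<lbrakk>a \<in> carrier (alg M); b \<in> carrier (alg M); c \<in> carrier (cmod (coalg X))\<rbrakk>
      \<Longrightarrow> snd u (a \<otimes>\<^bsub>alg M\<^esub> b) c = tlift R (cmod (coalg X)) (cmod (coalg X)) (alg N)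
         (\<lambda>c1 c2. snd u a c1 \<otimes>\<^bsub>alg N\<^esub> snd u b c2) (comult (coalg X) c)"
    "\<And>c. c \<in> carrier (cmod (coalg X)) \<Longrightarrow> snd u \<one>\<^bsub>alg M\<^esub> c = counit (coalg X) c \<odot>\<^bsub>alg N\<^esub> \<one>\<^bsub>alg N\<^esub>"
    "\<And>a x z. \<lbrakk>a \<in> carrier (alg M); x \<in> carrier (nmod M); z \<in> carrier (xmod X)\<rbrakk>
      \<Longrightarrow> fst u (act M a x) z = tlift R (xmod X) (cmod (coalg X)) (nmod N)
         (\<lambda>x0 x1. act N (snd u a x1) (fst u x x0)) (coact X z)"
  using assms by (simp_all add: measurings_iff)

lemma measurings_eqI:
  assumes "u \<in> measurings X M N" "v \<in> measurings X M N" "is_comodule R X" "is_amodule R M" "is_amodule R N"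
    and "\<And>a x. \<lbrakk>a \<in> carrier (nmod M); x \<in> carrier (xmod X)\<rbrakk> \<Longrightarrow> fst u a x = fst v a x"
    and "\<And>a x. \<lbrakk>a \<in> carrier (alg M); x \<in> carrier (cmod (coalg X))\<rbrakk> \<Longrightarrow> snd u a x = snd v a x"
  shows "u = v"
  by (rule prod_eqI)
    (use assms measuringsD[OF assms(1,3-5)] measuringsD[OF assms(2,3-5)] is_amodule_modules[OF assms(4)]
      in \<open>auto intro: lin_lin_module_eqI\<close>)

text \<open>How arrows of comodules act on measurings: composition with \<open>Hom_arr\<close>,
  freed from the restrictions to spaces of linear maps that the latter carries.\<close>

definition pull where
  "pull M X p u = (lin_precompose (nmod M) (xmod X) (fst u) (fst p),
     lin_precompose (alg M) (cmod (coalg X)) (snd u) (snd p))"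

lemma Mod_cmp_Hom_arr:
  assumes "u \<in> measurings Y M N" "is_comodule R Y" "is_amodule R M" "is_amodule R N"
  shows "Mod_cmp M (Hom_arr R X Y N p) u = pull M X p u"
  using lin_lin_moduleD(1)[OF measuringsD(1)[OF assms] is_amodule_modules(1)[OF assms(3)]]
    lin_lin_moduleD(1)[OF measuringsD(2)[OF assms] is_amodule_modules(2)[OF assms(3)]]
  by (auto simp: Mod_cmp_def Hom_arr_def pull_def lin_precompose_def compose_def[of "carrier _" "restrict _ _"]
      cong: restrict_cong)

text \<open>Since p intertwines, a sum over the coaction of Y at p(z) is a sum over p applied to the
  coaction of X at z; \<open>tlift_tmap\<close> moves p into the summands.\<close>

lemma pull_closed:
  assumes p: "p \<in> Comod_hom R X Y" and u: "u \<in> measurings Y M N"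
    and o: "is_comodule R X" "is_comodule R Y" "is_amodule R M" "is_amodule R N"
  shows "pull M X p u \<in> measurings X M N"
proof -
  note X = comodule_facts[OF o(1)] and Y = comodule_facts[OF o(2)]
  note M = is_amodule_modules[OF o(3)] and N = is_amodule_modules[OF o(4)]
  note D = measuringsD[OF u o(2-4)] and P = Comod_homD[OF p o(1,2)]
  note L = lin_lin_moduleD(1)[OF D(1) M(1)] lin_lin_moduleD(1)[OF D(2) M(2)]
  have iw: "\<And>z. z \<in> carrier (xmod X) \<Longrightarrow> coact Y (fst p z) =
        tmap R (xmod X) (xmod Y) (cmod (coalg X)) (cmod (coalg Y)) (fst p) (snd p) (coact X z)"
    "\<And>c. c \<in> carrier (cmod (coalg X)) \<Longrightarrow> comult (coalg Y) (snd p c) =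
        tmap R (cmod (coalg X)) (cmod (coalg Y)) (cmod (coalg X)) (cmod (coalg Y)) (snd p) (snd p) (comult (coalg X) c)"
    "\<And>c. c \<in> carrier (cmod (coalg X)) \<Longrightarrow> counit (coalg Y) (snd p c) = counit (coalg X) c"
    using p o(1,2) by (simp_all add: Comod_hom_iff intertwines_def)
  show ?thesis
    unfolding measurings_iff[OF o(1,3,4)] pull_def fst_conv snd_conv
  proof (intro conjI ballI)
    show "lin_precompose (nmod M) (xmod X) (fst u) (fst p) \<in> lin R (nmod M) (lin_module R (xmod X) (nmod N))"
      by (rule lin_precompose_closed[OF D(1) P(1) M(1) X(1)])
    show "lin_precompose (alg M) (cmod (coalg X)) (snd u) (snd p) \<in>
        lin R (alg M) (lin_module R (cmod (coalg X)) (alg N))"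
      by (rule lin_precompose_closed[OF D(2) P(2) M(2) X(2)])
    show "lin_precompose (alg M) (cmod (coalg X)) (snd u) (snd p) \<one>\<^bsub>alg M\<^esub> c =
        counit (coalg X) c \<odot>\<^bsub>alg N\<^esub> \<one>\<^bsub>alg N\<^esub>" if "c \<in> carrier (cmod (coalg X))" for c
      using that by (simp add: lin_precompose_apply is_amodule_one[OF o(3)] D(4) lin_closed[OF P(2)] iw)
  next
    fix a b c assume abc: "a \<in> carrier (alg M)" "b \<in> carrier (alg M)" "c \<in> carrier (cmod (coalg X))"
    note bil = bilinear_map_compose[OF bilinear_map_alg_mult[OF o(4)] lin_linear[OF L(2)[OF abc(1)]]
        lin_linear[OF L(2)[OF abc(2)]]]
    show "lin_precompose (alg M) (cmod (coalg X)) (snd u) (snd p) (a \<otimes>\<^bsub>alg M\<^esub> b) c =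
        tlift R (cmod (coalg X)) (cmod (coalg X)) (alg N)
          (\<lambda>c1 c2. lin_precompose (alg M) (cmod (coalg X)) (snd u) (snd p) a c1 \<otimes>\<^bsub>alg N\<^esub>
            lin_precompose (alg M) (cmod (coalg X)) (snd u) (snd p) b c2) (comult (coalg X) c)"
      using abc is_amodule_mult[OF o(3) abc(1,2)]
      by (simp add: lin_precompose_apply D(3) lin_closed[OF P(2)] iw lin_closed[OF X(4)]
          tlift_tmap[OF bil P(2) P(2)] X Y N cong: tlift_cong)
  next
    fix a x z assume axz: "a \<in> carrier (alg M)" "x \<in> carrier (nmod M)" "z \<in> carrier (xmod X)"
    \<comment> \<open>The flip is needed because a right coaction lists the comodule entry first,
      while the algebra acts from the left.\<close>
    note bil = bilinear_map_compose[OF bilinear_map_flip[OF bilinear_map_act[OF o(4)]] lin_linear[OF L(1)[OF axz(2)]]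
        lin_linear[OF L(2)[OF axz(1)]]]
    show "lin_precompose (nmod M) (xmod X) (fst u) (fst p) (act M a x) z =
        tlift R (xmod X) (cmod (coalg X)) (nmod N)
          (\<lambda>x0 x1. act N (lin_precompose (alg M) (cmod (coalg X)) (snd u) (snd p) a x1)
            (lin_precompose (nmod M) (xmod X) (fst u) (fst p) x x0)) (coact X z)"
      using axz is_amodule_act[OF o(3) axz(1,2)]
      by (simp add: lin_precompose_apply D(5) lin_closed[OF P(1)] iw lin_closed[OF X(3)]
          tlift_tmap[OF bil P(1) P(2)] X Y N cong: tlift_cong)
  qed
qed

section \<open>Composition of measurings and its laws\<close>

definition measuring_compose where
  "measuring_compose M P X Y u v =
     (lin_tensor_compose (nmod M) (xmod X) (xmod Y) (nmod P) (fst u) (fst v),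
      lin_tensor_compose (alg M) (cmod (coalg X)) (cmod (coalg Y)) (alg P) (snd u) (snd v))"

definition measuring_unit where
  "measuring_unit M = (lin_unit (nmod M), lin_unit (alg M))"

text \<open>Apply the law for u, then the law for v inside the resulting sum. The coaction entries
  then occur in the order produced by the middle swap, that is, by the coaction of the tensor
  product.\<close>

lemma measuring_compose_closed:
  assumes u: "u \<in> measurings X M N" and v: "v \<in> measurings Y N P"
    and o: "is_comodule R X" "is_comodule R Y" "is_amodule R M" "is_amodule R N" "is_amodule R P"
  shows "measuring_compose M P X Y u v \<in> measurings (tensor_comodule R X Y) M P"
proof -
  note X = comodule_facts[OF o(1)] and Y = comodule_facts[OF o(2)]
  note M = is_amodule_modules[OF o(3)] and N = is_amodule_modules[OF o(4)] and P = is_amodule_modules[OF o(5)]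
  note U = measuringsD[OF u o(1,3,4)] and V = measuringsD[OF v o(2,4,5)]
  note L = lin_lin_moduleD(1)[OF U(1) M(1)] lin_lin_moduleD(1)[OF U(2) M(2)]
  note mods = X(1,2) Y(1,2) M N P
  let ?C = "cmod (coalg X)" and ?D = "cmod (coalg Y)"
  let ?m = "lin_tensor_compose (nmod M) (xmod X) (xmod Y) (nmod P) (fst u) (fst v)"
  let ?f = "lin_tensor_compose (alg M) ?C ?D (alg P) (snd u) (snd v)"
  have m: "?m \<in> lin R (nmod M) (lin_module R (xmod X \<boxtimes> xmod Y) (nmod P))"
    and f: "?f \<in> lin R (alg M) (lin_module R (?C \<boxtimes> ?D) (alg P))"
    by (rule lin_tensor_compose_closed[OF U(1) V(1)] lin_tensor_compose_closed[OF U(2) V(2)]; simp add: mods)+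
  note D = lin_lin_moduleD(1)[OF m M(1)] lin_lin_moduleD(1)[OF f M(2)]
  note m_pure = lin_tensor_compose_pure[OF U(1) V(1)] and f_pure = lin_tensor_compose_pure[OF U(2) V(2)]
  show ?thesis
    unfolding measurings_iff[OF is_comodule_tensor[OF o(1,2)] o(3,5)] measuring_compose_def fst_conv snd_conv
      tensor_comodule_simps tensor_coalgebra_simps
  proof (intro conjI ballI m f)
    fix t assume "t \<in> carrier (?C \<boxtimes> ?D)"
    then show "?f \<one>\<^bsub>alg M\<^esub> t = tensor_counit ?C ?D (counit (coalg X)) (counit (coalg Y)) t \<odot>\<^bsub>alg P\<^esub> \<one>\<^bsub>alg P\<^esub>"
    proof (rule tensor_linear_eqI[rotated 3, where P = "alg P"])
      fix c d assume cd: "c \<in> carrier ?C" "d \<in> carrier ?D"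
      \<comment> \<open>The scalar \<open>\<epsilon>(c)\<close> from the unit law of u leaves v by
        linearity; the counit of the tensor coalgebra is the product of the two scalars.\<close>
      have "snd v (snd u \<one>\<^bsub>alg M\<^esub> c) d = counit (coalg X) c \<odot>\<^bsub>alg P\<^esub> (counit (coalg Y) d \<odot>\<^bsub>alg P\<^esub> \<one>\<^bsub>alg P\<^esub>)"
        using cd linear_map_smult[OF lin_lin_moduleD(2)[OF V(2) N(2)]]
        by (simp add: U(4) V(4) unit_lin_closed[OF X(5)] is_amodule_one[OF o(4)])
      then show "?f \<one>\<^bsub>alg M\<^esub> (pure R ?C ?D c d) =
          tensor_counit ?C ?D (counit (coalg X)) (counit (coalg Y)) (pure R ?C ?D c d) \<odot>\<^bsub>alg P\<^esub> \<one>\<^bsub>alg P\<^esub>"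
        using cd by (simp add: f_pure mods X Y coact_simps is_amodule_one[OF o(3)] is_amodule_one[OF o(5)]
            unit_lin_closed[OF X(5)] unit_lin_closed[OF Y(5)] module.smult_assoc1)
    qed (simp_all add: mods X Y lin_linear[OF D(2)] is_amodule_one[OF o(3)] is_amodule_one[OF o(5)]
        linear_map_smult_vector coact_linear lin_linear[OF tensor_counit_lin])
  next
    fix a b t assume ab: "a \<in> carrier (alg M)" "b \<in> carrier (alg M)" and t: "t \<in> carrier (?C \<boxtimes> ?D)"
    note b = bilinear_map_compose[OF bilinear_map_alg_mult[OF o(5)] lin_linear[OF D(2)[OF ab(1)]]
        lin_linear[OF D(2)[OF ab(2)]]]
    show "?f (a \<otimes>\<^bsub>alg M\<^esub> b) t = tlift R (?C \<boxtimes> ?D) (?C \<boxtimes> ?D) (alg P) (\<lambda>p q. ?f a p \<otimes>\<^bsub>alg P\<^esub> ?f b q)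
        (tensor_coact ?C ?C ?D ?D (comult (coalg X)) (comult (coalg Y)) t)"
      using t
    proof (rule tensor_linear_eqI[rotated 3, where P = "alg P"])
      fix c d assume cd: "c \<in> carrier ?C" "d \<in> carrier ?D"
      \<comment> \<open>Here \<open>\<beta>\<close> and \<open>\<beta>'\<close> are the two
        products, and the algebra part of v takes the place of all of v1, v2 and v3.\<close>
      have "snd v (tlift R ?C ?C (alg N) (\<lambda>c1 c2. snd u a c1 \<otimes>\<^bsub>alg N\<^esub> snd u b c2) (comult (coalg X) c)) d =
          tlift R (?C \<boxtimes> ?D) (?C \<boxtimes> ?D) (alg P) (\<lambda>p q. ?f a p \<otimes>\<^bsub>alg P\<^esub> ?f b q)
            (tswap_middle R ?C ?C ?D ?D (pure R (?C \<boxtimes> ?C) (?D \<boxtimes> ?D) (comult (coalg X) c) (comult (coalg Y) d)))"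
        by (subst measuring_tensor_compose[OF L(2)[OF ab(1)] L(2)[OF ab(2)] V(2) V(2) V(2)
              bilinear_map_alg_mult[OF o(4)] bilinear_map_alg_mult[OF o(5)] Y(4) V(3)])
          (simp_all add: mods cd lin_closed[OF X(4)] lin_tensor_compose_def ab)
      then show "?f (a \<otimes>\<^bsub>alg M\<^esub> b) (pure R ?C ?D c d) =
          tlift R (?C \<boxtimes> ?D) (?C \<boxtimes> ?D) (alg P) (\<lambda>p q. ?f a p \<otimes>\<^bsub>alg P\<^esub> ?f b q)
            (tensor_coact ?C ?C ?D ?D (comult (coalg X)) (comult (coalg Y)) (pure R ?C ?D c d))"
        using cd ab by (simp add: f_pure mods X Y coact_simps is_amodule_mult[OF o(3)] U(3))
    qed (simp_all add: mods X Y lin_linear[OF D(2)] ab is_amodule_mult[OF o(3)] tensor_simps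
        linear_map_tlift b lin_linear[OF tensor_coact_lin])
  next
    fix a x t assume ax: "a \<in> carrier (alg M)" "x \<in> carrier (nmod M)" and t: "t \<in> carrier (xmod X \<boxtimes> xmod Y)"
    note b = bilinear_map_compose[OF bilinear_map_flip[OF bilinear_map_act[OF o(5)]]
        lin_linear[OF D(1)[OF ax(2)]] lin_linear[OF D(2)[OF ax(1)]]]
    show "?m (act M a x) t = tlift R (xmod X \<boxtimes> xmod Y) (?C \<boxtimes> ?D) (nmod P) (\<lambda>p q. act P (?f a q) (?m x p))
        (tensor_coact (xmod X) ?C (xmod Y) ?D (coact X) (coact Y) t)"
      using t
    proof (rule tensor_linear_eqI[rotated 3, where P = "nmod P"])
      fix z w assume zw: "z \<in> carrier (xmod X)" "w \<in> carrier (xmod Y)"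
      \<comment> \<open>Now the module part of v takes the place of v1 and v3 and its algebra part
        that of v2, with the flipped actions as \<open>\<beta>\<close> and
        \<open>\<beta>'\<close>.\<close>
      have "fst v (tlift R (xmod X) ?C (nmod N) (\<lambda>x0 x1. act N (snd u a x1) (fst u x x0)) (coact X z)) w =
          tlift R (xmod X \<boxtimes> xmod Y) (?C \<boxtimes> ?D) (nmod P) (\<lambda>p q. act P (?f a q) (?m x p))
            (tswap_middle R (xmod X) ?C (xmod Y) ?D
              (pure R (xmod X \<boxtimes> ?C) (xmod Y \<boxtimes> ?D) (coact X z) (coact Y w)))"
        by (subst measuring_tensor_compose[OF L(1)[OF ax(2)] L(2)[OF ax(1)] V(1) V(2) V(1)
              bilinear_map_flip[OF bilinear_map_act[OF o(4)]] bilinear_map_flip[OF bilinear_map_act[OF o(5)]]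
              Y(3) V(5)])
          (simp_all add: mods zw lin_closed[OF X(3)] lin_tensor_compose_def ax)
      then show "?m (act M a x) (pure R (xmod X) (xmod Y) z w) =
          tlift R (xmod X \<boxtimes> xmod Y) (?C \<boxtimes> ?D) (nmod P) (\<lambda>p q. act P (?f a q) (?m x p))
            (tensor_coact (xmod X) ?C (xmod Y) ?D (coact X) (coact Y) (pure R (xmod X) (xmod Y) z w))"
        using zw ax by (simp add: m_pure mods X Y coact_simps is_amodule_act[OF o(3)] U(5))
    qed (simp_all add: mods X Y lin_linear[OF D(1)] ax is_amodule_act[OF o(3)] tensor_simps
        linear_map_tlift b lin_linear[OF tensor_coact_lin])
  qed
qed

text \<open>Because R coacts by \<open>r \<mapsto> r \<otimes> 1\<close>, the two laws reduce to
  r(ab) = (ra)(1b) and r(ax) = (1a)(rx).\<close>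

lemma measuring_unit_closed:
  assumes "is_amodule R M"
  shows "measuring_unit M \<in> measurings (ring_comodule R) M M"
proof -
  note M = is_amodule_modules[OF assms]
  note mlin = lin_lin_moduleD(1)[OF lin_unit_closed[OF M(1)] M(1)]
    and flin = lin_lin_moduleD(1)[OF lin_unit_closed[OF M(2)] M(2)]
  show ?thesis
    unfolding measurings_iff[OF is_comodule_ring assms assms] measuring_unit_def fst_conv snd_conv
      ring_comodule_simps
  proof (intro conjI ballI lin_unit_closed M)
    fix a b r assume a: "a \<in> carrier (alg M)" "b \<in> carrier (alg M)" and r: "r \<in> carrier \<I>"
    note b = bilinear_map_compose[OF bilinear_map_alg_mult[OF assms] lin_linear[OF flin[OF a(1)]]
        lin_linear[OF flin[OF a(2)]]]
    show "lin_unit (alg M) (a \<otimes>\<^bsub>alg M\<^esub> b) r =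
      tlift R \<I> \<I> (alg M) (\<lambda>c1 c2. lin_unit (alg M) a c1 \<otimes>\<^bsub>alg M\<^esub> lin_unit (alg M) b c2) (unit_coact r)"
      using a r is_amodule_mult[OF assms a] M
        linear_map_smult[OF bilinear_map_left[OF bilinear_map_alg_mult[OF assms]], of b r a]
      by (simp add: unit_coact_apply tlift_pure[OF b] R_module lin_unit_apply module.smult_one)
  next
    fix a x r assume a: "a \<in> carrier (alg M)" "x \<in> carrier (nmod M)" and r: "r \<in> carrier \<I>"
    note b = bilinear_map_compose[OF bilinear_map_flip[OF bilinear_map_act[OF assms]] lin_linear[OF mlin[OF a(2)]]
        lin_linear[OF flin[OF a(1)]]]
    show "lin_unit (nmod M) (act M a x) r =
      tlift R \<I> \<I> (nmod M) (\<lambda>x0 x1. act M (lin_unit (alg M) a x1) (lin_unit (nmod M) x x0)) (unit_coact r)"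
      using a r is_amodule_act[OF assms a] M
        linear_map_smult[OF bilinear_map_right[OF bilinear_map_act[OF assms]], of a r x]
      by (simp add: unit_coact_apply tlift_pure[OF b] R_module lin_unit_apply module.smult_one)
  qed (simp add: lin_unit_apply is_amodule_one[OF assms])
qed

lemma pull_apply:
  "\<lbrakk>a \<in> carrier (nmod M); x \<in> carrier (xmod X)\<rbrakk> \<Longrightarrow> fst (pull M X p u) a x = fst u a (fst p x)"
  "\<lbrakk>a' \<in> carrier (alg M); c \<in> carrier (cmod (coalg X))\<rbrakk> \<Longrightarrow> snd (pull M X p u) a' c = snd u a' (snd p c)"
  by (simp_all add: pull_def lin_precompose_apply)

lemma pull_Comod_cmp:
  assumes p: "p \<in> Comod_hom R X Y" and q: "q \<in> Comod_hom R Y Z" and u: "u \<in> measurings Z M N"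
    and o: "is_comodule R X" "is_comodule R Y" "is_comodule R Z" "is_amodule R M" "is_amodule R N"
  shows "pull M X (Comod_cmp X q p) u = pull M X p (pull M Y q u)"
  using lin_closed[OF Comod_homD(1)[OF p o(1,2)]] lin_closed[OF Comod_homD(2)[OF p o(1,2)]]
  by (intro measurings_eqI[OF pull_closed[OF Comod_cmp_closed[OF o(1-3) p q] u o(1,3-5)]
        pull_closed[OF p pull_closed[OF q u o(2-5)] o(1,2,4,5)] o(1,4,5)])
    (simp_all add: pull_apply Comod_cmp_def compose_eq)

text \<open>Naturality of composition in both comodules. It turns a tensor product of classifying
  arrows into a composite of the measurings they classify.\<close>

lemma pull_tarr:
  assumes p: "p \<in> Comod_hom R X X'" and q: "q \<in> Comod_hom R Y Y'"
    and u: "u \<in> measurings X' M N" and v: "v \<in> measurings Y' N P"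
    and o: "is_comodule R X" "is_comodule R X'" "is_comodule R Y" "is_comodule R Y'"
      "is_amodule R M" "is_amodule R N" "is_amodule R P"
  shows "pull M (tensor_comodule R X Y) (tarr (Comod R) X X' Y Y' p q) (measuring_compose M P X' Y' u v) =
    measuring_compose M P X Y (pull M X p u) (pull N Y q v)"
proof -
  note U = measuringsD[OF u o(2,5,6)] and V = measuringsD[OF v o(4,6,7)]
  note p' = Comod_homD[OF p o(1,2)] and q' = Comod_homD[OF q o(3,4)]
  note m = comodule_facts(1,2)[OF o(1)] comodule_facts(1,2)[OF o(2)] comodule_facts(1,2)[OF o(3)]
    comodule_facts(1,2)[OF o(4)] is_amodule_modules[OF o(5)] is_amodule_modules[OF o(6)] is_amodule_modules[OF o(7)]
  show ?thesis
    by (rule measurings_eqI[OF pull_closed[OF Comod_tarr_closed[OF o(1-4) p q]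
            measuring_compose_closed[OF u v o(2,4-7)] is_comodule_tensor[OF o(1,3)] is_comodule_tensor[OF o(2,4)] o(5,7)]
          measuring_compose_closed[OF pull_closed[OF p u o(1,2,5,6)] pull_closed[OF q v o(3,4,6,7)] o(1,3,5-7)]
          is_comodule_tensor[OF o(1,3)] o(5,7)])
      (simp_all add: pull_apply tensor_comodule_simps tensor_coalgebra_simps Comod_simps measuring_compose_def
        pull_def lin_precompose_apply m lin_tensor_compose_tmap[OF U(1) V(1) p'(1) q'(1)]
        lin_tensor_compose_tmap[OF U(2) V(2) p'(2) q'(2)])
qed

lemma measuring_compose_assoc:
  assumes u: "u \<in> measurings X L M" and v: "v \<in> measurings Y M N" and w: "w \<in> measurings Z N P"
    and o: "is_comodule R X" "is_comodule R Y" "is_comodule R Z"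
      "is_amodule R L" "is_amodule R M" "is_amodule R N" "is_amodule R P"
  shows "pull L (tensor_comodule R (tensor_comodule R X Y) Z) (assoc_arr (Comod R) X Y Z)
      (measuring_compose L P X (tensor_comodule R Y Z) u (measuring_compose M P Y Z v w)) =
    measuring_compose L P (tensor_comodule R X Y) Z (measuring_compose L N X Y u v) w"
proof -
  note U = measuringsD[OF u o(1,4,5)] and V = measuringsD[OF v o(2,5,6)] and W = measuringsD[OF w o(3,6,7)]
  note m = comodule_facts(1,2)[OF o(1)] comodule_facts(1,2)[OF o(2)] comodule_facts(1,2)[OF o(3)]
    is_amodule_modules[OF o(4)] is_amodule_modules[OF o(5)] is_amodule_modules[OF o(6)] is_amodule_modules[OF o(7)]
  note XY = is_comodule_tensor[OF o(1,2)] and YZ = is_comodule_tensor[OF o(2,3)]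
  show ?thesis
    by (rule measurings_eqI[OF pull_closed[OF Comod_assoc_closed[OF o(1-3)]
            measuring_compose_closed[OF u measuring_compose_closed[OF v w o(2,3,5-7)] o(1) YZ o(4,5,7)]
            is_comodule_tensor[OF XY o(3)] is_comodule_tensor[OF o(1) YZ] o(4,7)]
          measuring_compose_closed[OF measuring_compose_closed[OF u v o(1,2,4-6)] w XY o(3,4,6,7)]
          is_comodule_tensor[OF XY o(3)] o(4,7)])
      (simp_all add: pull_apply tensor_comodule_simps tensor_coalgebra_simps Comod_simps measuring_compose_def
        m lin_tensor_compose_assoc[OF U(1) V(1) W(1)] lin_tensor_compose_assoc[OF U(2) V(2) W(2)])
qed

lemma measuring_compose_unit_left:
  assumes u: "u \<in> measurings X M N" and o: "is_comodule R X" "is_amodule R M" "is_amodule R N"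
  shows "measuring_compose M N (ring_comodule R) X (measuring_unit M) u =
    pull M (tensor_comodule R (ring_comodule R) X) (lunit_arr (Comod R) X) u"
proof -
  note U = measuringsD[OF u o]
  note m = comodule_facts(1,2)[OF o(1)] is_amodule_modules[OF o(2)] is_amodule_modules[OF o(3)]
  note IX = is_comodule_tensor[OF is_comodule_ring o(1)]
  show ?thesis
    by (rule measurings_eqI[OF measuring_compose_closed[OF measuring_unit_closed[OF o(2)] u is_comodule_ring o(1,2,2,3)]
          pull_closed[OF Comod_lunit_closed[OF o(1)] u IX o] IX o(2,3)])
      (simp_all add: pull_apply tensor_comodule_simps tensor_coalgebra_simps Comod_simps measuring_compose_def
        ring_comodule_simps measuring_unit_def
        m lin_tensor_compose_unit_left[OF U(1)] lin_tensor_compose_unit_left[OF U(2)])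
qed

lemma measuring_compose_unit_right:
  assumes u: "u \<in> measurings X M N" and o: "is_comodule R X" "is_amodule R M" "is_amodule R N"
  shows "measuring_compose M N X (ring_comodule R) u (measuring_unit N) =
    pull M (tensor_comodule R X (ring_comodule R)) (runit_arr (Comod R) X) u"
proof -
  note U = measuringsD[OF u o]
  note m = comodule_facts(1,2)[OF o(1)] is_amodule_modules[OF o(2)] is_amodule_modules[OF o(3)]
  note XI = is_comodule_tensor[OF o(1) is_comodule_ring]
  show ?thesis
    by (rule measurings_eqI[OF measuring_compose_closed[OF u measuring_unit_closed[OF o(3)] o(1) is_comodule_ring o(2,3,3)]
          pull_closed[OF Comod_runit_closed[OF o(1)] u XI o] XI o(2,3)])
      (simp_all add: pull_apply tensor_comodule_simps tensor_coalgebra_simps Comod_simps measuring_compose_def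
        ring_comodule_simps measuring_unit_def
        m lin_tensor_compose_unit_right[OF U(1)] lin_tensor_compose_unit_right[OF U(2)])
qed

section \<open>Measurings by the unit comodule as arrows of modules\<close>

definition eval_one where
  "eval_one M u = (\<lambda>x\<in>carrier (nmod M). fst u x \<one>, \<lambda>a\<in>carrier (alg M). snd u a \<one>)"

lemma Mod_hom_iff:
  "p \<in> Mod_hom R M N \<longleftrightarrow> fst p \<in> lin R (nmod M) (nmod N) \<and> snd p \<in> lin R (alg M) (alg N) \<and>
    snd p \<in> ring_hom (alg M) (alg N) \<and>
    (\<forall>a\<in>carrier (alg M). \<forall>x\<in>carrier (nmod M). fst p (act M a x) = act N (snd p a) (fst p x))"
  by (cases p) (auto simp: Mod_hom_def algebra_hom_def module_maps_def restrict_scalars_def)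

text \<open>Changes the source of a measuring. Applied to the scalar measuring of the target it
  produces preimages under evaluation at 1.\<close>

lemma Mod_cmp_measuring:
  assumes p: "p \<in> Mod_hom R L M" and u: "u \<in> measurings X M N"
    and o: "is_comodule R X" "is_amodule R L" "is_amodule R M" "is_amodule R N"
  shows "Mod_cmp L u p \<in> measurings X L N"
proof -
  note U = measuringsD[OF u o(1,3,4)]
  have p': "fst p \<in> lin R (nmod L) (nmod M)" "snd p \<in> lin R (alg L) (alg M)"
    "snd p \<in> ring_hom (alg L) (alg M)"
    "\<And>a x. a \<in> carrier (alg L) \<Longrightarrow> x \<in> carrier (nmod L) \<Longrightarrow> fst p (act L a x) = act M (snd p a) (fst p x)"
    using p by (simp_all add: Mod_hom_iff)
  note closed = lin_closed[OF p'(1)] lin_closed[OF p'(2)]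
  show ?thesis
    using lin_compose[OF U(1) p'(1) is_amodule_modules(1)[OF o(2)]]
      lin_compose[OF U(2) p'(2) is_amodule_modules(2)[OF o(2)]]
    by (simp add: measurings_iff[OF o(1,2,4)] Mod_cmp_def compose_eq closed p'(4) U is_amodule_one[OF o(2)]
        is_amodule_mult[OF o(2)] is_amodule_act[OF o(2)] ring_hom_mult[OF p'(3)] ring_hom_one[OF p'(3)])
qed

text \<open>The element 1 of R is grouplike: its comultiplication is 1 \<otimes> 1 and its counit is
  1. At this element the laws of a measuring become those of an arrow of \<open>Mod\<close>.\<close>

lemma eval_one_closed:
  assumes u: "u \<in> measurings (ring_comodule R) M N" and o: "is_amodule R M" "is_amodule R N"
  shows "eval_one M u \<in> Mod_hom R M N"
proof -
  note U = measuringsD[OF u is_comodule_ring o, unfolded ring_comodule_simps]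
  note M = is_amodule_modules[OF o(1)] and N = is_amodule_modules[OF o(2)]
  note L = lin_lin_moduleD(1)[OF U(1) M(1)] lin_lin_moduleD(1)[OF U(2) M(2)]
  have one: "\<one> \<in> carrier \<I>" by simp
  have fst: "fst (eval_one M u) \<in> lin R (nmod M) (nmod N)" and snd: "snd (eval_one M u) \<in> lin R (alg M) (alg N)"
    unfolding eval_one_def fst_conv snd_conv
    by (intro linear_restrict_lin M lin_lin_moduleD(2)[OF U(1) M(1) one] lin_lin_moduleD(2)[OF U(2) M(2) one])+
  have mult: "snd u (a \<otimes>\<^bsub>alg M\<^esub> b) \<one> = snd u a \<one> \<otimes>\<^bsub>alg N\<^esub> snd u b \<one>"
    if ab: "a \<in> carrier (alg M)" "b \<in> carrier (alg M)" for a b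
    using U(3)[OF ab one] N
    by (simp add: unit_coact_apply R_module tlift_pure[OF bilinear_map_compose[OF bilinear_map_alg_mult[OF o(2)]
          lin_linear[OF L(2)[OF ab(1)]] lin_linear[OF L(2)[OF ab(2)]]]])
  have act: "fst u (act M a x) \<one> = act N (snd u a \<one>) (fst u x \<one>)"
    if ax: "a \<in> carrier (alg M)" "x \<in> carrier (nmod M)" for a x
    using U(5)[OF ax one] N
    by (simp add: unit_coact_apply R_module tlift_pure[OF bilinear_map_compose[OF
          bilinear_map_flip[OF bilinear_map_act[OF o(2)]] lin_linear[OF L(1)[OF ax(2)]] lin_linear[OF L(2)[OF ax(1)]]]])
  have "snd u \<one>\<^bsub>alg M\<^esub> \<one> = \<one>\<^bsub>alg N\<^esub>"
    using U(4)[OF one] N is_amodule_one[OF o(2)] by (simp add: module.smult_one)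
  then have "snd (eval_one M u) \<in> ring_hom (alg M) (alg N)"
    using linear_map_add[OF lin_linear[OF snd]] lin_closed[OF snd] is_amodule_mult[OF o(1)] is_amodule_one[OF o(1)] mult
    by (auto simp: ring_hom_def eval_one_def)
  then show ?thesis
    using fst snd act is_amodule_act[OF o(1)] by (simp add: Mod_hom_iff) (simp add: eval_one_def)
qed

lemma Mod_cmp_apply:
  "x \<in> carrier (nmod M) \<Longrightarrow> fst (Mod_cmp M q p) x = fst q (fst p x)"
  "a \<in> carrier (alg M) \<Longrightarrow> snd (Mod_cmp M q p) a = snd q (snd p a)"
  by (simp_all add: Mod_cmp_def compose_eq)

lemma eval_one_apply:
  "x \<in> carrier (nmod M) \<Longrightarrow> fst (eval_one M u) x = fst u x \<one>"
  "a \<in> carrier (alg M) \<Longrightarrow> snd (eval_one M u) a = snd u a \<one>"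
  by (simp_all add: eval_one_def)

lemma Mod_hom_eqI:
  assumes "p \<in> Mod_hom R M N" "q \<in> Mod_hom R M N"
    and "\<And>x. x \<in> carrier (nmod M) \<Longrightarrow> fst p x = fst q x" "\<And>a. a \<in> carrier (alg M) \<Longrightarrow> snd p a = snd q a"
  shows "p = q"
  by (rule prod_eqI) (use assms in \<open>auto simp: Mod_hom_iff intro: lin_eqI\<close>)

lemma eval_one_unit:
  assumes "is_amodule R M"
  shows "eval_one M (measuring_unit M) = (idm (nmod M), idm (alg M))"
  using is_amodule_modules[OF assms]
  by (auto simp: eval_one_def measuring_unit_def lin_unit_apply module.smult_one cong: restrict_cong)

lemma eval_one_Mod_cmp_unit:
  assumes p: "p \<in> Mod_hom R M N" and o: "is_amodule R M" "is_amodule R N"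
  shows "eval_one M (Mod_cmp M (measuring_unit N) p) = p"
proof -
  have p': "fst p \<in> lin R (nmod M) (nmod N)" "snd p \<in> lin R (alg M) (alg N)"
    using p by (simp_all add: Mod_hom_iff)
  show ?thesis
    using lin_closed[OF p'(1)] lin_closed[OF p'(2)] is_amodule_modules[OF o(2)]
    by (intro Mod_hom_eqI[OF eval_one_closed[OF Mod_cmp_measuring[OF p measuring_unit_closed[OF o(2)]
            is_comodule_ring o(1,2,2)] o] p])
      (simp_all add: eval_one_apply Mod_cmp_apply measuring_unit_def lin_unit_apply module.smult_one)
qed

text \<open>R is generated by 1 as a module over itself; this gives injectivity of evaluation at
  1.\<close>

lemma lin_unit_expand: "f \<in> lin R \<I> B \<Longrightarrow> r \<in> carrier R \<Longrightarrow> f r = r \<odot>\<^bsub>B\<^esub> f \<one>"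
  using linear_map_smult[of R \<I> B f r \<one>] by (simp add: lin_linear)

lemma bij_betw_eval_one:
  assumes o: "is_amodule R M" "is_amodule R N"
  shows "bij_betw (eval_one M) (measurings (ring_comodule R) M N) (Mod_hom R M N)"
proof (rule bij_betw_imageI)
  show "eval_one M ` measurings (ring_comodule R) M N = Mod_hom R M N"
  proof (intro equalityI image_subsetI subsetI)
    fix p assume p: "p \<in> Mod_hom R M N"
    show "p \<in> eval_one M ` measurings (ring_comodule R) M N"
      using eval_one_Mod_cmp_unit[OF p o]
        Mod_cmp_measuring[OF p measuring_unit_closed[OF o(2)] is_comodule_ring o o(2)]
      by (intro image_eqI[where x = "Mod_cmp M (measuring_unit N) p"]) simp_all
  qed (rule eval_one_closed[OF _ o])
  show "inj_on (eval_one M) (measurings (ring_comodule R) M N)"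
  proof (rule inj_onI)
    fix u v assume u: "u \<in> measurings (ring_comodule R) M N" and v: "v \<in> measurings (ring_comodule R) M N"
      and eq: "eval_one M u = eval_one M v"
    note U = measuringsD[OF u is_comodule_ring o, unfolded ring_comodule_simps]
      and V = measuringsD[OF v is_comodule_ring o, unfolded ring_comodule_simps]
    note M = is_amodule_modules[OF o(1)]
    show "u = v"
    proof (rule measurings_eqI[OF u v is_comodule_ring o], unfold ring_comodule_simps)
      fix x r assume x: "x \<in> carrier (nmod M)" and "r \<in> carrier \<I>"
      then have r: "r \<in> carrier R" by simp
      have "fst u x \<one> = fst v x \<one>"
        using x eq by (metis eval_one_apply(1))
      then show "fst u x r = fst v x r"
        using lin_unit_expand[OF lin_lin_moduleD(1)[OF U(1) M(1) x] r]
          lin_unit_expand[OF lin_lin_moduleD(1)[OF V(1) M(1) x] r] by simp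
    next
      fix a r assume a: "a \<in> carrier (alg M)" and "r \<in> carrier \<I>"
      then have r: "r \<in> carrier R" by simp
      have "snd u a \<one> = snd v a \<one>"
        using a eq by (metis eval_one_apply(2))
      then show "snd u a r = snd v a r"
        using lin_unit_expand[OF lin_lin_moduleD(1)[OF U(2) M(2) a] r]
          lin_unit_expand[OF lin_lin_moduleD(1)[OF V(2) M(2) a] r] by simp
    qed
  qed
qed

text \<open>Two-sided inverses are unique, so the definite description in
  \<open>inverse_arrow\<close> can be replaced by any known inverse.\<close>

lemma inverse_arrow_eq:
  assumes "inverse_arrows (Comod R) X Y f g" "is_comodule R X" "is_comodule R Y"
  shows "inverse_arrow (Comod R) X Y f = g"
proof -
  interpret category "Comod R" by (rule category_Comod)
  have X: "X \<in> objs (Comod R)" "Y \<in> objs (Comod R)" using assms by (simp_all add: Comod_simps)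
  show ?thesis
    unfolding inverse_arrow_def
  proof (rule the_equality, rule assms(1))
    fix h assume "inverse_arrows (Comod R) X Y f h"
    then show "h = g"
      using assms(1) cmp_assoc[OF X(2,1,2,1), of g f h] X
      by (simp add: inverse_arrows_def cmp_ident_left cmp_ident_right)
  qed
qed

text \<open>The inverse left unitor sends 1 to 1 \<otimes> 1, where the composite measuring takes
  the value v(u(m)(1))(1).\<close>

lemma eval_one_compose:
  assumes u: "u \<in> measurings (ring_comodule R) M N" and v: "v \<in> measurings (ring_comodule R) N P"
    and o: "is_amodule R M" "is_amodule R N" "is_amodule R P"
  shows "eval_one M (pull M (ring_comodule R) (inverse_arrow (Comod R)
      (tensor_comodule R (ring_comodule R) (ring_comodule R)) (ring_comodule R) (lunit_arr (Comod R) (ring_comodule R)))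
      (measuring_compose M P (ring_comodule R) (ring_comodule R) u v)) =
    Mod_cmp M (eval_one N v) (eval_one M u)"
proof -
  note U = measuringsD[OF u is_comodule_ring o(1,2), unfolded ring_comodule_simps]
    and V = measuringsD[OF v is_comodule_ring o(2,3), unfolded ring_comodule_simps]
  note m = is_amodule_modules[OF o(1)] is_amodule_modules[OF o(2)] is_amodule_modules[OF o(3)] R_module
  note closed = lin_closed[OF lin_lin_moduleD(1)[OF U(1) m(1)]] lin_closed[OF lin_lin_moduleD(1)[OF U(2) m(2)]]
  note inv = inverse_arrow_eq[OF Comod_lunit_inverse[OF is_comodule_ring] is_comodule_tensor[OF is_comodule_ring is_comodule_ring]
      is_comodule_ring]
  show ?thesis
    unfolding inv eval_one_def[of M "pull _ _ _ _"] Mod_cmp_def compose_def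
    by (auto simp: pull_apply ring_comodule_simps measuring_compose_def lin_tensor_compose_pure[OF U(1) V(1)]
        lin_tensor_compose_pure[OF U(2) V(2)] m eval_one_apply closed cong: restrict_cong)
qed

section \<open>Universal measurings from representability\<close>

lemma pull_ident:
  assumes u: "u \<in> measurings X M N" and o: "is_comodule R X" "is_amodule R M" "is_amodule R N"
  shows "pull M X (idm (xmod X), idm (cmod (coalg X))) u = u"
  by (intro measurings_eqI[OF pull_closed[OF Comod_ident[OF o(1)] u o(1) o] u o]) (simp_all add: pull_apply)

lemma universal_measuring:
  assumes "universal_measuring_comodule R M N Q" and o: "is_amodule R M" "is_amodule R N"
  obtains u where "u \<in> measurings Q M N"
    and "\<And>X. is_comodule R X \<Longrightarrow> bij_betw (\<lambda>p. pull M X p u) (Comod_hom R X Q) (measurings X M N)"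
proof -
  obtain \<Phi> where \<Phi>: "\<forall>X\<in>objs (Comod R). bij_betw (\<Phi> X) (arrs (Comod R) X Q) (measurings X M N)"
      "\<forall>X\<in>objs (Comod R). \<forall>Y\<in>objs (Comod R). \<forall>p\<in>arrs (Comod R) X Y. \<forall>h\<in>arrs (Comod R) Y Q.
         \<Phi> X (cmp (Comod R) X Y Q h p) = Mod_cmp M (Hom_arr R X Y N p) (\<Phi> Y h)"
    using assms(1) unfolding universal_measuring_comodule_def by (elim conjE exE)
  have Q: "is_comodule R Q"
    using assms(1) by (simp add: universal_measuring_comodule_def Comod_simps)
  have bij: "bij_betw (\<Phi> X) (Comod_hom R X Q) (measurings X M N)" if "is_comodule R X" for X
    using \<Phi>(1) that by (simp add: Comod_simps)
  have nat: "\<Phi> X (Comod_cmp X h p) = Mod_cmp M (Hom_arr R X Y N p) (\<Phi> Y h)"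
    if "is_comodule R X" "is_comodule R Y" "p \<in> Comod_hom R X Y" "h \<in> Comod_hom R Y Q" for X Y p h
    using \<Phi>(2) that by (simp add: Comod_simps)
  define u where "u = \<Phi> Q (idm (xmod Q), idm (cmod (coalg Q)))"
  have u: "u \<in> measurings Q M N"
    unfolding u_def using bij_betw_apply[OF bij[OF Q] Comod_ident[OF Q]] .
  \<comment> \<open>The Yoneda argument: naturality at p followed by the identity of Q expresses the
    representation at p through its value at the identity.\<close>
  have "\<Phi> X p = pull M X p u" if X: "is_comodule R X" and p: "p \<in> Comod_hom R X Q" for X p
    using nat[OF X Q p Comod_ident[OF Q]] Mod_cmp_Hom_arr[OF u Q o] Comod_homD[OF p X Q]
    by (simp add: u_def Comod_cmp_def compose_ident_left)
  then have "bij_betw (\<lambda>p. pull M X p u) (Comod_hom R X Q) (measurings X M N)" if "is_comodule R X" for X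
    using bij[OF that] that by (simp cong: bij_betw_cong)
  then show ?thesis using u that by blast
qed

end

section \<open>The enrichment\<close>

text \<open>The universal measurings are fixed as parameters, so that classifying arrows and the
  enriched structure can be defined as constants; the choice of U is made in the final
  proof.\<close>

locale universal_measurings = tensor_products R
  for R :: "('u, 'z) ring_scheme" (structure) +
  fixes Q :: "('u, 'a, 'm) amodule \<Rightarrow> ('u, 'a, 'm) amodule \<Rightarrow> 'u comodule"
    and U :: "('u, 'a, 'm) amodule \<Rightarrow> ('u, 'a, 'm) amodule \<Rightarrow> ('m \<Rightarrow> 'u \<Rightarrow> 'm) \<times> ('a \<Rightarrow> 'u \<Rightarrow> 'a)"
  assumes Q: "\<lbrakk>is_amodule R M; is_amodule R N\<rbrakk> \<Longrightarrow> is_comodule R (Q M N)"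
    and U: "\<lbrakk>is_amodule R M; is_amodule R N\<rbrakk> \<Longrightarrow> U M N \<in> measurings (Q M N) M N"
    and bij_pull: "\<lbrakk>is_amodule R M; is_amodule R N; is_comodule R X\<rbrakk>
      \<Longrightarrow> bij_betw (\<lambda>p. pull M X p (U M N)) (Comod_hom R X (Q M N)) (measurings X M N)"
begin

section \<open>Composition and identity arrows and the enrichment axioms\<close>

definition classify where
  "classify M N X = inv_into (Comod_hom R X (Q M N)) (\<lambda>p. pull M X p (U M N))"

lemma classify:
  assumes "is_amodule R M" "is_amodule R N" "is_comodule R X" "w \<in> measurings X M N"
  shows "classify M N X w \<in> Comod_hom R X (Q M N)" "pull M X (classify M N X w) (U M N) = w"
proof -
  have "w \<in> (\<lambda>p. pull M X p (U M N)) ` Comod_hom R X (Q M N)"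
    using bij_pull[OF assms(1-3)] assms(4) by (simp add: bij_betw_def)
  then show "classify M N X w \<in> Comod_hom R X (Q M N)" "pull M X (classify M N X w) (U M N) = w"
    unfolding classify_def by (rule inv_into_into, rule f_inv_into_f)
qed

lemma pull_eqI:
  assumes "is_amodule R M" "is_amodule R N" "is_comodule R X"
    and "p \<in> Comod_hom R X (Q M N)" "q \<in> Comod_hom R X (Q M N)"
    and "pull M X p (U M N) = pull M X q (U M N)"
  shows "p = q"
  using bij_pull[OF assms(1-3)] assms(4-6) by (auto simp: bij_betw_def dest: inj_onD)

definition compose_arrow where
  "compose_arrow L M N = classify L N (tensor_comodule R (Q L M) (Q M N))
     (measuring_compose L N (Q L M) (Q M N) (U L M) (U M N))"

definition unit_arrow where
  "unit_arrow M = classify M M (ring_comodule R) (measuring_unit M)"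

lemma compose_arrow:
  assumes "is_amodule R L" "is_amodule R M" "is_amodule R N"
  shows "compose_arrow L M N \<in> Comod_hom R (tensor_comodule R (Q L M) (Q M N)) (Q L N)"
    "pull L (tensor_comodule R (Q L M) (Q M N)) (compose_arrow L M N) (U L N) =
      measuring_compose L N (Q L M) (Q M N) (U L M) (U M N)"
  unfolding compose_arrow_def
  by (rule classify measuring_compose_closed is_comodule_tensor Q U assms)+

lemma unit_arrow:
  assumes "is_amodule R M"
  shows "unit_arrow M \<in> Comod_hom R (ring_comodule R) (Q M M)"
    "pull M (ring_comodule R) (unit_arrow M) (U M M) = measuring_unit M"
  unfolding unit_arrow_def
  by (rule classify measuring_unit_closed is_comodule_ring assms)+

text \<open>The computation rule behind all axioms: the enriched composite of two classifying arrows
  classifies the composite of what they classify. It combines functoriality of pullback,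
  \<open>pull_tarr\<close> and the choice of \<open>compose_arrow\<close>.\<close>

lemma pull_compose_arrow_tarr:
  assumes o: "is_amodule R L" "is_amodule R M" "is_amodule R N" "is_comodule R X" "is_comodule R Y"
    and p: "p \<in> Comod_hom R X (Q L M)" and q: "q \<in> Comod_hom R Y (Q M N)"
  shows "Comod_cmp (tensor_comodule R X Y) (compose_arrow L M N) (tarr (Comod R) X (Q L M) Y (Q M N) p q)
      \<in> Comod_hom R (tensor_comodule R X Y) (Q L N)"
    "pull L (tensor_comodule R X Y)
      (Comod_cmp (tensor_comodule R X Y) (compose_arrow L M N) (tarr (Comod R) X (Q L M) Y (Q M N) p q)) (U L N) =
    measuring_compose L N X Y (pull L X p (U L M)) (pull M Y q (U M N))"
proof -
  note t = Comod_tarr_closed[OF o(4) Q[OF o(1,2)] o(5) Q[OF o(2,3)] p q]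
  note XY = is_comodule_tensor[OF o(4,5)] is_comodule_tensor[OF Q[OF o(1,2)] Q[OF o(2,3)]]
  show "Comod_cmp (tensor_comodule R X Y) (compose_arrow L M N) (tarr (Comod R) X (Q L M) Y (Q M N) p q)
      \<in> Comod_hom R (tensor_comodule R X Y) (Q L N)"
    by (rule Comod_cmp_closed[OF XY Q[OF o(1,3)] t compose_arrow(1)[OF o(1-3)]])
  show "pull L (tensor_comodule R X Y)
      (Comod_cmp (tensor_comodule R X Y) (compose_arrow L M N) (tarr (Comod R) X (Q L M) Y (Q M N) p q)) (U L N) =
    measuring_compose L N X Y (pull L X p (U L M)) (pull M Y q (U M N))"
    using pull_Comod_cmp[OF t compose_arrow(1)[OF o(1-3)] U[OF o(1,3)] XY Q[OF o(1,3)] o(1,3)]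
      pull_tarr[OF p q U[OF o(1,2)] U[OF o(2,3)] o(4) Q[OF o(1,2)] o(5) Q[OF o(2,3)] o(1-3)]
    by (simp add: compose_arrow(2)[OF o(1-3)])
qed

text \<open>Hom-objects are reversed, so the indices of composition are reversed as well:
  \<open>compose_arrow N M L\<close> already starts at Q(N,M) \<otimes> Q(M,L), the domain demanded
  of \<open>ecmp L M N\<close>.\<close>

definition Mod_enriched where
  "Mod_enriched = \<lparr>eobjs = {M. is_amodule R M}, ehom = (\<lambda>M N. Q N M), eident = unit_arrow,
     ecmp = (\<lambda>L M N. compose_arrow N M L)\<rparr>"

lemma Mod_enriched_simps:
  "eobjs Mod_enriched = {M. is_amodule R M}" "ehom Mod_enriched M N = Q N M"
  "eident Mod_enriched = unit_arrow" "ecmp Mod_enriched L M N = compose_arrow N M L"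
  by (simp_all add: Mod_enriched_def)

lemma pull_ident_universal:
  "\<lbrakk>is_amodule R M; is_amodule R N\<rbrakk> \<Longrightarrow> pull M (Q M N) (ident (Comod R) (Q M N)) (U M N) = U M N"
  by (simp add: Comod_simps pull_ident[OF U Q])

lemma ident_universal:
  "\<lbrakk>is_amodule R M; is_amodule R N\<rbrakk> \<Longrightarrow> ident (Comod R) (Q M N) \<in> Comod_hom R (Q M N) (Q M N)"
  by (simp add: Comod_simps Comod_ident Q)

text \<open>The associativity axiom at L, M, N, P after this reversal, hence the indices running
  from P down to L.\<close>

lemma compose_arrow_assoc:
  assumes o: "is_amodule R L" "is_amodule R M" "is_amodule R N" "is_amodule R P"
  shows "Comod_cmp (tensor_comodule R (tensor_comodule R (Q P N) (Q N M)) (Q M L)) (compose_arrow P M L)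
      (tarr (Comod R) (tensor_comodule R (Q P N) (Q N M)) (Q P M) (Q M L) (Q M L)
        (compose_arrow P N M) (ident (Comod R) (Q M L))) =
    Comod_cmp (tensor_comodule R (tensor_comodule R (Q P N) (Q N M)) (Q M L))
      (Comod_cmp (tensor_comodule R (Q P N) (tensor_comodule R (Q N M) (Q M L))) (compose_arrow P N L)
        (tarr (Comod R) (Q P N) (Q P N) (tensor_comodule R (Q N M) (Q M L)) (Q N L)
          (ident (Comod R) (Q P N)) (compose_arrow N M L)))
      (assoc_arr (Comod R) (Q P N) (Q N M) (Q M L))"
proof -
  note A = Q[OF o(4,3)] and B = Q[OF o(3,2)] and C = Q[OF o(2,1)]
  note AB = is_comodule_tensor[OF A B] and BC = is_comodule_tensor[OF B C]
  note ABC = is_comodule_tensor[OF AB C] and ABC' = is_comodule_tensor[OF A BC]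
  note l = pull_compose_arrow_tarr[OF o(4,2,1) AB C compose_arrow(1)[OF o(4,3,2)] ident_universal[OF o(2,1)]]
  note r = pull_compose_arrow_tarr[OF o(4,3,1) A BC ident_universal[OF o(4,3)] compose_arrow(1)[OF o(3,2,1)]]
  note assoc = Comod_assoc_closed[OF A B C]
  note r' = Comod_cmp_closed[OF ABC ABC' Q[OF o(4,1)] assoc r(1)]
    pull_Comod_cmp[OF assoc r(1) U[OF o(4,1)] ABC ABC' Q[OF o(4,1)] o(4,1)]
  show ?thesis
    by (rule pull_eqI[OF o(4,1) ABC l(1) r'(1)])
      (simp add: l(2) r'(2) r(2) compose_arrow(2) o pull_ident_universal
        measuring_compose_assoc[OF U[OF o(4,3)] U[OF o(3,2)] U[OF o(2,1)] A B C o(4,3,2,1)])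
qed

lemma compose_arrow_unit_left:
  assumes o: "is_amodule R M" "is_amodule R N"
  shows "Comod_cmp (tensor_comodule R (ring_comodule R) (Q M N)) (compose_arrow M M N)
      (tarr (Comod R) (ring_comodule R) (Q M M) (Q M N) (Q M N) (unit_arrow M) (ident (Comod R) (Q M N))) =
    lunit_arr (Comod R) (Q M N)"
proof -
  note l = pull_compose_arrow_tarr[OF o(1,1,2) is_comodule_ring Q[OF o] unit_arrow(1)[OF o(1)] ident_universal[OF o]]
  show ?thesis
    by (rule pull_eqI[OF o is_comodule_tensor[OF is_comodule_ring Q[OF o]] l(1) Comod_lunit_closed[OF Q[OF o]]])
      (simp add: l(2) unit_arrow(2) o pull_ident_universal measuring_compose_unit_left[OF U[OF o] Q[OF o] o])
qed

lemma compose_arrow_unit_right: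
  assumes o: "is_amodule R M" "is_amodule R N"
  shows "Comod_cmp (tensor_comodule R (Q M N) (ring_comodule R)) (compose_arrow M N N)
      (tarr (Comod R) (Q M N) (Q M N) (ring_comodule R) (Q N N) (ident (Comod R) (Q M N)) (unit_arrow N)) =
    runit_arr (Comod R) (Q M N)"
proof -
  note l = pull_compose_arrow_tarr[OF o(1,2,2) Q[OF o] is_comodule_ring ident_universal[OF o] unit_arrow(1)[OF o(2)]]
  show ?thesis
    by (rule pull_eqI[OF o is_comodule_tensor[OF Q[OF o] is_comodule_ring] l(1) Comod_runit_closed[OF Q[OF o]]])
      (simp add: l(2) unit_arrow(2) o pull_ident_universal measuring_compose_unit_right[OF U[OF o] Q[OF o] o])
qed

lemma enriched_category_Mod: "enriched_category (Comod R) Mod_enriched"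
proof -
  interpret monoidal_category "Comod R" by (rule monoidal_category_Comod)
  show ?thesis
    by unfold_locales (simp_all add: Mod_enriched_simps Comod_simps(1,2,4-6) Q unit_arrow(1) compose_arrow(1)
        compose_arrow_assoc compose_arrow_unit_left compose_arrow_unit_right)
qed

section \<open>The underlying category\<close>

lemma bij_betw_eval_one_pull:
  assumes o: "is_amodule R M" "is_amodule R N"
  shows "bij_betw (\<lambda>p. eval_one M (pull M (ring_comodule R) p (U M N)))
    (Comod_hom R (ring_comodule R) (Q M N)) (Mod_hom R M N)"
  using bij_betw_trans[OF bij_pull[OF o is_comodule_ring] bij_betw_eval_one[OF o]] by (simp add: o_def)

text \<open>On the right the arrow for g is applied first: the comparison takes composition in the
  underlying category to composition in the opposite of \<open>Mod\<close>.\<close>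

lemma eval_one_pull_cmp:
  assumes o: "is_amodule R L" "is_amodule R M" "is_amodule R N"
    and f: "f \<in> Comod_hom R (ring_comodule R) (Q M L)" and g: "g \<in> Comod_hom R (ring_comodule R) (Q N M)"
  shows "eval_one N (pull N (ring_comodule R) (cmp (underlying_category (Comod R) Mod_enriched) L M N g f) (U N L)) =
    Mod_cmp N (eval_one M (pull M (ring_comodule R) f (U M L))) (eval_one N (pull N (ring_comodule R) g (U N M)))"
proof -
  let ?I = "ring_comodule R"
  let ?inv = "inverse_arrow (Comod R) (tensor_comodule R ?I ?I) ?I (lunit_arr (Comod R) ?I)"
  note II = is_comodule_tensor[OF is_comodule_ring is_comodule_ring]
  note QQ = is_comodule_tensor[OF Q[OF o(3,2)] Q[OF o(2,1)]]
  have inv: "?inv \<in> Comod_hom R ?I (tensor_comodule R ?I ?I)"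
    using Comod_lunit_inverse[OF is_comodule_ring] inverse_arrow_eq[OF Comod_lunit_inverse[OF is_comodule_ring] II is_comodule_ring]
    by (simp add: inverse_arrows_def Comod_simps)
  note gf = Comod_tarr_closed[OF is_comodule_ring Q[OF o(3,2)] is_comodule_ring Q[OF o(2,1)] g f]
  note t = pull_compose_arrow_tarr[OF o(3,2,1) is_comodule_ring is_comodule_ring g f]
  have "cmp (underlying_category (Comod R) Mod_enriched) L M N g f =
      Comod_cmp ?I (compose_arrow N M L) (Comod_cmp ?I (tarr (Comod R) ?I (Q N M) ?I (Q M L) g f) ?inv)"
    by (simp add: underlying_category_def Let_def Mod_enriched_simps Comod_simps(4-6))
  \<comment> \<open>Rebracketing brings the tensor product of arrows next to
    \<open>compose_arrow\<close>, the form required by \<open>pull_compose_arrow_tarr\<close>; the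
    inverse unitor remains outside as one pullback.\<close>
  also have "\<dots> = Comod_cmp ?I (Comod_cmp (tensor_comodule R ?I ?I) (compose_arrow N M L)
      (tarr (Comod R) ?I (Q N M) ?I (Q M L) g f)) ?inv"
    using category.cmp_assoc[OF category_Comod, of ?I "tensor_comodule R ?I ?I"
        "tensor_comodule R (Q N M) (Q M L)" "Q N L" ?inv _ "compose_arrow N M L"]
      inv gf compose_arrow(1)[OF o(3,2,1)] II QQ Q[OF o(3,1)]
    by (simp add: Comod_simps(1,2,4) is_comodule_ring)
  finally show ?thesis
    using pull_Comod_cmp[OF inv t(1) U[OF o(3,1)] is_comodule_ring II Q[OF o(3,1)] o(3,1)]
      eval_one_compose[OF pull_closed[OF g U[OF o(3,2)] is_comodule_ring Q[OF o(3,2)] o(3,2)]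
        pull_closed[OF f U[OF o(2,1)] is_comodule_ring Q[OF o(2,1)] o(2,1)] o(3,2,1)]
    by (simp add: t(2))
qed

lemma underlying_Mod_enriched:
  "isomorphic_over_objects (underlying_category (Comod R) Mod_enriched) (opposite (Mod R))"
proof -
  let ?K = "underlying_category (Comod R) Mod_enriched"
  let ?F = "\<lambda>M N p. eval_one N (pull N (ring_comodule R) p (U N M))"
  have K: "objs ?K = {M. is_amodule R M}" "\<And>M N. arrs ?K M N = Comod_hom R (ring_comodule R) (Q N M)"
    "ident ?K = unit_arrow"
    by (simp_all add: underlying_category_def Let_def Mod_enriched_simps Comod_simps(2,5))
  have D: "objs (opposite (Mod R)) = {M. is_amodule R M}" "\<And>M N. arrs (opposite (Mod R)) M N = Mod_hom R N M"
    "\<And>M. ident (opposite (Mod R)) M = (idm (nmod M), idm (alg M))"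
    "\<And>L M N g f. cmp (opposite (Mod R)) L M N g f = Mod_cmp N f g"
    by (simp_all add: opposite_def Mod_def)
  show ?thesis
    unfolding isomorphic_over_objects_def K D
    by (intro conjI exI[of _ ?F] ballI refl)
      (simp_all add: bij_betw_eval_one_pull unit_arrow(2) eval_one_unit eval_one_pull_cmp)
qed

end

theorem proposition7p1:
  fixes R :: "('u, 'z) ring_scheme"
    and Q :: "('u, 'a, 'm) amodule \<Rightarrow> ('u, 'a, 'm) amodule \<Rightarrow> 'u comodule"
  assumes "cring R"
    and "infinite (UNIV :: 'u set)"
    and "\<And>M N. M \<in> objs (Mod R) \<Longrightarrow> N \<in> objs (Mod R) \<Longrightarrow>
           universal_measuring_comodule R M N (Q M N)"
  shows "\<exists>K :: (('u, 'a, 'm) amodule, 'u comodule, ('u \<Rightarrow> 'u) \<times> ('u \<Rightarrow> 'u)) enriched_category.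
           enriched_category (Comod R) K \<and>
           eobjs K = objs (opposite (Mod R)) \<and>
           (\<forall>M\<in>eobjs K. \<forall>N\<in>eobjs K. ehom K M N = Q N M) \<and>
           isomorphic_over_objects (underlying_category (Comod R) K) (opposite (Mod R))"
proof -
  interpret tensor_products R
    by (intro tensor_products.intro tensor_products_axioms.intro assms)
  have umc: "universal_measuring_comodule R M N (Q M N)" if "is_amodule R M" "is_amodule R N" for M N
    using assms(3) that by (simp add: Mod_def)
  have "\<exists>u. u \<in> measurings (Q M N) M N \<and> (\<forall>X. is_comodule R X \<longrightarrow>
      bij_betw (\<lambda>p. pull M X p u) (Comod_hom R X (Q M N)) (measurings X M N))"
    if "is_amodule R M" "is_amodule R N" for M N
    using universal_measuring[OF umc[OF that] that] by metis
  \<comment> \<open>One universal measuring is chosen for every pair at once. Representability gives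
    them separately for each pair of modules, while composition relates several pairs.\<close>
  then obtain U where U: "\<And>M N. \<lbrakk>is_amodule R M; is_amodule R N\<rbrakk> \<Longrightarrow> U M N \<in> measurings (Q M N) M N"
    "\<And>M N X. \<lbrakk>is_amodule R M; is_amodule R N; is_comodule R X\<rbrakk> \<Longrightarrow>
      bij_betw (\<lambda>p. pull M X p (U M N)) (Comod_hom R X (Q M N)) (measurings X M N)"
    by metis
  have "is_comodule R (Q M N)" if "is_amodule R M" "is_amodule R N" for M N
    using umc[OF that] by (simp add: universal_measuring_comodule_def Comod_simps)
  then interpret universal_measurings R Q U
    using U by unfold_locales
  show ?thesis
    using enriched_category_Mod underlying_Mod_enriched
    by (intro exI[of _ Mod_enriched]) (simp add: Mod_enriched_simps opposite_def Mod_def)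
qed

end
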